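(* Let $(X,d,\ll,\leq,\tau)$ be a Lorentzian pre-length space that is globally hyperbolic, strongly causal, locally causally closed, timelike path-connected, and regular. Suppose that $X$ has timelike curvature bounded above by $0$ in the sense of timelike triangle comparison, and let $\gamma\in\mathrm{TGeo}(X)$. Then there exists a timelike family about $\gamma$ that is continuous at $\gamma$. This family is unique among timelike families about $\gamma$ that are continuous at $\gamma$. In particular, the endpoints of $\gamma$ are reachable along $\gamma$ (and are thus not ultimate conjugate along $\gamma$).
   Context: A Lorentzian pre-length space $(X,d,\ll,\leq,\tau)$ consists of a metric space $(X,d)$, transitive relations $\ll,\leq$ on $X$ with $\leq$ reflexive and containing $\ll$, and a lower semicontinuous $\tau\colon X\times X\to[0,\infty]$ vanishing outside $\leq$, with $x\ll y\iff\tau(x,y)>0$ and $\tau(x,z)\ge\tau(x,y)+\tau(y,z)$ for $x\le y\le z$. Put $I(x,y)=\{z: x\ll z\ll y\}$, $J(x,y)=\{z:x\le z\le y\}$. A future-directed timelike (causal) curve is a $d$-Lipschitz, nowhere constant map $\gamma\colon[a,b]\to X$ (not constant on any non-trivial subinterval) with $\gamma(t_1)\ll\gamma(t_2)$ ($\gamma(t_1)\le\gamma(t_2)$) for $t_1<t_2$. A causal curve is null if no two of its points are $\ll$-related. $L_\tau(\gamma)=\inf\sum_i\tau(\gamma(t_i),\gamma(t_{i+1}))$ over partitions of $[a,b]$. $\gamma$ is a maximizer if $L_\tau(\gamma)=\tau(\gamma(a),\gamma(b))$. A geodesic is a causal curve $\gamma\colon I\to X$ such that each $t\in I$ has a neighborhood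 $[a,b]$ in $I$ on which $\gamma$ is a maximizer. Globally hyperbolic: $d$-lengths of causal curves contained in any given compact set are uniformly bounded, and $J(x,y)$ is compact for all $x,y$. Strongly causal: the topology generated by the subbase $\{I(x,y)\}$ is the metric topology. Locally causally closed: every point has a neighborhood $U$ such that $p_n,q_n\in U$, $p_n\le q_n$, $p_n\to p\in\bar U$, $q_n\to q\in\bar U$ imply $p\le q$. Timelike path-connected: any two points $x\ll y$ are joined by a timelike curve. Regular: every maximizer between two timelike related points is timelike, i.e. contains no null subsegment. Timelike curvature bounded above by $0$: every point has a neighborhood $U$ such that (1) $U^2\cap\tau^{-1}([0,\infty))$ is open in $X^2$ and $\tau$ is continuous and finite-valued on it; (2) whenever $x\le y$, $x\ne y$, $x,y\in U$ and $\tau(x,y)<\infty$, there is a maximizer in $U$ from $x$ to $y$; (3) for every timelike triangle $\Delta(x,y,z)$ in $U$ (i.e. $x\ll y\ll z$ together with timelike maximizers in $U$ between them) with $\tau(x,z)<\infty$ and comparison triangle $\Delta(\bar x,\bar y,\bar z)$ with equal side lengths in the two-dimensional Minkowski spacetime with time separation $\bar\tau$, and for all points $p,q$ on the sides of $\Delta(x,y,z)$ with corresponding points $\bar p,\bar q$ (same time separations to the endpoints of their sides), $\tau(p,q)\ge\bar\tau(\bar p,\bar q)$. (This bound makes all $\tau$-lengths of causal curve segments finite.) $\mathrm{TGeo}(X)$ is the set of future-directed timelike geodesic segments $[0,1]\to X$ modulo strictly increasing surjective reparametrizations of $[0,1]$. On it, $d_F(\gamma,\sigma)=\inf_{\varphi,\psi}\max_{t}d(\gamma(\varphi(t)),\sigma(\psi(t)))$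 over strictly increasing surjective $\varphi,\psi\colon[0,1]\to[0,1]$, and $d_\Gamma(\gamma,\sigma)=d_F(\gamma,\sigma)+|L_\tau(\gamma)-L_\tau(\sigma)|$. Let $\gamma\in\mathrm{TGeo}(X)$ go from $p$ to $q$. A timelike family about $\gamma$ is a map $F\colon U\times V\to\mathrm{TGeo}(X)$, $U,V$ neighborhoods of $p,q$ with $p'\ll q'$ for all $p'\in U$, $q'\in V$, such that $F(p',q')$ goes from $p'$ to $q'$ and $F(p,q)=\gamma$. It is continuous at $\gamma$ if it is continuous (w.r.t. $d_\Gamma$) at $(p,q)$. It is unique among timelike families about $\gamma$ continuous at $\gamma$ if any other such family $F'\colon U'\times V'\to \mathrm{TGeo}(X)$ agrees with $F$ on $U''\times V''$ for some neighborhoods $U''\subseteq U\cap U'$ of $p$, $V''\subseteq V\cap V'$ of $q$. $p,q$ are reachable along $\gamma$ if there is a timelike family about $\gamma$ continuous at $\gamma$; otherwise they are unreachable conjugate. They are symmetrically conjugate along $\gamma$ if there are $p_i\to p$, $q_i\to q$ and distinct $\gamma_i\neq\sigma_i\in\mathrm{TGeo}(X)$ from $p_i$ to $q_i$ with $\gamma_i,\sigma_i\to\gamma$ w.r.t. $d_\Gamma$. They are ultimate conjugate if they are unreachable conjugate or symmetrically conjugate along $\gamma$. *)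

theory Defs
  imports "HOL-Analysis.Analysis"
begin

section \<open>Lorentzian pre-length spaces\<close>

text \<open>The underlying metric space is the type \<open>'a\<close>, of class \<open>metric_space\<close>; the record
  carries the remaining structure.\<close>

record 'a causal_space =
  chron :: "'a \<Rightarrow> 'a \<Rightarrow> bool"  (infix \<open>\<lless>\<index>\<close> 50)
  causal :: "'a \<Rightarrow> 'a \<Rightarrow> bool"  (infix \<open>\<preceq>\<index>\<close> 50)
  tsep :: "'a \<Rightarrow> 'a \<Rightarrow> ennreal"  (\<open>\<tau>\<index>\<close>)

definition lorentzian_pre_length_space :: "'a::metric_space causal_space \<Rightarrow> bool" where
  "lorentzian_pre_length_space X \<longleftrightarrow>
     transp (chron X) \<and> transp (causal X) \<and> reflp (causal X) \<and>
     (\<forall>x y. x \<lless>\<^bsub>X\<^esub> y \<longrightarrow> x \<preceq>\<^bsub>X\<^esub> y) \<and>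
     (\<forall>c. open {(x, y). c < \<tau>\<^bsub>X\<^esub> x y}) \<and>
     (\<forall>x y. \<not> x \<preceq>\<^bsub>X\<^esub> y \<longrightarrow> \<tau>\<^bsub>X\<^esub> x y = 0) \<and>
     (\<forall>x y. x \<lless>\<^bsub>X\<^esub> y \<longleftrightarrow> \<tau>\<^bsub>X\<^esub> x y > 0) \<and>
     (\<forall>x y z. x \<preceq>\<^bsub>X\<^esub> y \<longrightarrow> y \<preceq>\<^bsub>X\<^esub> z \<longrightarrow> \<tau>\<^bsub>X\<^esub> x z \<ge> \<tau>\<^bsub>X\<^esub> x y + \<tau>\<^bsub>X\<^esub> y z)"

definition chron_diamond :: "'a causal_space \<Rightarrow> 'a \<Rightarrow> 'a \<Rightarrow> 'a set" where
  "chron_diamond X x y = {z. x \<lless>\<^bsub>X\<^esub> z \<and> z \<lless>\<^bsub>X\<^esub> y}"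

definition causal_diamond :: "'a causal_space \<Rightarrow> 'a \<Rightarrow> 'a \<Rightarrow> 'a set" where
  "causal_diamond X x y = {z. x \<preceq>\<^bsub>X\<^esub> z \<and> z \<preceq>\<^bsub>X\<^esub> y}"

section \<open>Curves\<close>

text \<open>A curve on \<open>[a, b]\<close> is a total function on \<open>real\<close> of which only the values on
  \<open>{a..b}\<close> are used. All causal curves are future-directed.\<close>

definition lipschitz_nowhere_constant :: "(real \<Rightarrow> 'a::metric_space) \<Rightarrow> real \<Rightarrow> real \<Rightarrow> bool" where
  "lipschitz_nowhere_constant \<gamma> a b \<longleftrightarrow>
     a < b \<and> (\<exists>L. L-lipschitz_on {a..b} \<gamma>) \<and>
     (\<forall>s t. a \<le> s \<longrightarrow> s < t \<longrightarrow> t \<le> b \<longrightarrow> \<not> \<gamma> constant_on {s..t})"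

definition timelike_curve ::
  "'a::metric_space causal_space \<Rightarrow> (real \<Rightarrow> 'a) \<Rightarrow> real \<Rightarrow> real \<Rightarrow> bool" where
  "timelike_curve X \<gamma> a b \<longleftrightarrow> lipschitz_nowhere_constant \<gamma> a b \<and>
     (\<forall>s t. a \<le> s \<longrightarrow> s < t \<longrightarrow> t \<le> b \<longrightarrow> \<gamma> s \<lless>\<^bsub>X\<^esub> \<gamma> t)"

definition causal_curve ::
  "'a::metric_space causal_space \<Rightarrow> (real \<Rightarrow> 'a) \<Rightarrow> real \<Rightarrow> real \<Rightarrow> bool" where
  "causal_curve X \<gamma> a b \<longleftrightarrow> lipschitz_nowhere_constant \<gamma> a b \<and>
     (\<forall>s t. a \<le> s \<longrightarrow> s < t \<longrightarrow> t \<le> b \<longrightarrow> \<gamma> s \<preceq>\<^bsub>X\<^esub> \<gamma> t)"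

text \<open>\<open>(n, t)\<close> stands for the partition \<open>a = t 0 < t 1 < \<dots> < t n = b\<close>.\<close>

definition partitions :: "real \<Rightarrow> real \<Rightarrow> (nat \<times> (nat \<Rightarrow> real)) set" where
  "partitions a b = {(n, t). t 0 = a \<and> t n = b \<and> (\<forall>i<n. t i < t (Suc i))}"

definition d_length :: "(real \<Rightarrow> 'a::metric_space) \<Rightarrow> real \<Rightarrow> real \<Rightarrow> ennreal" where
  "d_length \<gamma> a b =
     (SUP (n, t) \<in> partitions a b. \<Sum>i<n. ennreal (dist (\<gamma> (t i)) (\<gamma> (t (Suc i)))))"

definition tau_length :: "'a causal_space \<Rightarrow> (real \<Rightarrow> 'a) \<Rightarrow> real \<Rightarrow> real \<Rightarrow> ennreal" where
  "tau_length X \<gamma> a b =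
     (INF (n, t) \<in> partitions a b. \<Sum>i<n. \<tau>\<^bsub>X\<^esub> (\<gamma> (t i)) (\<gamma> (t (Suc i))))"

definition maximizer ::
  "'a::metric_space causal_space \<Rightarrow> (real \<Rightarrow> 'a) \<Rightarrow> real \<Rightarrow> real \<Rightarrow> bool" where
  "maximizer X \<gamma> a b \<longleftrightarrow>
     causal_curve X \<gamma> a b \<and> tau_length X \<gamma> a b = \<tau>\<^bsub>X\<^esub> (\<gamma> a) (\<gamma> b)"

definition geodesic ::
  "'a::metric_space causal_space \<Rightarrow> (real \<Rightarrow> 'a) \<Rightarrow> real \<Rightarrow> real \<Rightarrow> bool" where
  "geodesic X \<gamma> A B \<longleftrightarrow> causal_curve X \<gamma> A B \<and>
     (\<forall>t\<in>{A..B}. \<exists>a b. {a..b} \<subseteq> {A..B} \<and> (\<exists>e>0. ball t e \<inter> {A..B} \<subseteq> {a..b}) \<and>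
        maximizer X \<gamma> a b)"

section \<open>Assumptions on the space\<close>

definition globally_hyperbolic :: "'a::metric_space causal_space \<Rightarrow> bool" where
  "globally_hyperbolic X \<longleftrightarrow>
     (\<forall>K. compact K \<longrightarrow>
        (\<exists>C::real. \<forall>\<gamma> a b. causal_curve X \<gamma> a b \<longrightarrow> \<gamma> ` {a..b} \<subseteq> K \<longrightarrow>
           d_length \<gamma> a b \<le> ennreal C)) \<and>
     (\<forall>x y. compact (causal_diamond X x y))"

definition strongly_causal :: "'a::metric_space causal_space \<Rightarrow> bool" where
  "strongly_causal X \<longleftrightarrow>
     generate_topology {S. \<exists>x y. S = chron_diamond X x y} = (open :: 'a set \<Rightarrow> bool)"

text \<open>Neighborhoods need not be open: \<open>U\<close> is a neighborhood of \<open>x\<close> iff \<open>x \<in> interior U\<close>.\<close>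

definition locally_causally_closed :: "'a::metric_space causal_space \<Rightarrow> bool" where
  "locally_causally_closed X \<longleftrightarrow>
     (\<forall>x. \<exists>U. x \<in> interior U \<and>
        (\<forall>P Q p q. (\<forall>n::nat. P n \<in> U \<and> Q n \<in> U \<and> P n \<preceq>\<^bsub>X\<^esub> Q n) \<longrightarrow>
           P \<longlonglongrightarrow> p \<longrightarrow> p \<in> closure U \<longrightarrow> Q \<longlonglongrightarrow> q \<longrightarrow> q \<in> closure U \<longrightarrow> p \<preceq>\<^bsub>X\<^esub> q))"

definition timelike_path_connected :: "'a::metric_space causal_space \<Rightarrow> bool" where
  "timelike_path_connected X \<longleftrightarrow>
     (\<forall>x y. x \<lless>\<^bsub>X\<^esub> y \<longrightarrow> (\<exists>\<gamma> a b. timelike_curve X \<gamma> a b \<and> \<gamma> a = x \<and> \<gamma> b = y))"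

text \<open>By push-up (\<open>x \<preceq> y \<lless> z \<preceq> w\<close> implies \<open>x \<lless> w\<close>, from the reverse triangle inequality)
  a causal curve is timelike iff no non-trivial subsegment of it is null.\<close>

definition regular :: "'a::metric_space causal_space \<Rightarrow> bool" where
  "regular X \<longleftrightarrow>
     (\<forall>\<gamma> a b. maximizer X \<gamma> a b \<longrightarrow> \<gamma> a \<lless>\<^bsub>X\<^esub> \<gamma> b \<longrightarrow> timelike_curve X \<gamma> a b)"

section \<open>Timelike curvature bounded above by 0\<close>

text \<open>Two-dimensional Minkowski spacetime: points are pairs of a time and a space coordinate.\<close>

definition minkowski_sep :: "real \<times> real \<Rightarrow> real \<times> real \<Rightarrow> real" where
  "minkowski_sep p q =
     (if \<bar>snd q - snd p\<bar> \<le> fst q - fst p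
      then sqrt ((fst q - fst p)\<^sup>2 - (snd q - snd p)\<^sup>2) else 0)"

definition comparison_triangle ::
  "'a causal_space \<Rightarrow> 'a \<Rightarrow> 'a \<Rightarrow> 'a \<Rightarrow> real \<times> real \<Rightarrow> real \<times> real \<Rightarrow> real \<times> real \<Rightarrow> bool" where
  "comparison_triangle X x y z x' y' z' \<longleftrightarrow>
     ennreal (minkowski_sep x' y') = \<tau>\<^bsub>X\<^esub> x y \<and>
     ennreal (minkowski_sep y' z') = \<tau>\<^bsub>X\<^esub> y z \<and>
     ennreal (minkowski_sep x' z') = \<tau>\<^bsub>X\<^esub> x z"

text \<open>\<open>timelike_side X U S x y\<close>: the set \<open>S\<close> is the image of a timelike maximizer in \<open>U\<close>
  from \<open>x\<close> to \<open>y\<close>.\<close>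

definition timelike_side ::
  "'a::metric_space causal_space \<Rightarrow> 'a set \<Rightarrow> 'a set \<Rightarrow> 'a \<Rightarrow> 'a \<Rightarrow> bool" where
  "timelike_side X U S x y \<longleftrightarrow>
     (\<exists>\<alpha> a b. timelike_curve X \<alpha> a b \<and> maximizer X \<alpha> a b \<and> \<alpha> a = x \<and> \<alpha> b = y \<and>
        S = \<alpha> ` {a..b} \<and> S \<subseteq> U)"

text \<open>The point \<open>p\<close> on the side \<open>S\<close> from \<open>x\<close> to \<open>y\<close> corresponds to the point \<open>p'\<close> on the
  straight segment from \<open>x'\<close> to \<open>y'\<close>.\<close>

definition corresponding ::
  "'a causal_space \<Rightarrow> 'a set \<Rightarrow> 'a \<Rightarrow> 'a \<Rightarrow> real \<times> real \<Rightarrow> real \<times> real \<Rightarrow> 'a \<Rightarrow> real \<times> real \<Rightarrow> bool"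
  where
  "corresponding X S x y x' y' p p' \<longleftrightarrow>
     p \<in> S \<and> p' \<in> closed_segment x' y' \<and>
     \<tau>\<^bsub>X\<^esub> x p = ennreal (minkowski_sep x' p') \<and>
     \<tau>\<^bsub>X\<^esub> p y = ennreal (minkowski_sep p' y')"

definition corresponding_on_triangle ::
  "'a causal_space \<Rightarrow> 'a set \<Rightarrow> 'a set \<Rightarrow> 'a set \<Rightarrow> 'a \<Rightarrow> 'a \<Rightarrow> 'a \<Rightarrow>
   real \<times> real \<Rightarrow> real \<times> real \<Rightarrow> real \<times> real \<Rightarrow> 'a \<Rightarrow> real \<times> real \<Rightarrow> bool" where
  "corresponding_on_triangle X Sxy Syz Sxz x y z x' y' z' p p' \<longleftrightarrow>
     corresponding X Sxy x y x' y' p p' \<or>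
     corresponding X Syz y z y' z' p p' \<or>
     corresponding X Sxz x z x' z' p p'"

text \<open>On the set \<open>{\<tau> < \<infinity>}\<close> in the first clause \<open>\<tau>\<close> is finite-valued by definition. Comparison
  triangles exist for all side lengths satisfying the reverse triangle inequality and are unique
  up to isometry, so quantifying over all of them is not vacuous.\<close>

definition comparison_neighborhood :: "'a::metric_space causal_space \<Rightarrow> 'a set \<Rightarrow> bool" where
  "comparison_neighborhood X U \<longleftrightarrow>
     (let D = (U \<times> U) \<inter> {(x, y). \<tau>\<^bsub>X\<^esub> x y < \<infinity>}
      in open D \<and> continuous_on D (\<lambda>(x, y). \<tau>\<^bsub>X\<^esub> x y)) \<and>
     (\<forall>x\<in>U. \<forall>y\<in>U. x \<preceq>\<^bsub>X\<^esub> y \<longrightarrow> x \<noteq> y \<longrightarrow> \<tau>\<^bsub>X\<^esub> x y < \<infinity> \<longrightarrow>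
        (\<exists>\<alpha> a b. maximizer X \<alpha> a b \<and> \<alpha> a = x \<and> \<alpha> b = y \<and> \<alpha> ` {a..b} \<subseteq> U)) \<and>
     (\<forall>x y z Sxy Syz Sxz x' y' z' p q p' q'.
        x \<lless>\<^bsub>X\<^esub> y \<longrightarrow> y \<lless>\<^bsub>X\<^esub> z \<longrightarrow> \<tau>\<^bsub>X\<^esub> x z < \<infinity> \<longrightarrow>
        timelike_side X U Sxy x y \<longrightarrow> timelike_side X U Syz y z \<longrightarrow> timelike_side X U Sxz x z \<longrightarrow>
        comparison_triangle X x y z x' y' z' \<longrightarrow>
        corresponding_on_triangle X Sxy Syz Sxz x y z x' y' z' p p' \<longrightarrow>
        corresponding_on_triangle X Sxy Syz Sxz x y z x' y' z' q q' \<longrightarrow>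
        \<tau>\<^bsub>X\<^esub> p q \<ge> ennreal (minkowski_sep p' q'))"

definition timelike_curvature_bounded_above_0 :: "'a::metric_space causal_space \<Rightarrow> bool" where
  "timelike_curvature_bounded_above_0 X \<longleftrightarrow>
     (\<forall>x. \<exists>U. x \<in> interior U \<and> comparison_neighborhood X U)"

section \<open>The space of timelike geodesics\<close>

definition reparam :: "(real \<Rightarrow> real) \<Rightarrow> bool" where
  "reparam \<phi> \<longleftrightarrow> strict_mono_on {0..1} \<phi> \<and> \<phi> ` {0..1} = {0..1}"

definition timelike_geodesics :: "'a::metric_space causal_space \<Rightarrow> (real \<Rightarrow> 'a) set" where
  "timelike_geodesics X = {\<gamma>. timelike_curve X \<gamma> 0 1 \<and> geodesic X \<gamma> 0 1}"

definition reparam_rel ::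
  "'a::metric_space causal_space \<Rightarrow> ((real \<Rightarrow> 'a) \<times> (real \<Rightarrow> 'a)) set" where
  "reparam_rel X = {(\<gamma>, \<sigma>). \<gamma> \<in> timelike_geodesics X \<and> \<sigma> \<in> timelike_geodesics X \<and>
     (\<exists>\<phi>. reparam \<phi> \<and> (\<forall>t\<in>{0..1}. \<sigma> t = \<gamma> (\<phi> t)))}"

definition TGeo :: "'a::metric_space causal_space \<Rightarrow> (real \<Rightarrow> 'a) set set" where
  "TGeo X = timelike_geodesics X // reparam_rel X"

text \<open>Endpoints, \<open>\<tau>\<close>-length and \<open>d\<^sub>F\<close> of classes are evaluated on representatives; they
  do not depend on the choice (lemmas \<open>source_class\<close> to \<open>d_F_class\<close> below).\<close>

definition rep :: "(real \<Rightarrow> 'a) set \<Rightarrow> real \<Rightarrow> 'a" where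
  "rep g = (SOME \<gamma>. \<gamma> \<in> g)"

definition source :: "(real \<Rightarrow> 'a) set \<Rightarrow> 'a" where
  "source g = rep g 0"

definition target :: "(real \<Rightarrow> 'a) set \<Rightarrow> 'a" where
  "target g = rep g 1"

definition len :: "'a causal_space \<Rightarrow> (real \<Rightarrow> 'a) set \<Rightarrow> ennreal" where
  "len X g = tau_length X (rep g) 0 1"

definition frechet_dist :: "(real \<Rightarrow> 'a::metric_space) \<Rightarrow> (real \<Rightarrow> 'a) \<Rightarrow> real" where
  "frechet_dist \<gamma> \<sigma> = (INF (\<phi>, \<psi>) \<in> Collect reparam \<times> Collect reparam.
      SUP t\<in>{0..1}. dist (\<gamma> (\<phi> t)) (\<sigma> (\<psi> t)))"

definition d_F :: "(real \<Rightarrow> 'a::metric_space) set \<Rightarrow> (real \<Rightarrow> 'a) set \<Rightarrow> real" where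
  "d_F g h = frechet_dist (rep g) (rep h)"

text \<open>Extended-real valued because \<open>\<tau>\<close>-lengths may a priori be infinite. They are finite
  under the curvature bound, so the convention for \<open>\<infinity> - \<infinity>\<close> is irrelevant there.\<close>

definition d_Gamma ::
  "'a::metric_space causal_space \<Rightarrow> (real \<Rightarrow> 'a) set \<Rightarrow> (real \<Rightarrow> 'a) set \<Rightarrow> ereal" where
  "d_Gamma X g h = ereal (d_F g h) + \<bar>enn2ereal (len X g) - enn2ereal (len X h)\<bar>"

section \<open>Timelike families and conjugate points\<close>

text \<open>Only the values of \<open>F\<close> on \<open>U \<times> V\<close> matter.\<close>

definition timelike_family ::
  "'a::metric_space causal_space \<Rightarrow> (real \<Rightarrow> 'a) set \<Rightarrow> 'a set \<Rightarrow> 'a set \<Rightarrow>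
   ('a \<times> 'a \<Rightarrow> (real \<Rightarrow> 'a) set) \<Rightarrow> bool" where
  "timelike_family X g U V F \<longleftrightarrow>
     source g \<in> interior U \<and> target g \<in> interior V \<and>
     (\<forall>p'\<in>U. \<forall>q'\<in>V. p' \<lless>\<^bsub>X\<^esub> q' \<and>
        F (p', q') \<in> TGeo X \<and> source (F (p', q')) = p' \<and> target (F (p', q')) = q') \<and>
     F (source g, target g) = g"

definition family_continuous_at ::
  "'a::metric_space causal_space \<Rightarrow> (real \<Rightarrow> 'a) set \<Rightarrow> 'a set \<Rightarrow> 'a set \<Rightarrow>
   ('a \<times> 'a \<Rightarrow> (real \<Rightarrow> 'a) set) \<Rightarrow> bool" where
  "family_continuous_at X g U V F \<longleftrightarrow>
     (\<forall>e>0. \<exists>\<delta>>0. \<forall>p'\<in>U. \<forall>q'\<in>V. dist p' (source g) < \<delta> \<longrightarrow> dist q' (target g) < \<delta> \<longrightarrow>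
        d_Gamma X (F (p', q')) g < ereal e)"

definition unique_continuous_family ::
  "'a::metric_space causal_space \<Rightarrow> (real \<Rightarrow> 'a) set \<Rightarrow> 'a set \<Rightarrow> 'a set \<Rightarrow>
   ('a \<times> 'a \<Rightarrow> (real \<Rightarrow> 'a) set) \<Rightarrow> bool" where
  "unique_continuous_family X g U V F \<longleftrightarrow>
     (\<forall>U' V' F'. timelike_family X g U' V' F' \<longrightarrow> family_continuous_at X g U' V' F' \<longrightarrow>
        (\<exists>U'' V''. U'' \<subseteq> U \<inter> U' \<and> V'' \<subseteq> V \<inter> V' \<and>
           source g \<in> interior U'' \<and> target g \<in> interior V'' \<and>
           (\<forall>p'\<in>U''. \<forall>q'\<in>V''. F (p', q') = F' (p', q'))))"

definition reachable_along :: "'a::metric_space causal_space \<Rightarrow> (real \<Rightarrow> 'a) set \<Rightarrow> bool" where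
  "reachable_along X g \<longleftrightarrow>
     (\<exists>U V F. timelike_family X g U V F \<and> family_continuous_at X g U V F)"

definition unreachable_conjugate_along ::
  "'a::metric_space causal_space \<Rightarrow> (real \<Rightarrow> 'a) set \<Rightarrow> bool" where
  "unreachable_conjugate_along X g \<longleftrightarrow> \<not> reachable_along X g"

definition symmetrically_conjugate_along ::
  "'a::metric_space causal_space \<Rightarrow> (real \<Rightarrow> 'a) set \<Rightarrow> bool" where
  "symmetrically_conjugate_along X g \<longleftrightarrow>
     (\<exists>(P::nat \<Rightarrow> 'a) Q G S. P \<longlonglongrightarrow> source g \<and> Q \<longlonglongrightarrow> target g \<and>
        (\<forall>i. G i \<in> TGeo X \<and> S i \<in> TGeo X \<and> G i \<noteq> S i \<and>
           source (G i) = P i \<and> target (G i) = Q i \<and>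
           source (S i) = P i \<and> target (S i) = Q i) \<and>
        (\<lambda>i. d_Gamma X (G i) g) \<longlonglongrightarrow> 0 \<and> (\<lambda>i. d_Gamma X (S i) g) \<longlonglongrightarrow> 0)"

definition ultimate_conjugate_along ::
  "'a::metric_space causal_space \<Rightarrow> (real \<Rightarrow> 'a) set \<Rightarrow> bool" where
  "ultimate_conjugate_along X g \<longleftrightarrow>
     unreachable_conjugate_along X g \<or> symmetrically_conjugate_along X g"

section \<open>Independence of representatives\<close>

lemma reparam_id: "reparam (\<lambda>t. t)"
  by (auto simp: reparam_def strict_mono_on_def)

lemma reparam_mem: "reparam \<phi> \<Longrightarrow> t \<in> {0..1} \<Longrightarrow> \<phi> t \<in> {0..1}"
  unfolding reparam_def by blast

lemma reparam_comp:
  assumes "reparam \<phi>" "reparam \<psi>"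
  shows "reparam (\<lambda>t. \<phi> (\<psi> t))"
proof -
  have "(\<lambda>t. \<phi> (\<psi> t)) ` {0..1} = \<phi> ` (\<psi> ` {0..1})" by (simp add: image_image)
  then show ?thesis
    using assms reparam_mem[OF assms(2)] unfolding reparam_def strict_mono_on_def by auto
qed

lemma reparam_inverse:
  assumes "reparam \<phi>"
  obtains \<psi> where "reparam \<psi>" "\<And>t. t \<in> {0..1} \<Longrightarrow> \<phi> (\<psi> t) = t" "\<And>t. t \<in> {0..1} \<Longrightarrow> \<psi> (\<phi> t) = t"
proof -
  let ?\<psi> = "inv_into {0..1} \<phi>"
  have sm: "strict_mono_on {0..1} \<phi>" and im: "\<phi> ` {0..1} = {0..1}"
    using assms by (auto simp: reparam_def)
  have inj: "inj_on \<phi> {0..1}" using sm by (rule strict_mono_on_imp_inj_on)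
  have r: "\<phi> (?\<psi> t) = t" if "t \<in> {0..1}" for t using that im by (metis f_inv_into_f)
  have l: "?\<psi> (\<phi> t) = t" if "t \<in> {0..1}" for t using that inj by simp
  have m: "?\<psi> t \<in> {0..1}" if "t \<in> {0..1}" for t using that im by (metis inv_into_into)
  have im': "?\<psi> ` {0..1} = {0..1}"
  proof
    show "?\<psi> ` {0..1} \<subseteq> {0..1}" using m by blast
    show "{0..1} \<subseteq> ?\<psi> ` {0..1}"
      using l reparam_mem[OF assms] by (metis image_eqI subsetI)
  qed
  have "strict_mono_on {0..1} ?\<psi>"
  proof (rule strict_mono_onI)
    fix s t :: real assume s: "s \<in> {0..1}" and t: "t \<in> {0..1}" and "s < t"
    show "?\<psi> s < ?\<psi> t"
    proof (rule ccontr)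
      assume "\<not> ?\<psi> s < ?\<psi> t"
      then have "?\<psi> t \<le> ?\<psi> s" by simp
      then have "\<phi> (?\<psi> t) \<le> \<phi> (?\<psi> s)"
        using sm m[OF s] m[OF t] by (metis strict_mono_on_leD)
      then show False using r[OF s] r[OF t] \<open>s < t\<close> by simp
    qed
  qed
  then show ?thesis using that[of ?\<psi>] r l im' by (simp add: reparam_def)
qed

lemma reparam_endpoints:
  assumes "reparam \<phi>" shows "\<phi> 0 = 0" "\<phi> 1 = 1"
proof -
  have le: "\<phi> s \<le> \<phi> t" if "s \<in> {0..1}" "t \<in> {0..1}" "s \<le> t" for s t
    using assms that unfolding reparam_def by (metis strict_mono_on_leD)
  obtain \<psi> where \<psi>: "reparam \<psi>" "\<And>t. t \<in> {0..1} \<Longrightarrow> \<phi> (\<psi> t) = t"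
    using reparam_inverse[OF assms] by metis
  have "\<phi> 0 \<le> \<phi> (\<psi> 0)" "\<phi> (\<psi> 1) \<le> \<phi> 1"
    using reparam_mem[OF \<psi>(1), of 0] reparam_mem[OF \<psi>(1), of 1] by (auto intro!: le)
  moreover have "\<phi> 0 \<in> {0..1}" "\<phi> 1 \<in> {0..1}" using reparam_mem[OF assms] by auto
  ultimately show "\<phi> 0 = 0" "\<phi> 1 = 1" using \<psi>(2)[of 0] \<psi>(2)[of 1] by auto
qed

lemma equiv_reparam_rel: "equiv (timelike_geodesics X) (reparam_rel X)"
proof (rule equivI)
  show "reparam_rel X \<subseteq> timelike_geodesics X \<times> timelike_geodesics X"
    by (auto simp: reparam_rel_def)
  show "refl_on (timelike_geodesics X) (reparam_rel X)"
    by (auto simp: refl_on_def reparam_rel_def intro!: exI[of _ "\<lambda>t. t"] reparam_id)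
  show "sym (reparam_rel X)"
  proof (rule symI)
    fix \<gamma> \<sigma> assume *: "(\<gamma>, \<sigma>) \<in> reparam_rel X"
    then obtain \<phi> where \<phi>: "reparam \<phi>" "\<And>t. t \<in> {0..1} \<Longrightarrow> \<sigma> t = \<gamma> (\<phi> t)"
      by (auto simp: reparam_rel_def)
    obtain \<psi> where \<psi>: "reparam \<psi>" "\<And>t. t \<in> {0..1} \<Longrightarrow> \<phi> (\<psi> t) = t"
      using reparam_inverse[OF \<phi>(1)] by metis
    have "\<gamma> t = \<sigma> (\<psi> t)" if "t \<in> {0..1}" for t
      using \<phi>(2)[OF reparam_mem[OF \<psi>(1) that]] \<psi>(2)[OF that] by simp
    with * \<psi>(1) show "(\<sigma>, \<gamma>) \<in> reparam_rel X" by (auto simp: reparam_rel_def)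
  qed
  show "trans (reparam_rel X)"
  proof (rule transI)
    fix \<gamma> \<sigma> \<rho> assume *: "(\<gamma>, \<sigma>) \<in> reparam_rel X" "(\<sigma>, \<rho>) \<in> reparam_rel X"
    then obtain \<phi> \<psi> where \<phi>: "reparam \<phi>" "\<And>t. t \<in> {0..1} \<Longrightarrow> \<sigma> t = \<gamma> (\<phi> t)"
      and \<psi>: "reparam \<psi>" "\<And>t. t \<in> {0..1} \<Longrightarrow> \<rho> t = \<sigma> (\<psi> t)"
      by (auto simp: reparam_rel_def)
    have "\<rho> t = \<gamma> (\<phi> (\<psi> t))" if "t \<in> {0..1}" for t
      using \<phi>(2)[OF reparam_mem[OF \<psi>(1) that]] \<psi>(2)[OF that] by simp
    with * reparam_comp[OF \<phi>(1) \<psi>(1)] show "(\<gamma>, \<rho>) \<in> reparam_rel X"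
      by (auto simp: reparam_rel_def intro!: exI[of _ "\<lambda>t. \<phi> (\<psi> t)"])
  qed
qed

lemma rep_class:
  assumes "g \<in> TGeo X" "\<gamma> \<in> g"
  obtains \<phi> where "reparam \<phi>" "\<And>t. t \<in> {0..1} \<Longrightarrow> rep g t = \<gamma> (\<phi> t)"
proof -
  have "rep g \<in> g" unfolding rep_def by (rule someI[of "\<lambda>\<gamma>. \<gamma> \<in> g", OF assms(2)])
  then have "(\<gamma>, rep g) \<in> reparam_rel X"
    using assms quotient_eq_iff[OF equiv_reparam_rel] unfolding TGeo_def by blast
  then show ?thesis using that by (auto simp: reparam_rel_def)
qed

lemma source_class: "g \<in> TGeo X \<Longrightarrow> \<gamma> \<in> g \<Longrightarrow> source g = \<gamma> 0"
  by (erule (1) rep_class) (simp add: source_def reparam_endpoints)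

lemma target_class: "g \<in> TGeo X \<Longrightarrow> \<gamma> \<in> g \<Longrightarrow> target g = \<gamma> 1"
  by (erule (1) rep_class) (simp add: target_def reparam_endpoints)

lemma partition_mem:
  assumes "(n, t) \<in> partitions a b" "i \<le> n"
  shows "t i \<in> {a..b}"
proof -
  have st: "\<And>i. i < n \<Longrightarrow> t i \<le> t (Suc i)" and e: "t 0 = a" "t n = b"
    using assms(1) by (auto simp: partitions_def less_imp_le)
  have "t 0 \<le> t i" using assms(2)
  proof (induction i)
    case (Suc i)
    then show ?case using st[of i] by simp
  qed simp
  moreover have "t i \<le> t n" using assms(2)
  proof (induction i rule: inc_induct)
    case (step i)
    then show ?case using st[of i] by simp
  qed simp
  ultimately show ?thesis using e by simp
qed

lemma tau_length_reparam_le: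
  assumes "reparam \<phi>" "\<And>t. t \<in> {0..1} \<Longrightarrow> \<sigma> t = \<gamma> (\<phi> t)"
  shows "tau_length X \<gamma> 0 1 \<le> tau_length X \<sigma> 0 1"
  unfolding tau_length_def
proof (rule INF_greatest, clarify)
  fix n t assume p: "(n, t) \<in> partitions 0 1"
  have m: "t i \<in> {0..1}" if "i \<le> n" for i using partition_mem[OF p that] .
  have "strict_mono_on {0..1} \<phi>" using assms(1) by (simp add: reparam_def)
  then have "(n, \<lambda>i. \<phi> (t i)) \<in> partitions 0 1"
    using p m reparam_endpoints[OF assms(1)]
    by (auto simp: partitions_def intro!: strict_mono_onD[of "{0..1}" \<phi>])
  moreover have "(\<Sum>i<n. \<tau>\<^bsub>X\<^esub> (\<sigma> (t i)) (\<sigma> (t (Suc i)))) =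
      (\<Sum>i<n. \<tau>\<^bsub>X\<^esub> (\<gamma> (\<phi> (t i))) (\<gamma> (\<phi> (t (Suc i)))))"
    using m assms(2) by (intro sum.cong) auto
  ultimately show "(INF (n, t) \<in> partitions 0 1. \<Sum>i<n. \<tau>\<^bsub>X\<^esub> (\<gamma> (t i)) (\<gamma> (t (Suc i))))
      \<le> (\<Sum>i<n. \<tau>\<^bsub>X\<^esub> (\<sigma> (t i)) (\<sigma> (t (Suc i))))"
    by (intro INF_lower2[of "(n, \<lambda>i. \<phi> (t i))"]) auto
qed

lemma len_class:
  assumes "g \<in> TGeo X" "\<gamma> \<in> g" shows "len X g = tau_length X \<gamma> 0 1"
proof -
  obtain \<phi> where \<phi>: "reparam \<phi>" "\<And>t. t \<in> {0..1} \<Longrightarrow> rep g t = \<gamma> (\<phi> t)"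
    using rep_class[OF assms] by metis
  obtain \<psi> where \<psi>: "reparam \<psi>" "\<And>t. t \<in> {0..1} \<Longrightarrow> \<phi> (\<psi> t) = t"
    using reparam_inverse[OF \<phi>(1)] by metis
  have "\<gamma> t = rep g (\<psi> t)" if "t \<in> {0..1}" for t
    using \<phi>(2)[OF reparam_mem[OF \<psi>(1) that]] \<psi>(2)[OF that] by simp
  then have "tau_length X (rep g) 0 1 \<le> tau_length X \<gamma> 0 1"
    using \<psi>(1) by (metis tau_length_reparam_le)
  moreover have "tau_length X \<gamma> 0 1 \<le> tau_length X (rep g) 0 1"
    using \<phi> by (metis tau_length_reparam_le)
  ultimately show ?thesis unfolding len_def by (rule antisym)
qed

lemma frechet_dist_reparam:
  assumes \<phi>0: "reparam \<phi>0" "\<And>t. t \<in> {0..1} \<Longrightarrow> \<gamma>' t = \<gamma> (\<phi>0 t)"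
    and \<psi>0: "reparam \<psi>0" "\<And>t. t \<in> {0..1} \<Longrightarrow> \<sigma>' t = \<sigma> (\<psi>0 t)"
  shows "frechet_dist \<gamma>' \<sigma>' = frechet_dist \<gamma> \<sigma>"
proof -
  let ?R = "Collect reparam \<times> Collect reparam"
  let ?f = "\<lambda>\<gamma> \<sigma> (\<phi>, \<psi>). SUP t\<in>{0..1}. dist (\<gamma> (\<phi> t)) (\<sigma> (\<psi> t)) :: real"
  obtain \<phi>1 where \<phi>1: "reparam \<phi>1" "\<And>t. t \<in> {0..1} \<Longrightarrow> \<phi>0 (\<phi>1 t) = t"
    using reparam_inverse[OF \<phi>0(1)] by metis
  obtain \<psi>1 where \<psi>1: "reparam \<psi>1" "\<And>t. t \<in> {0..1} \<Longrightarrow> \<psi>0 (\<psi>1 t) = t"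
    using reparam_inverse[OF \<psi>0(1)] by metis
  have "?f \<gamma>' \<sigma>' ` ?R = ?f \<gamma> \<sigma> ` ?R"
  proof (intro equalityI image_subsetI)
    fix x assume "x \<in> ?R"
    then obtain \<phi> \<psi> where x: "x = (\<phi>, \<psi>)" and r: "reparam \<phi>" "reparam \<psi>" by blast
    have "?f \<gamma>' \<sigma>' (\<phi>, \<psi>) = ?f \<gamma> \<sigma> (\<lambda>t. \<phi>0 (\<phi> t), \<lambda>t. \<psi>0 (\<psi> t))"
      using \<phi>0(2) \<psi>0(2) reparam_mem[OF r(1)] reparam_mem[OF r(2)] by simp
    then show "?f \<gamma>' \<sigma>' x \<in> ?f \<gamma> \<sigma> ` ?R"
      unfolding x using reparam_comp[OF \<phi>0(1) r(1)] reparam_comp[OF \<psi>0(1) r(2)] by blast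
  next
    fix x assume "x \<in> ?R"
    then obtain \<phi> \<psi> where x: "x = (\<phi>, \<psi>)" and r: "reparam \<phi>" "reparam \<psi>" by blast
    have "?f \<gamma> \<sigma> (\<phi>, \<psi>) = ?f \<gamma>' \<sigma>' (\<lambda>t. \<phi>1 (\<phi> t), \<lambda>t. \<psi>1 (\<psi> t))"
      using \<phi>0(2)[OF reparam_mem[OF \<phi>1(1)]] \<psi>0(2)[OF reparam_mem[OF \<psi>1(1)]] \<phi>1(2) \<psi>1(2)
        reparam_mem[OF r(1)] reparam_mem[OF r(2)] by simp
    then show "?f \<gamma> \<sigma> x \<in> ?f \<gamma>' \<sigma>' ` ?R"
      unfolding x using reparam_comp[OF \<phi>1(1) r(1)] reparam_comp[OF \<psi>1(1) r(2)] by blast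
  qed
  then show ?thesis unfolding frechet_dist_def by (rule arg_cong[where f = Inf])
qed

lemma d_F_class:
  assumes "g \<in> TGeo X" "\<gamma> \<in> g" "h \<in> TGeo X" "\<sigma> \<in> h"
  shows "d_F g h = frechet_dist \<gamma> \<sigma>"
proof -
  obtain \<phi> where \<phi>: "reparam \<phi>" "\<And>t. t \<in> {0..1} \<Longrightarrow> rep g t = \<gamma> (\<phi> t)"
    using rep_class[OF assms(1,2)] by metis
  obtain \<psi> where \<psi>: "reparam \<psi>" "\<And>t. t \<in> {0..1} \<Longrightarrow> rep h t = \<sigma> (\<psi> t)"
    using rep_class[OF assms(3,4)] by metis
  show ?thesis
    unfolding d_F_def using frechet_dist_reparam[of \<phi> "rep g" \<gamma> \<psi> "rep h" \<sigma>] \<phi> \<psi> by blast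
qed

end

theory Submission
  imports Defs
begin

text \<open>Small diamonds are convex sets on which \<open>\<tau>\<close> is finite and continuous and in which triangles
  compare with Minkowski triangles. In Minkowski space the division points of two sides that start
  (or end) at a common vertex inherit the chronological order of the opposite vertices. So the
  midpoint map is monotone, and points of \<open>\<gamma>\<close> shifted along \<open>\<gamma>\<close> itself serve as barriers.

  Put the points \<open>i / N\<close> on \<open>\<gamma>\<close> and let \<open>w\<close> be a strictly concave weight that vanishes at the ends.
  Existence: for \<open>p'\<close>, \<open>q'\<close> near the endpoints, maximise \<open>\<Sum> \<tau> (x i) (x (i + 1))\<close> over chains from \<open>p'\<close>
  to \<open>q'\<close> with \<open>x i\<close> in the causal diamond between \<open>\<gamma> (i / N - w i)\<close> and \<open>\<gamma> (i / N + w i)\<close>. By strict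
  concavity the midpoint of \<open>x (i - 1)\<close> and \<open>x (i + 1)\<close> lies in the \<open>i\<close>-th diamond again, so a maximal
  chain satisfies \<open>\<tau> (x (i - 1)) (x i) + \<tau> (x i) (x (i + 1)) = \<tau> (x (i - 1)) (x (i + 1))\<close>, and joining
  its points by maximizers gives a geodesic.
  Uniqueness: if \<open>\<sigma>\<close> and \<open>\<rho>\<close> have the same endpoints and \<open>\<sigma> (i / N - s * w i) \<lless> \<rho> (i / N)\<close> for all \<open>i\<close>,
  then comparison of midpoints gives the same with \<open>\<theta> * s\<close> in place of \<open>s\<close>, for a fixed \<open>\<theta> < 1\<close>; in the
  limit \<open>\<sigma> (i / N) \<preceq> \<rho> (i / N)\<close>, and by symmetry the two agree. This needs that geodesics near \<open>\<gamma>\<close>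
  with proportional parametrisation are uniformly near \<open>\<gamma>\<close>, which holds because a local maximizer
  inside a comparison set is a maximizer.\<close>

text \<open>Comparison bounds \<open>\<tau>\<close> only from below and gives no control of the
  metric, so convexity of the distance between two geodesics, the usual tool under upper curvature
  bounds, is not at hand. Chronological order takes its place: relations between the ends of two
  segments pass to their midpoints, and a concave weight turns this into a discrete maximum
  principle. On a grid of spacing \<open>1 / N\<close> the weight is
  \<open>i * (N - i) / N ^ 3\<close>. Its midpoint defect is the constant \<open>1 / N ^ 3\<close>,
  and its height, at most \<open>1 / (4 * N)\<close>, keeps shifted grid points in order. Two
  obstacles shape the existence proof. Maximal chains need closed sets while comparison yields
  strict relations, so the barriers lie slightly outside the diamonds. At the ends the barriers
  would need \<gamma> at parameters below 0 or above 1; a point just before the source, or just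
  after the target, takes over there, and the resulting loss is absorbed by the defect of the
  weight.\<close>

section \<open>Causality\<close>

text \<open>For a causal curve with \<open>\<tau>\<close> finite between its ends, having a potential (its \<open>\<tau>\<close>-arclength) is
  equivalent to being a maximizer. Monotonicity is required because \<open>ennreal\<close> truncates.\<close>

definition potential ::
  "'a causal_space \<Rightarrow> (real \<Rightarrow> 'a) \<Rightarrow> real \<Rightarrow> real \<Rightarrow> (real \<Rightarrow> real) \<Rightarrow> bool" where
  "potential X c a b f \<longleftrightarrow>
     (\<forall>s t. a \<le> s \<longrightarrow> s \<le> t \<longrightarrow> t \<le> b \<longrightarrow>
        f s \<le> f t \<and> \<tau>\<^bsub>X\<^esub> (c s) (c t) = ennreal (f t - f s))"

text \<open>The last assumption excludes the one-point space, whose topology is generated although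
  no diamond contains the point. It follows from the presence of a timelike geodesic.\<close>

locale curved_space =
  fixes X :: "'a::metric_space causal_space" (structure)
  assumes lpls: "lorentzian_pre_length_space X"
    and gh: "globally_hyperbolic X"
    and sc: "strongly_causal X"
    and tpc: "timelike_path_connected X"
    and reg: "regular X"
    and cba: "timelike_curvature_bounded_above_0 X"
    and nontrivial: "\<exists>x y::'a. x \<noteq> y"
begin

text \<open>\<open>T x y = 0\<close> if \<open>\<tau> x y = \<infinity>\<close>, so \<open>T\<close> is only used on sets where \<open>\<tau>\<close> is finite.\<close>

definition T where "T x y = enn2real (\<tau> x y)"

lemma T_nonneg [simp]: "0 \<le> T x y" by (simp add: T_def)

lemma chron_trans: "x \<lless> y \<Longrightarrow> y \<lless> z \<Longrightarrow> x \<lless> z"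
  using lpls by (meson lorentzian_pre_length_space_def transpD)

lemma causal_refl [simp]: "x \<preceq> x"
  using lpls by (meson lorentzian_pre_length_space_def reflpD)

lemma chron_imp_causal: "x \<lless> y \<Longrightarrow> x \<preceq> y"
  using lpls by (meson lorentzian_pre_length_space_def)

lemma chron_iff: "x \<lless> y \<longleftrightarrow> 0 < \<tau> x y"
  using lpls by (meson lorentzian_pre_length_space_def)

lemma rev_tri: "x \<preceq> y \<Longrightarrow> y \<preceq> z \<Longrightarrow> \<tau> x y + \<tau> y z \<le> \<tau> x z"
  using lpls by (meson lorentzian_pre_length_space_def)

lemma chron_causal_trans: "x \<lless> y \<Longrightarrow> y \<preceq> z \<Longrightarrow> x \<lless> z"
  using rev_tri[of x y z] chron_imp_causal[of x y] unfolding chron_iff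
  by (metis add_eq_0_iff_both_eq_0 not_gr_zero le_zero_eq)

lemma causal_chron_trans: "x \<preceq> y \<Longrightarrow> y \<lless> z \<Longrightarrow> x \<lless> z"
  using rev_tri[of x y z] chron_imp_causal[of y z] unfolding chron_iff
  by (metis add_eq_0_iff_both_eq_0 not_gr_zero le_zero_eq)

lemma open_chron: "open {(x, y). x \<lless> y}"
  using lpls unfolding lorentzian_pre_length_space_def chron_iff by blast

lemma open_future: "open {y. x \<lless> y}"
proof -
  have "open (Pair x -` {(x, y). x \<lless> y})"
    by (intro open_vimage open_chron continuous_intros)
  then show ?thesis by (simp add: vimage_def)
qed

lemma open_past: "open {x. x \<lless> y}"
proof -
  have "open ((\<lambda>x. (x, y)) -` {(x, y). x \<lless> y})"
    by (intro open_vimage open_chron continuous_intros)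
  then show ?thesis by (simp add: vimage_def)
qed

lemma open_chron_diamond: "open (chron_diamond X x y)"
proof -
  have "chron_diamond X x y = {z. x \<lless> z} \<inter> {z. z \<lless> y}" by (auto simp: chron_diamond_def)
  then show ?thesis using open_future open_past by (metis open_Int)
qed

section \<open>Consequences of strong causality\<close>

lemma generated: "open S \<Longrightarrow> generate_topology {S. \<exists>x y. S = chron_diamond X x y} (S::'a set)"
  using sc by (simp add: strongly_causal_def)

text \<open>By push-up, points that precede each other lie in exactly the same diamonds, so no
  generated open set separates them, whereas the metric topology is T1.\<close>

lemma causal_antisym:
  assumes "x \<preceq> y" "y \<preceq> x" shows "x = y"
proof (rule ccontr)
  assume "x \<noteq> y"
  then obtain S where S: "open S" "x \<in> S" "y \<notin> S" using t1_space by blast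
  have "x \<in> S \<longleftrightarrow> y \<in> S" using generated[OF S(1)]
  proof (induction rule: generate_topology.induct)
    case (Basis S)
    then show ?case
      using assms by (auto simp: chron_diamond_def dest: chron_causal_trans causal_chron_trans)
  qed auto
  then show False using S by simp
qed

text \<open>On a timelike curve from \<open>x\<close> to \<open>x\<close> every inner point is both
  after and before \<open>x\<close>, so antisymmetry makes the curve constant.\<close>

lemma chron_irrefl: "\<not> x \<lless> x"
proof
  assume "x \<lless> x"
  then obtain c a b where c: "timelike_curve X c a b" "c a = x" "c b = x"
    using tpc unfolding timelike_path_connected_def by blast
  then have ab: "a < b" and nc: "\<not> c constant_on {a..b}"
    by (auto simp: timelike_curve_def lipschitz_nowhere_constant_def)
  have "c t = x" if "t \<in> {a..b}" for t
  proof (cases "t = a \<or> t = b")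
    case False
    then have "c a \<lless> c t" "c t \<lless> c b" using c(1) that by (auto simp: timelike_curve_def)
    then show ?thesis using c causal_antisym chron_imp_causal by metis
  qed (use c in auto)
  then show False using nc by (auto simp: constant_on_def)
qed

lemma tau_refl [simp]: "\<tau> x x = 0"
  using chron_irrefl[of x] by (simp add: chron_iff)

lemma T_refl [simp]: "T x x = 0" by (simp add: T_def)

lemma chron_imp_neq: "x \<lless> y \<Longrightarrow> x \<noteq> y" using chron_irrefl by auto

lemma closed_causal_diamond: "closed (causal_diamond X x y)"
  using gh compact_imp_closed unfolding globally_hyperbolic_def by blast

text \<open>Among the generated open sets only the whole space can contain a point that lies in no
  diamond, so a neighbourhood of \<open>p\<close> that omits another point yields a diamond around
  \<open>p\<close>.\<close>

lemma in_diamond: "\<exists>x y. x \<lless> p \<and> p \<lless> y"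
proof -
  obtain q where "p \<noteq> q" using nontrivial by metis
  then obtain S where S: "open S" "p \<in> S" "q \<notin> S" using t1_space by blast
  have "p \<in> S \<longrightarrow> S = UNIV \<or> (\<exists>x y. p \<in> chron_diamond X x y)" using generated[OF S(1)]
  proof (induction rule: generate_topology.induct)
    case (UN K)
    then show ?case by (metis UNIV_eq_I UnionE UnionI iso_tuple_UNIV_I)
  qed auto
  then show ?thesis using S by (auto simp: chron_diamond_def)
qed

lemma timelike_curve_cont: "timelike_curve X c a b \<Longrightarrow> continuous_on {a..b} c"
  by (auto simp: timelike_curve_def lipschitz_nowhere_constant_def
      intro: lipschitz_on_continuous_on)

text \<open>Timelike path-connectedness supplies a continuous curve from \<open>a\<close> to
  \<open>p\<close>; its points shortly before the end lie in the given neighbourhood.\<close>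

lemma past_near:
  assumes "open S" "p \<in> S" "a \<lless> p" obtains p' where "p' \<in> S" "a \<lless> p'" "p' \<lless> p"
proof -
  obtain c s t where c: "timelike_curve X c s t" "c s = a" "c t = p"
    using tpc assms unfolding timelike_path_connected_def by blast
  have st: "s < t" using c(1) by (auto simp: timelike_curve_def lipschitz_nowhere_constant_def)
  have "(c \<longlongrightarrow> c t) (at t within {s..t})"
    using timelike_curve_cont[OF c(1)] st by (auto simp: continuous_on_def)
  then have "(c \<longlongrightarrow> c t) (at_left t)" using st
    by (metis at_within_Icc_at_left)
  then have "\<forall>\<^sub>F u in at_left t. c u \<in> S" using assms c by (auto dest: topological_tendstoD)
  moreover have "\<forall>\<^sub>F u in at_left t. u \<in> {s<..<t}"
    using st eventually_at_leftI[of s t "\<lambda>u. u \<in> {s<..<t}"] by simp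
  ultimately have "\<forall>\<^sub>F u in at_left t. c u \<in> S \<and> u \<in> {s<..<t}" by (rule eventually_conj)
  then obtain u where "c u \<in> S" "u \<in> {s<..<t}"
    using eventually_happens'[OF trivial_limit_at_left_real] by blast
  then show ?thesis using that[of "c u"] c by (auto simp: timelike_curve_def)
qed

lemma future_near:
  assumes "open S" "p \<in> S" "p \<lless> b" obtains p' where "p' \<in> S" "p' \<lless> b" "p \<lless> p'"
proof -
  obtain c s t where c: "timelike_curve X c s t" "c s = p" "c t = b"
    using tpc assms unfolding timelike_path_connected_def by blast
  have st: "s < t" using c(1) by (auto simp: timelike_curve_def lipschitz_nowhere_constant_def)
  have "(c \<longlongrightarrow> c s) (at s within {s..t})"
    using timelike_curve_cont[OF c(1)] st by (auto simp: continuous_on_def)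
  then have "(c \<longlongrightarrow> c s) (at_right s)" using st
    by (metis at_within_Icc_at_right)
  then have "\<forall>\<^sub>F u in at_right s. c u \<in> S" using assms c by (auto dest: topological_tendstoD)
  moreover have "\<forall>\<^sub>F u in at_right s. u \<in> {s<..<t}"
    using st eventually_at_rightI[of s t "\<lambda>u. u \<in> {s<..<t}"] by simp
  ultimately have "\<forall>\<^sub>F u in at_right s. c u \<in> S \<and> u \<in> {s<..<t}" by (rule eventually_conj)
  then obtain u where "c u \<in> S" "u \<in> {s<..<t}"
    using eventually_happens'[OF trivial_limit_at_right_real] by blast
  then show ?thesis using that[of "c u"] c by (auto simp: timelike_curve_def)
qed

lemma past_exists: assumes "open S" "p \<in> S" obtains p' where "p' \<in> S" "p' \<lless> p"
  using in_diamond past_near[OF assms] by metis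

lemma future_exists: assumes "open S" "p \<in> S" obtains p' where "p' \<in> S" "p \<lless> p'"
  using in_diamond future_near[OF assms] by metis

text \<open>Diamonds are assumed only to be a subbase. Two diamonds around \<open>p\<close> contain
  a third one around \<open>p\<close>: \<open>past_near\<close>, applied to the open future of one
  lower vertex, finds a point before \<open>p\<close> that lies after both lower vertices, and
  dually for the upper ones.\<close>

lemma diamond_basis:
  assumes "open S" "p \<in> S"
  obtains a b where "a \<lless> p" "p \<lless> b" "chron_diamond X a b \<subseteq> S"
proof -
  have "p \<in> S \<longrightarrow> (\<exists>a b. a \<lless> p \<and> p \<lless> b \<and> chron_diamond X a b \<subseteq> S)" using generated[OF assms(1)]
  proof (induction rule: generate_topology.induct)
    case UNIV
    then show ?case using in_diamond by auto
  next
    case (Int A B)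
    show ?case
    proof
      assume "p \<in> A \<inter> B"
      then obtain a b a' b' where ab: "a \<lless> p" "p \<lless> b" "chron_diamond X a b \<subseteq> A"
        "a' \<lless> p" "p \<lless> b'" "chron_diamond X a' b' \<subseteq> B" using Int.IH by auto
      obtain a'' where "a' \<lless> a''" "a \<lless> a''" "a'' \<lless> p"
        using past_near[OF open_future[of a'], of p a] ab by auto
      moreover obtain b'' where "b'' \<lless> b'" "b'' \<lless> b" "p \<lless> b''"
        using future_near[OF open_past[of b'], of p b] ab by auto
      ultimately show "\<exists>a b. a \<lless> p \<and> p \<lless> b \<and> chron_diamond X a b \<subseteq> A \<inter> B"
        using ab unfolding chron_diamond_def subset_iff Int_iff mem_Collect_eq
        by (metis chron_trans)
    qed
  next
    case (UN K)
    then show ?case by (meson UnionE Union_upper order_trans)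
  next
    case (Basis S)
    then show ?case by (auto simp: chron_diamond_def)
  qed
  then show ?thesis using assms that by blast
qed

section \<open>Comparison sets\<close>

text \<open>Comparison neighborhoods need be neither causally convex nor free of infinite values of
  \<tau>. Convexity keeps maximizers, which the curvature bound only places in \<open>U\<close>,
  inside \<open>W\<close>; finiteness allows computing with the real-valued
  \<open>T\<close>.\<close>

definition cmp_set :: "'a set \<Rightarrow> bool" where
  "cmp_set W \<longleftrightarrow> open W \<and> (\<forall>x\<in>W. \<forall>y\<in>W. \<forall>z. x \<preceq> z \<longrightarrow> z \<preceq> y \<longrightarrow> z \<in> W) \<and>
     (\<exists>U. comparison_neighborhood X U \<and> W \<subseteq> U) \<and>
     (\<forall>x\<in>W. \<forall>y\<in>W. \<tau> x y < \<infinity>) \<and> continuous_on (W \<times> W) (\<lambda>(x, y). T x y)"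

text \<open>The pair \<open>(p, p)\<close> belongs to the open set \<open>D\<close> since
  \<open>\<tau> p p = 0\<close>, and by push-up every chronological diamond is causally convex, so a
  small diamond around \<open>p\<close> qualifies.\<close>

lemma cmp_set_exists:
  assumes "open S" "p \<in> S" obtains W where "cmp_set W" "p \<in> W" "W \<subseteq> S"
proof -
  obtain U where U: "p \<in> interior U" "comparison_neighborhood X U"
    using cba by (auto simp: timelike_curvature_bounded_above_0_def)
  define D where "D = (U \<times> U) \<inter> {(x, y). \<tau> x y < \<infinity>}"
  have D: "open D" "continuous_on D (\<lambda>(x, y). \<tau> x y)"
    using U(2) unfolding comparison_neighborhood_def D_def Let_def by auto
  have "(p, p) \<in> D" using U interior_subset by (auto simp: D_def)
  then obtain A B where AB: "open A" "open B" "p \<in> A" "p \<in> B" "A \<times> B \<subseteq> D"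
    using D(1) by (metis mem_Sigma_iff open_prod_elim)
  have "open (A \<inter> B \<inter> S)" "p \<in> A \<inter> B \<inter> S" using AB assms by auto
  then obtain a b where ab: "a \<lless> p" "p \<lless> b" "chron_diamond X a b \<subseteq> A \<inter> B \<inter> S"
    using diamond_basis by metis
  let ?W = "chron_diamond X a b"
  have sub: "?W \<times> ?W \<subseteq> D" using ab AB by auto
  have "continuous_on (?W \<times> ?W) (\<lambda>x. enn2real (case_prod \<tau> x))"
    unfolding continuous_on_def
  proof
    fix x assume x: "x \<in> ?W \<times> ?W"
    have "continuous_on (?W \<times> ?W) (case_prod \<tau>)" using D(2) sub by (rule continuous_on_subset)
    then have "(case_prod \<tau> \<longlongrightarrow> case_prod \<tau> x) (at x within ?W \<times> ?W)"
      using x by (auto simp: continuous_on_def)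
    moreover have "case_prod \<tau> x = ennreal (enn2real (case_prod \<tau> x))"
      using x sub by (auto simp: D_def)
    ultimately show "((\<lambda>x. enn2real (case_prod \<tau> x)) \<longlongrightarrow> enn2real (case_prod \<tau> x))
        (at x within ?W \<times> ?W)" by (intro tendsto_enn2real) auto
  qed
  moreover have "(\<lambda>x. enn2real (case_prod \<tau> x)) = (\<lambda>(x, y). T x y)"
    by (auto simp: T_def fun_eq_iff)
  ultimately have "continuous_on (?W \<times> ?W) (\<lambda>(x, y). T x y)" by (simp only:)
  moreover have "z \<in> ?W" if "x \<in> ?W" "y \<in> ?W" "x \<preceq> z" "z \<preceq> y" for x y z
    using that unfolding chron_diamond_def mem_Collect_eq by (metis chron_causal_trans causal_chron_trans)
  moreover have "?W \<subseteq> U" using sub by (auto simp: D_def)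
  moreover have "\<tau> x y < \<infinity>" if "x \<in> ?W" "y \<in> ?W" for x y using sub that by (auto simp: D_def)
  ultimately have "cmp_set ?W" unfolding cmp_set_def using open_chron_diamond U(2) by blast
  then show ?thesis using that ab by (auto simp: chron_diamond_def)
qed

context fixes W assumes W: "cmp_set W" begin

lemma cmp_set_open: "open W" using W by (simp add: cmp_set_def)
lemma cmp_set_convex: "\<lbrakk>x \<in> W; y \<in> W; x \<preceq> z; z \<preceq> y\<rbrakk> \<Longrightarrow> z \<in> W"
  using W unfolding cmp_set_def by blast
lemma cmp_set_cont: "continuous_on (W \<times> W) (\<lambda>(x, y). T x y)" using W by (simp add: cmp_set_def)
lemma cmp_set_tau: "x \<in> W \<Longrightarrow> y \<in> W \<Longrightarrow> \<tau> x y = ennreal (T x y)"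
proof -
  assume "x \<in> W" "y \<in> W"
  then have "\<tau> x y < \<infinity>" using W unfolding cmp_set_def by blast
  then show "\<tau> x y = ennreal (T x y)" unfolding T_def by simp
qed

lemma cmp_set_rev_tri:
  "\<lbrakk>x \<in> W; y \<in> W; z \<in> W; x \<preceq> y; y \<preceq> z\<rbrakk> \<Longrightarrow> T x y + T y z \<le> T x z"
  using rev_tri[of x y z] cmp_set_tau[of x y] cmp_set_tau[of y z] cmp_set_tau[of x z]
  by (metis T_nonneg ennreal_le_iff ennreal_plus)

lemma cmp_set_ch: "x \<in> W \<Longrightarrow> y \<in> W \<Longrightarrow> x \<lless> y \<longleftrightarrow> 0 < T x y"
  by (simp add: chron_iff cmp_set_tau)
end

end

section \<open>Potentials, \<tau>-length and concatenation\<close>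

lemma potentialD:
  assumes "potential X c a b f" "a \<le> s" "s \<le> t" "t \<le> b"
  shows "f s \<le> f t" "\<tau>\<^bsub>X\<^esub> (c s) (c t) = ennreal (f t - f s)"
  using assms by (auto simp: potential_def)

lemma potential_subset: "\<lbrakk>potential X c a b f; a \<le> a'; b' \<le> b\<rbrakk> \<Longrightarrow> potential X c a' b' f"
  by (auto simp: potential_def)

lemma potential_cong:
  assumes "potential X c a b f" "\<And>t. a \<le> t \<Longrightarrow> t \<le> b \<Longrightarrow> c' t = c t"
  shows "potential X c' a b f"
  using assms by (auto simp: potential_def)

lemma partitions_nonempty: "a < b \<Longrightarrow> (1, \<lambda>i. if i = 0 then a else b) \<in> partitions a b"
  by (auto simp: partitions_def)

lemma partition_mono:
  assumes "(n, t) \<in> partitions a b" "i < n" shows "a \<le> t i" "t i < t (Suc i)" "t (Suc i) \<le> b"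
  using partition_mem[OF assms(1), of i] partition_mem[OF assms(1), of "Suc i"] assms
  by (auto simp: partitions_def)

lemma potential_tau_length:
  assumes "potential X c a b f" "a < b"
  shows "tau_length X c a b = ennreal (f b - f a)"
proof -
  have "(\<Sum>i<n. \<tau>\<^bsub>X\<^esub> (c (t i)) (c (t (Suc i)))) = ennreal (f b - f a)"
    if p: "(n, t) \<in> partitions a b" for n t
  proof -
    have d: "f (t i) \<le> f (t (Suc i)) \<and>
        \<tau>\<^bsub>X\<^esub> (c (t i)) (c (t (Suc i))) = ennreal (f (t (Suc i)) - f (t i))" if "i < n" for i
      using partition_mono[OF p that] potentialD[OF assms(1), of "t i" "t (Suc i)"] by auto
    have "(\<Sum>i<n. \<tau>\<^bsub>X\<^esub> (c (t i)) (c (t (Suc i)))) = (\<Sum>i<n. ennreal (f (t (Suc i)) - f (t i)))"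
      using d by (intro sum.cong) auto
    also have "\<dots> = ennreal (\<Sum>i<n. f (t (Suc i)) - f (t i))" using d by (intro sum_ennreal) auto
    also have "(\<Sum>i<n. f (t (Suc i)) - f (t i)) = f (t n) - f (t 0)"
      by (rule sum_lessThan_telescope)
    finally show ?thesis using p by (simp add: partitions_def)
  qed
  then show ?thesis
    unfolding tau_length_def using partitions_nonempty[OF assms(2)]
    by (intro INF_eq_const) auto
qed

lemma tau_length_le_partition:
  assumes "(n, t) \<in> partitions a b"
  shows "tau_length X c a b \<le> (\<Sum>i<n. \<tau>\<^bsub>X\<^esub> (c (t i)) (c (t (Suc i))))"
  unfolding tau_length_def by (rule INF_lower2[OF assms]) simp

context curved_space begin

lemma tau_length_le2:
  assumes "a < b" "a \<le> s" "s \<le> b"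
  shows "tau_length X c a b \<le> \<tau> (c a) (c s) + \<tau> (c s) (c b)"
proof (cases "s = a \<or> s = b")
  case True
  have "tau_length X c a b \<le> \<tau> (c a) (c b)"
    using tau_length_le_partition[OF partitions_nonempty[OF assms(1)], of X c] by simp
  then show ?thesis using True by auto
next
  case False
  then have "(2, \<lambda>i. if i = 0 then a else if i = 1 then s else b) \<in> partitions a b"
    using assms by (auto simp: partitions_def less_Suc_eq numeral_2_eq_2)
  from tau_length_le_partition[OF this, of X c] show ?thesis by (simp add: numeral_2_eq_2)
qed

lemma tau_length_le3:
  assumes "a < b" "a \<le> s" "s \<le> t" "t \<le> b"
  shows "tau_length X c a b \<le> \<tau> (c a) (c s) + \<tau> (c s) (c t) + \<tau> (c t) (c b)"
proof (cases "s = a \<or> s = t \<or> t = b")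
  case True
  then show ?thesis
    using tau_length_le2[OF assms(1), of s c] tau_length_le2[OF assms(1), of t c] assms by auto
next
  case False
  then have "(3, \<lambda>i. if i = 0 then a else if i = 1 then s else if i = 2 then t else b)
      \<in> partitions a b"
    using assms by (auto simp: partitions_def less_Suc_eq numeral_3_eq_3)
  from tau_length_le_partition[OF this, of X c] show ?thesis
    by (simp add: numeral_3_eq_3 numeral_2_eq_2 add.assoc)
qed

text \<open>The partition through \<open>s\<close> and \<open>t\<close> bounds
  \<open>\<tau> (c a) (c b)\<close> from above, the reverse triangle inequality bounds it from
  below. Cancelling the finite \<open>\<tau> (c t) (c b)\<close> makes separations along the curve
  additive, so the separation from \<open>c a\<close> is a potential.\<close>

lemma maximizer_potential:
  assumes m: "maximizer X c a b" and fin: "\<tau> (c a) (c b) < \<infinity>"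
  shows "\<exists>f. potential X c a b f"
proof -
  have ab: "a < b" and le: "\<And>s t. \<lbrakk>a \<le> s; s \<le> t; t \<le> b\<rbrakk> \<Longrightarrow> c s \<preceq> c t"
    using m by (auto simp: maximizer_def causal_curve_def lipschitz_nowhere_constant_def le_less)
  define f where "f t = enn2real (\<tau> (c a) (c t))" for t
  have *: "\<tau> (c a) (c t) < \<infinity> \<and> \<tau> (c a) (c s) + \<tau> (c s) (c t) = \<tau> (c a) (c t)"
    if st: "a \<le> s" "s \<le> t" "t \<le> b" for s t
  proof -
    have 1: "\<tau> (c a) (c b) \<le> \<tau> (c a) (c s) + \<tau> (c s) (c t) + \<tau> (c t) (c b)"
      using tau_length_le3[OF ab st, of c] m by (simp add: maximizer_def)
    have 2: "\<tau> (c a) (c s) + \<tau> (c s) (c t) \<le> \<tau> (c a) (c t)" using st by (intro rev_tri le) auto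
    have 3: "\<tau> (c a) (c t) + \<tau> (c t) (c b) \<le> \<tau> (c a) (c b)" using st by (intro rev_tri le) auto
    have "\<tau> (c a) (c t) + \<tau> (c t) (c b) < \<infinity>" using 3 fin by (rule le_less_trans)
    then have fin': "\<tau> (c a) (c t) < \<infinity>" "\<tau> (c t) (c b) < \<infinity>" by simp_all
    have "\<tau> (c a) (c t) + \<tau> (c t) (c b) \<le> (\<tau> (c a) (c s) + \<tau> (c s) (c t)) + \<tau> (c t) (c b)"
      using 3 1 by (rule order_trans)
    then have "\<tau> (c a) (c t) \<le> \<tau> (c a) (c s) + \<tau> (c s) (c t)"
      using ennreal_add_left_cancel_le[of "\<tau> (c t) (c b)"] fin'(2)
      by (metis add.commute order_less_irrefl)
    then show ?thesis using 2 fin' by simp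
  qed
  have "f s \<le> f t \<and> \<tau> (c s) (c t) = ennreal (f t - f s)"
    if st: "a \<le> s" "s \<le> t" "t \<le> b" for s t
  proof -
    obtain A where A: "\<tau> (c a) (c s) = ennreal A" "0 \<le> A"
      using *[of s s] st by (cases "\<tau> (c a) (c s)") auto
    obtain B where B: "\<tau> (c a) (c t) = ennreal B" "0 \<le> B"
      using *[of s t] st by (cases "\<tau> (c a) (c t)") auto
    have eq: "ennreal A + \<tau> (c s) (c t) = ennreal B" using *[OF st] A B by simp
    then obtain C where C: "\<tau> (c s) (c t) = ennreal C" "0 \<le> C"
      by (cases "\<tau> (c s) (c t)") auto
    have "A + C = B" using eq C A B by (simp flip: ennreal_plus)
    then show ?thesis using A B C by (auto simp: f_def)
  qed
  then show ?thesis unfolding potential_def by blast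
qed

text \<open>Nowhere constancy is automatic for chronologically increasing curves, because \<lless>
  is irreflexive.\<close>

lemma timelike_curve_iff:
  "timelike_curve X c a b \<longleftrightarrow> a < b \<and> (\<exists>L. L-lipschitz_on {a..b} c) \<and>
     (\<forall>s t. a \<le> s \<longrightarrow> s < t \<longrightarrow> t \<le> b \<longrightarrow> c s \<lless> c t)"
proof -
  have "\<not> c constant_on {s..t}" if "s < t" "c s \<lless> c t" for s t :: real
  proof
    assume "c constant_on {s..t}"
    then have "c s = c t" using that(1) by (auto simp: constant_on_def)
    then show False using chron_imp_neq[OF that(2)] by simp
  qed
  then show ?thesis unfolding timelike_curve_def lipschitz_nowhere_constant_def by blast
qed

lemma timelike_curve_causal: "timelike_curve X c a b \<Longrightarrow> causal_curve X c a b"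
  by (auto simp: timelike_curve_def causal_curve_def chron_imp_causal)

lemma timelike_curve_cong:
  assumes "timelike_curve X c a b" "\<And>t. a \<le> t \<Longrightarrow> t \<le> b \<Longrightarrow> c' t = c t"
  shows "timelike_curve X c' a b"
proof -
  have "L-lipschitz_on {a..b} c' \<longleftrightarrow> L-lipschitz_on {a..b} c" for L
    using assms(2) by (auto simp: lipschitz_on_def)
  then show ?thesis using assms by (auto simp: timelike_curve_iff)
qed

lemma timelike_curve_join:
  assumes "timelike_curve X c a b" "timelike_curve X c b d"
  shows "timelike_curve X c a d"
proof -
  obtain L where L: "L-lipschitz_on {a..b} c" using assms by (auto simp: timelike_curve_iff)
  obtain M where M: "M-lipschitz_on {b..d} c" using assms by (auto simp: timelike_curve_iff)
  have "(max L M)-lipschitz_on {a..d} (\<lambda>x. if x \<le> b then c x else c x)"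
    by (rule lipschitz_on_concat_max[OF L M refl])
  then have lip: "(max L M)-lipschitz_on {a..d} c" by simp
  have "c s \<lless> c t" if "a \<le> s" "s < t" "t \<le> d" for s t
  proof -
    consider "t \<le> b" | "b \<le> s" | "s < b" "b < t" by linarith
    then show ?thesis
    proof cases
      case 3
      then have "c s \<lless> c b" "c b \<lless> c t" using assms that by (auto simp: timelike_curve_iff)
      then show ?thesis by (rule chron_trans)
    qed (use assms that in \<open>auto simp: timelike_curve_iff\<close>)
  qed
  then show ?thesis using lip assms by (auto simp: timelike_curve_iff)
qed

lemma potential_maximizer:
  assumes "timelike_curve X c a b" "potential X c a b f" shows "maximizer X c a b"
  using assms potential_tau_length[OF assms(2)] potentialD[OF assms(2), of a b]
  by (auto simp: maximizer_def timelike_curve_causal timelike_curve_iff)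

text \<open>Equality in the triangle inequality at the joint forces it for every \<open>s\<close>
  before and \<open>t\<close> after it: \<open>\<tau> (c s) (c t)\<close> is squeezed between the
  sum through the joint and what remains of \<open>\<tau> (c a) (c d)\<close> once the two outer
  pieces are removed.\<close>

lemma potential_join:
  assumes f: "potential X c a b f" and g: "potential X c b d g" and ab: "a \<le> b" "b \<le> d"
    and c: "\<And>s t. \<lbrakk>a \<le> s; s \<le> t; t \<le> d\<rbrakk> \<Longrightarrow> c s \<preceq> c t"
    and add: "\<tau> (c a) (c d) \<le> \<tau> (c a) (c b) + \<tau> (c b) (c d)"
  shows "\<exists>h. potential X c a d h"
proof -
  define h where "h t = (if t \<le> b then f t else g t - g b + f b)" for t
  have "h s \<le> h t \<and> \<tau> (c s) (c t) = ennreal (h t - h s)"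
    if st: "a \<le> s" "s \<le> t" "t \<le> d" for s t
  proof -
    consider "t \<le> b" | "b < s" | "s \<le> b" "b < t" by linarith
    then show ?thesis
    proof cases
      case 1
      then show ?thesis using potentialD[OF f, of s t] st by (simp add: h_def)
    next
      case 2
      then show ?thesis using potentialD[OF g, of s t] st by (simp add: h_def)
    next
      case 3
      note e = potentialD[OF f, of a s] potentialD[OF f, of s b] potentialD[OF f, of a b]
        potentialD[OF g, of b t] potentialD[OF g, of t d] potentialD[OF g, of b d]
      have 1: "\<tau> (c s) (c b) + \<tau> (c b) (c t) \<le> \<tau> (c s) (c t)"
        using 3 st ab by (intro rev_tri c) auto
      have 2: "\<tau> (c a) (c s) + \<tau> (c s) (c t) \<le> \<tau> (c a) (c t)"
        using 3 st ab by (intro rev_tri c) auto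
      have 3: "\<tau> (c a) (c t) + \<tau> (c t) (c d) \<le> \<tau> (c a) (c d)"
        using 3 st ab by (intro rev_tri c) auto
      have "\<tau> (c a) (c s) + \<tau> (c s) (c t) + \<tau> (c t) (c d) \<le> \<tau> (c a) (c b) + \<tau> (c b) (c d)"
        using 2 3 add by (meson add_right_mono order_trans)
      then have 4: "ennreal (f s - f a) + \<tau> (c s) (c t) + ennreal (g d - g t)
          \<le> ennreal (f b - f a + (g d - g b))"
        using e \<open>s \<le> b\<close> \<open>b < t\<close> st ab by (simp flip: ennreal_plus)
      then obtain C where C: "\<tau> (c s) (c t) = ennreal C" "0 \<le> C"
        by (cases "\<tau> (c s) (c t)") (auto simp: top_unique)
      have "f s - f a + C + (g d - g t) \<le> f b - f a + (g d - g b)"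
        using 4 e \<open>s \<le> b\<close> \<open>b < t\<close> st ab C by (simp flip: ennreal_plus)
      moreover have "f b - f s + (g t - g b) \<le> C"
        using 1 e \<open>s \<le> b\<close> \<open>b < t\<close> st ab C by (simp flip: ennreal_plus)
      ultimately have "C = h t - h s" using \<open>s \<le> b\<close> \<open>b < t\<close> by (simp add: h_def)
      then show ?thesis using C by auto
    qed
  qed
  then show ?thesis unfolding potential_def by blast
qed

lemma rescale:
  assumes c: "timelike_curve X c a b" and f: "potential X c a b f" and lt: "a' < b'"
  shows "\<exists>c' f'. timelike_curve X c' a' b' \<and> potential X c' a' b' f' \<and> c' a' = c a \<and> c' b' = c b
     \<and> c' ` {a'..b'} \<subseteq> c ` {a..b}"
proof -
  have ab: "a < b" using c by (simp add: timelike_curve_iff)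
  define k where "k = (b - a) / (b' - a')"
  have k: "0 < k" using ab lt by (simp add: k_def)
  define h where "h t = a + k * (t - a')" for t
  have hb: "h b' = b" using lt by (simp add: h_def k_def)
  have ha: "h a' = a" by (simp add: h_def)
  have hm: "h s < h t" if "s < t" for s t using that k by (simp add: h_def)
  have hm': "h s \<le> h t" if "s \<le> t" for s t using that k by (simp add: h_def)
  have hr: "a \<le> h t" "h t \<le> b" if "a' \<le> t" "t \<le> b'" for t
    using hm'[of a' t] hm'[of t b'] that ha hb by auto
  obtain L where L: "L-lipschitz_on {a..b} c" using c by (auto simp: timelike_curve_iff)
  have "k-lipschitz_on {a'..b'} h"
  proof (rule lipschitz_onI)
    fix x y
    have "h x - h y = k * (x - y)" by (simp add: h_def algebra_simps)
    then show "dist (h x) (h y) \<le> k * dist x y"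
      using k by (simp add: dist_real_def abs_mult)
  qed (use k in simp)
  moreover have "h ` {a'..b'} \<subseteq> {a..b}" using hr by auto
  ultimately have "(L * k)-lipschitz_on {a'..b'} (c \<circ> h)"
    using lipschitz_on_compose[of k "{a'..b'}" h L c] L lipschitz_on_subset by blast
  then have "timelike_curve X (c \<circ> h) a' b'"
    using c hm hr lt unfolding timelike_curve_iff by (auto simp: comp_def)
  moreover have "potential X (c \<circ> h) a' b' (f \<circ> h)"
    using f hm' hr unfolding potential_def by auto
  ultimately show ?thesis using ha hb hr
    by (intro exI[of _ "c \<circ> h"] exI[of _ "f \<circ> h"]) auto
qed

section \<open>Maximizers and division points in comparison sets\<close>

lemma cmp_set_connect:
  assumes W: "cmp_set W" and xy: "x \<in> W" "y \<in> W" "x \<lless> y" and ab: "a < b"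
  shows "\<exists>c f. timelike_curve X c a b \<and> potential X c a b f \<and> c a = x \<and> c b = y \<and> c ` {a..b} \<subseteq> W"
proof -
  obtain U where U: "comparison_neighborhood X U" "W \<subseteq> U" using W unfolding cmp_set_def by blast
  have fin: "\<tau> x y < \<infinity>" using cmp_set_tau[OF W xy(1,2)] by simp
  have "\<forall>x\<in>U. \<forall>y\<in>U. x \<preceq> y \<longrightarrow> x \<noteq> y \<longrightarrow> \<tau> x y < \<infinity> \<longrightarrow>
        (\<exists>\<alpha> a b. maximizer X \<alpha> a b \<and> \<alpha> a = x \<and> \<alpha> b = y \<and> \<alpha> ` {a..b} \<subseteq> U)"
    using U(1) unfolding comparison_neighborhood_def by blast
  then obtain \<alpha> a0 b0 where \<alpha>: "maximizer X \<alpha> a0 b0" "\<alpha> a0 = x" "\<alpha> b0 = y"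
    using U(2) xy chron_imp_causal[OF xy(3)] chron_imp_neq[OF xy(3)] fin by blast
  \<comment> \<open>Regularity turns the maximizer into a timelike curve. So far its image is only
    known to lie in \<open>U\<close>; causal convexity will bring it back to
    \<open>W\<close>.\<close>
  have tl: "timelike_curve X \<alpha> a0 b0" using reg \<alpha> xy(3) unfolding regular_def by blast
  obtain f where f: "potential X \<alpha> a0 b0 f" using maximizer_potential[OF \<alpha>(1)] \<alpha> fin by blast
  obtain c f' where c: "timelike_curve X c a b" "potential X c a b f'" "c a = x" "c b = y"
    using rescale[OF tl f ab] \<alpha> by auto
  have "c t \<in> W" if "t \<in> {a..b}" for t
  proof -
    have "t = a \<or> a < t" "t = b \<or> t < b" using that by auto
    then have "c a \<preceq> c t" "c t \<preceq> c b" using c(1) that chron_imp_causal unfolding timelike_curve_iff by auto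
    then show ?thesis using cmp_set_convex[OF W xy(1,2)] c by simp
  qed
  then show ?thesis using c by blast
qed

text \<open>The curvature bound speaks of points on given sides. A point that realises equality lies
  on a side built through it, by joining a maximizer from \<open>x\<close> to \<open>p\<close> with
  one from \<open>p\<close> to \<open>y\<close>. Hence comparison applies to every such point,
  whichever maximizer it came from.\<close>

lemma cmp_set_side:
  assumes W: "cmp_set W" and U: "W \<subseteq> U" and p: "x \<in> W" "p \<in> W" "y \<in> W" "x \<lless> p" "p \<lless> y"
    and add: "T x p + T p y = T x y"
  shows "\<exists>S. timelike_side X U S x y \<and> p \<in> S"
proof -
  obtain c f where c: "timelike_curve X c 0 1" "potential X c 0 1 f" "c 0 = x" "c 1 = p"
      "c ` {0..1} \<subseteq> W" using cmp_set_connect[OF W p(1,2,4), of 0 1] by auto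
  obtain d g where d: "timelike_curve X d 1 2" "potential X d 1 2 g" "d 1 = p" "d 2 = y"
      "d ` {1..2} \<subseteq> W" using cmp_set_connect[OF W p(2,3,5), of 1 2] by auto
  define e where "e t = (if t \<le> 1 then c t else d t)" for t :: real
  have ec: "e t = c t" if "t \<le> 1" for t using that by (simp add: e_def)
  have ed: "e t = d t" if "1 \<le> t" for t using that c d by (cases "t = 1") (auto simp: e_def)
  have "timelike_curve X e 0 1" by (rule timelike_curve_cong[OF c(1)]) (simp add: ec)
  moreover have "timelike_curve X e 1 2" by (rule timelike_curve_cong[OF d(1)]) (simp add: ed)
  ultimately have tl: "timelike_curve X e 0 2" by (rule timelike_curve_join)
  have e: "e 0 = x" "e 1 = p" "e 2 = y" using c d by (auto simp: ec ed)
  have "\<tau> x y = \<tau> x p + \<tau> p y"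
    unfolding cmp_set_tau[OF W p(1,3)] cmp_set_tau[OF W p(1,2)] cmp_set_tau[OF W p(2,3)] add[symmetric]
    by (simp add: ennreal_plus)
  moreover have "e s \<preceq> e t" if "0 \<le> s" "s \<le> t" "t \<le> 2" for s t
    using tl that chron_imp_causal unfolding timelike_curve_iff by (cases "s = t") auto
  ultimately have "\<exists>h. potential X e 0 2 h"
    using e by (intro potential_join[OF potential_cong[OF c(2)] potential_cong[OF d(2)]])
      (auto simp: ec ed)
  then have "maximizer X e 0 2" using potential_maximizer[OF tl] by blast
  moreover have "e ` {0..2} \<subseteq> U" using c(5) d(5) U by (force simp: e_def)
  moreover have "p \<in> e ` {0..2}" using e by force
  ultimately show ?thesis using tl e unfolding timelike_side_def by blast
qed

text \<open>Division points are described by separations alone, without reference to a curve. At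
  this stage they are not known to be unique; \<open>cmp_set_side\<close> puts each of them on some
  side.\<close>

definition ratio where
  "ratio x y l p \<longleftrightarrow> T x p = l * T x y \<and> T p y = (1 - l) * T x y"

lemma ratio_ch:
  assumes "cmp_set W" "x \<in> W" "y \<in> W" "p \<in> W" "x \<lless> y" "ratio x y l p" "0 < l" "l < 1"
  shows "x \<lless> p" "p \<lless> y"
  using assms cmp_set_ch[OF assms(1)] by (auto simp: ratio_def)

text \<open>Along a maximizer the separation from \<open>x\<close> grows continuously from 0 to
  \<open>T x y\<close>, so it takes the value \<open>l * T x y\<close>.\<close>

lemma ratio_exists:
  assumes W: "cmp_set W" and xy: "x \<in> W" "y \<in> W" "x \<lless> y" and l: "0 < l" "l < 1"
  shows "\<exists>m\<in>W. ratio x y l m"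
proof -
  obtain c f where c: "timelike_curve X c 0 1" "potential X c 0 1 f" "c 0 = x" "c 1 = y"
      "c ` {0..1} \<subseteq> W" using cmp_set_connect[OF W xy, of 0 1] by auto
  have e: "T (c s) (c t) = f t - f s" if "0 \<le> s" "s \<le> t" "t \<le> 1" for s t
    using potentialD[OF c(2) that] by (simp add: T_def)
  have "continuous_on {0..1} (\<lambda>t. (case (x, c t) of (x, y) \<Rightarrow> T x y))"
    using c(5) xy timelike_curve_cont[OF c(1)]
    by (intro continuous_on_compose2[OF cmp_set_cont[OF W]] continuous_intros) auto
  then have "continuous_on {0..1} (\<lambda>t. T x (c t))" by simp
  moreover have "T x (c 0) \<le> l * T x y" "l * T x y \<le> T x (c 1)"
    using c l by (auto simp: mult_left_le_one_le)
  ultimately obtain t where t: "0 \<le> t" "t \<le> 1" "T x (c t) = l * T x y"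
    using IVT'[of "\<lambda>t. T x (c t)" 0 "l * T x y" 1] by auto
  have "T x (c t) + T (c t) y = T x y"
    using e[of 0 t] e[of t 1] e[of 0 1] t c by simp
  then have "ratio x y l (c t)" using t by (simp add: ratio_def algebra_simps)
  moreover have "c t \<in> W" using c(5) t by auto
  ultimately show ?thesis by blast
qed

end

section \<open>Triangle comparison in coordinates\<close>

text \<open>The apex of a Minkowski triangle whose longest side, of length \<open>c\<close>, lies on
  the time axis. Subtracting the two equations gives \<open>u\<close>; the reverse triangle
  inequality gives \<open>a \<le> u \<le> c - b\<close>, so \<open>u\<^sup>2 - a\<^sup>2\<close> has
  a root \<open>v\<close>, taken nonnegative.\<close>

lemma comparison_apex:
  fixes a b c :: real
  assumes "0 < a" "0 < b" "a + b \<le> c"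
  obtains u v where "0 \<le> v" "v < u" "v < c - u" "u\<^sup>2 - v\<^sup>2 = a\<^sup>2" "(c - u)\<^sup>2 - v\<^sup>2 = b\<^sup>2"
    "u \<le> c - b" "a \<le> u"
proof -
  define u where "u = (a\<^sup>2 - b\<^sup>2 + c\<^sup>2) / (2 * c)"
  have c: "0 < c" using assms by simp
  have uc: "2 * c * u = a\<^sup>2 - b\<^sup>2 + c\<^sup>2" using c by (simp add: u_def)
  have sq: "b\<^sup>2 \<le> (c - a)\<^sup>2" "a\<^sup>2 \<le> (c - b)\<^sup>2" using assms by (auto intro!: power_mono)
  have "2 * c * a \<le> 2 * c * u" unfolding uc using sq(1) by (simp add: power2_eq_square algebra_simps)
  then have au: "a \<le> u" using c by simp
  have "2 * c * u \<le> 2 * c * (c - b)" unfolding uc using sq(2) by (simp add: power2_eq_square algebra_simps)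
  then have ub: "u \<le> c - b" using c by simp
  define v where "v = sqrt (u\<^sup>2 - a\<^sup>2)"
  have "a\<^sup>2 \<le> u\<^sup>2" using au assms by (intro power_mono) auto
  then have v: "0 \<le> v" "v\<^sup>2 = u\<^sup>2 - a\<^sup>2" by (auto simp: v_def)
  have 1: "u\<^sup>2 - v\<^sup>2 = a\<^sup>2" using v by simp
  have 2: "(c - u)\<^sup>2 - v\<^sup>2 = b\<^sup>2" using v uc by (simp add: power2_eq_square algebra_simps)
  have "v\<^sup>2 < u\<^sup>2" using 1 assms by (smt (verit) zero_less_power)
  then have 3: "v < u" using au assms by (smt (verit) power_mono)
  have "v\<^sup>2 < (c - u)\<^sup>2" using 2 assms by (smt (verit) zero_less_power)
  then have 4: "v < c - u" using ub assms by (smt (verit) power_mono)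
  show ?thesis using that[OF v(1) 3 4 1 2 ub au] .
qed

lemma minkowski_sep_scale:
  assumes "0 \<le> k" "\<bar>snd q - snd p\<bar> \<le> fst q - fst p"
    "fst q' - fst p' = k * (fst q - fst p)" "snd q' - snd p' = k * (snd q - snd p)"
  shows "minkowski_sep p' q' = k * minkowski_sep p q"
proof -
  have "\<bar>snd q' - snd p'\<bar> \<le> fst q' - fst p'"
    unfolding assms(3,4) using assms(1,2) by (simp add: abs_mult mult_left_mono)
  moreover have "(k * (fst q - fst p))\<^sup>2 - (k * (snd q - snd p))\<^sup>2 =
      k\<^sup>2 * ((fst q - fst p)\<^sup>2 - (snd q - snd p)\<^sup>2)"
    by (simp add: power2_eq_square algebra_simps)
  ultimately show ?thesis
    using assms by (simp add: minkowski_sep_def real_sqrt_mult)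
qed

lemma minkowski_sep_pos:
  "\<bar>snd q - snd p\<bar> < fst q - fst p \<Longrightarrow> 0 < minkowski_sep p q"
proof -
  assume *: "\<bar>snd q - snd p\<bar> < fst q - fst p"
  then have "\<bar>snd q - snd p\<bar>\<^sup>2 < (fst q - fst p)\<^sup>2" by (intro power_strict_mono) auto
  then show ?thesis using * by (simp add: minkowski_sep_def)
qed

context curved_space begin

lemma corresponding_ratio:
  assumes W: "cmp_set W" and xy: "x \<in> W" "y \<in> W" "p \<in> W" and p: "p \<in> S" "ratio x y l p"
    and l: "0 < l" "l < 1" and tl: "\<bar>snd y' - snd x'\<bar> \<le> fst y' - fst x'"
    and sep: "minkowski_sep x' y' = T x y"
  shows "corresponding X S x y x' y' p
     (fst x' + l * (fst y' - fst x'), snd x' + l * (snd y' - snd x'))"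
proof -
  let ?p = "(fst x' + l * (fst y' - fst x'), snd x' + l * (snd y' - snd x'))"
  have "minkowski_sep x' ?p = l * minkowski_sep x' y'" using l tl
    by (intro minkowski_sep_scale) auto
  moreover have "minkowski_sep ?p y' = (1 - l) * minkowski_sep x' y'" using l tl
    by (intro minkowski_sep_scale) (auto simp: algebra_simps)
  moreover have "?p = (1 - l) *\<^sub>R x' + l *\<^sub>R y'" by (simp add: prod_eq_iff algebra_simps)
  then have "?p \<in> closed_segment x' y'" using l unfolding closed_segment_def by auto
  ultimately show ?thesis
    using p l unfolding corresponding_def ratio_def cmp_set_tau[OF W xy(1,3)] cmp_set_tau[OF W xy(3,2)] sep
    by simp
qed

text \<open>The comparison triangle is normalised to have its long side on the time axis, with vertices
  \<open>(0, 0)\<close>, \<open>(u, v)\<close> and \<open>(T x z, 0)\<close>.\<close>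

lemma comparison:
  assumes W: "cmp_set W" and xyz: "x \<in> W" "y \<in> W" "z \<in> W" "x \<lless> y" "y \<lless> z"
  obtains u v where "0 \<le> v" "v < u" "v < T x z - u" "u\<^sup>2 - v\<^sup>2 = (T x y)\<^sup>2"
    "(T x z - u)\<^sup>2 - v\<^sup>2 = (T y z)\<^sup>2" "u \<le> T x z - T y z" "T x y \<le> u"
    "\<And>p l r n. \<lbrakk>p \<in> W; r \<in> W; ratio x y l p; ratio x z n r; 0 < l; l < 1; 0 < n; n < 1\<rbrakk> \<Longrightarrow>
      minkowski_sep (l * u, l * v) (n * T x z, 0) \<le> T p r \<and>
       minkowski_sep (n * T x z, 0) (l * u, l * v) \<le> T r p"
    "\<And>q m r n. \<lbrakk>q \<in> W; r \<in> W; ratio y z m q; ratio x z n r; 0 < m; m < 1; 0 < n; n < 1\<rbrakk> \<Longrightarrow>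
      minkowski_sep (u + m * (T x z - u), v - m * v) (n * T x z, 0) \<le> T q r \<and>
       minkowski_sep (n * T x z, 0) (u + m * (T x z - u), v - m * v) \<le> T r q"
    "\<And>p l q m. \<lbrakk>p \<in> W; q \<in> W; ratio x y l p; ratio y z m q; 0 < l; l < 1; 0 < m; m < 1\<rbrakk> \<Longrightarrow>
      minkowski_sep (l * u, l * v) (u + m * (T x z - u), v - m * v) \<le> T p q"
proof -
  have xz: "x \<lless> z" using xyz chron_trans by blast
  have pos: "0 < T x y" "0 < T y z" "0 < T x z" using xyz xz cmp_set_ch[OF W] by auto
  have "T x y + T y z \<le> T x z" using xyz chron_imp_causal by (intro cmp_set_rev_tri[OF W]) auto
  then obtain u v where uv: "0 \<le> v" "v < u" "v < T x z - u" "u\<^sup>2 - v\<^sup>2 = (T x y)\<^sup>2"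
    "(T x z - u)\<^sup>2 - v\<^sup>2 = (T y z)\<^sup>2" "u \<le> T x z - T y z" "T x y \<le> u"
    using comparison_apex[OF pos(1,2)] by blast
  obtain U where U: "comparison_neighborhood X U" "W \<subseteq> U" using W unfolding cmp_set_def by blast
  let ?x = "(0, 0) :: real \<times> real" and ?y = "(u, v)" and ?z = "(T x z, 0) :: real \<times> real"
  have s1: "minkowski_sep ?x ?y = T x y" using uv pos by (simp add: minkowski_sep_def)
  have s2: "minkowski_sep ?y ?z = T y z" using uv pos by (simp add: minkowski_sep_def)
  have s3: "minkowski_sep ?x ?z = T x z" using pos by (simp add: minkowski_sep_def)
  have tri: "comparison_triangle X x y z ?x ?y ?z"
    using xyz by (simp add: comparison_triangle_def s1 s2 s3 cmp_set_tau[OF W])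
  have side: "\<exists>S. timelike_side X U S a b \<and> p \<in> S"
    if "a \<in> W" "b \<in> W" "p \<in> W" "a \<lless> b" "ratio a b k p" "0 < k" "k < 1" for a b p k
    using that ratio_ch[OF W that(1,2,3,4,5,6,7)]
    by (intro cmp_set_side[OF W U(2)]) (auto simp: ratio_def algebra_simps)
  have main: "minkowski_sep p' q' \<le> T p q"
    if S: "timelike_side X U Sxy x y" "timelike_side X U Syz y z" "timelike_side X U Sxz x z"
      and p: "corresponding_on_triangle X Sxy Syz Sxz x y z ?x ?y ?z p p'"
      and q: "corresponding_on_triangle X Sxy Syz Sxz x y z ?x ?y ?z q q'"
      and pq: "p \<in> W" "q \<in> W"
    for Sxy Syz Sxz p p' q q'
  proof -
    have "\<tau> x z < \<infinity>" using cmp_set_tau[OF W xyz(1,3)] by simp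
    have C: "\<forall>x y z Sxy Syz Sxz x' y' z' p q p' q'.
        x \<lless> y \<longrightarrow> y \<lless> z \<longrightarrow> \<tau> x z < \<infinity> \<longrightarrow>
        timelike_side X U Sxy x y \<longrightarrow> timelike_side X U Syz y z \<longrightarrow> timelike_side X U Sxz x z \<longrightarrow>
        comparison_triangle X x y z x' y' z' \<longrightarrow>
        corresponding_on_triangle X Sxy Syz Sxz x y z x' y' z' p p' \<longrightarrow>
        corresponding_on_triangle X Sxy Syz Sxz x y z x' y' z' q q' \<longrightarrow>
        \<tau> p q \<ge> ennreal (minkowski_sep p' q')"
      using U(1) unfolding comparison_neighborhood_def by (elim conjE)
    have "ennreal (minkowski_sep p' q') \<le> \<tau> p q"
      by (rule C[rule_format, OF xyz(4,5) \<open>\<tau> x z < \<infinity>\<close> S tri p q])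
    then show ?thesis using pq by (simp add: cmp_set_tau[OF W])
  qed
  \<comment> \<open>The curvature bound needs all three sides. On a side that carries no prescribed
    point the midpoint takes that role and produces the side.\<close>
  obtain p0 q0 r0 where half: "p0 \<in> W" "ratio x y (1/2) p0" "q0 \<in> W" "ratio y z (1/2) q0"
      "r0 \<in> W" "ratio x z (1/2) r0"
    using ratio_exists[OF W xyz(1,2,4), of "1/2"] ratio_exists[OF W xyz(2,3,5), of "1/2"]
      ratio_exists[OF W xyz(1,3) xz, of "1/2"] by auto
  have all: "minkowski_sep (l * u, l * v) (n * T x z, 0) \<le> T p r \<and>
       minkowski_sep (n * T x z, 0) (l * u, l * v) \<le> T r p \<and>
       minkowski_sep (u + m * (T x z - u), v - m * v) (n * T x z, 0) \<le> T q r \<and>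
       minkowski_sep (n * T x z, 0) (u + m * (T x z - u), v - m * v) \<le> T r q \<and>
       minkowski_sep (l * u, l * v) (u + m * (T x z - u), v - m * v) \<le> T p q"
    if A: "p \<in> W" "q \<in> W" "r \<in> W" "ratio x y l p" "ratio y z m q" "ratio x z n r"
      "0 < l" "l < 1" "0 < m" "m < 1" "0 < n" "n < 1" for p q r l m n
  proof -
    obtain Sxy where S1: "timelike_side X U Sxy x y" "p \<in> Sxy"
      using side[OF xyz(1,2) A(1) xyz(4) A(4,7,8)] by blast
    obtain Syz where S2: "timelike_side X U Syz y z" "q \<in> Syz"
      using side[OF xyz(2,3) A(2) xyz(5) A(5,9,10)] by blast
    obtain Sxz where S3: "timelike_side X U Sxz x z" "r \<in> Sxz"
      using side[OF xyz(1,3) A(3) xz A(6,11,12)] by blast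
    have "corresponding X Sxy x y ?x ?y p (l * u, l * v)"
      using corresponding_ratio[OF W xyz(1,2) A(1) S1(2) A(4,7,8), of ?y ?x] uv s1 by simp
    moreover have "corresponding X Syz y z ?y ?z q (u + m * (T x z - u), v - m * v)"
      using corresponding_ratio[OF W xyz(2,3) A(2) S2(2) A(5,9,10), of ?z ?y] uv s2 by simp
    moreover have "corresponding X Sxz x z ?x ?z r (n * T x z, 0)"
      using corresponding_ratio[OF W xyz(1,3) A(3) S3(2) A(6,11,12), of ?z ?x] pos s3 by simp
    ultimately have "corresponding_on_triangle X Sxy Syz Sxz x y z ?x ?y ?z p (l * u, l * v)"
      "corresponding_on_triangle X Sxy Syz Sxz x y z ?x ?y ?z q (u + m * (T x z - u), v - m * v)"
      "corresponding_on_triangle X Sxy Syz Sxz x y z ?x ?y ?z r (n * T x z, 0)"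
      by (auto simp: corresponding_on_triangle_def)
    then show ?thesis using main[OF S1(1) S2(1) S3(1)] A by blast
  qed
  have h: "(0::real) < 1 / 2" "(1::real) / 2 < 1" by simp_all
  note pr = all[OF _ half(3) _ _ half(4) _ _ _ h] and qr = all[OF half(1) _ _ half(2) _ _ h]
    and pq = all[OF _ _ half(5) _ _ half(6) _ _ _ _ h]
  show ?thesis
  proof (rule that[OF uv])
    fix p l r n
    assume "p \<in> W" "r \<in> W" "ratio x y l p" "ratio x z n r" "0 < l" "l < 1" "0 < n" "n < 1"
    from pr[OF this] show "minkowski_sep (l * u, l * v) (n * T x z, 0) \<le> T p r \<and>
       minkowski_sep (n * T x z, 0) (l * u, l * v) \<le> T r p" by blast
  next
    fix q m r n
    assume "q \<in> W" "r \<in> W" "ratio y z m q" "ratio x z n r" "0 < m" "m < 1" "0 < n" "n < 1"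
    from qr[OF this] show "minkowski_sep (u + m * (T x z - u), v - m * v) (n * T x z, 0) \<le> T q r \<and>
       minkowski_sep (n * T x z, 0) (u + m * (T x z - u), v - m * v) \<le> T r q" by blast
  next
    fix p l q m
    assume "p \<in> W" "q \<in> W" "ratio x y l p" "ratio y z m q" "0 < l" "l < 1" "0 < m" "m < 1"
    from pq[OF this] show "minkowski_sep (l * u, l * v) (u + m * (T x z - u), v - m * v) \<le> T p q"
      by blast
  qed
qed

section \<open>Order relations read off from comparison triangles\<close>

lemma comparison_below:
  assumes W: "cmp_set W" and "x \<in> W" "y \<in> W" "z \<in> W" "x \<lless> y" "y \<lless> z" "p \<in> W" "r \<in> W"
    "ratio x y l p" "ratio x z l r" "0 < l" "l < 1"
  shows "p \<lless> r"
proof -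
  obtain u v where uv: "0 \<le> v" "v < u" "v < T x z - u" and
    "minkowski_sep (l * u, l * v) (l * T x z, 0) \<le> T p r"
    by (rule comparison[OF assms(1-6)]) (use assms(7-) in blast)
  \<comment> \<open>The vector between the two model points is \<open>l\<close> times the side from
    the apex to the image of \<open>z\<close>, hence timelike.\<close>
  moreover have "0 < minkowski_sep (l * u, l * v) (l * T x z, 0)"
    using uv assms by (intro minkowski_sep_pos) (simp add: abs_mult flip: right_diff_distrib)
  ultimately show ?thesis using assms by (simp add: cmp_set_ch[OF W])
qed

text \<open>In the model, the vector from the image of \<open>r\<close> to that of \<open>q\<close>
  is \<open>1 - l\<close> times the side from the image of \<open>x\<close> to the apex, hence
  timelike.\<close>

lemma comparison_above:
  assumes W: "cmp_set W" and "x \<in> W" "y \<in> W" "z \<in> W" "x \<lless> y" "y \<lless> z" "q \<in> W" "r \<in> W"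
    "ratio y z l q" "ratio x z l r" "0 < l" "l < 1"
  shows "r \<lless> q"
proof -
  obtain u v where uv: "0 \<le> v" "v < u" "v < T x z - u" and
    "minkowski_sep (l * T x z, 0) (u + l * (T x z - u), v - l * v) \<le> T r q"
    by (rule comparison[OF assms(1-6)]) (use assms(7-) in blast)
  moreover have "\<bar>(1 - l) * v\<bar> < (1 - l) * u"
    using uv assms by (simp add: abs_mult)
  then have "0 < minkowski_sep (l * T x z, 0) (u + l * (T x z - u), v - l * v)"
    by (intro minkowski_sep_pos) (simp add: algebra_simps)
  ultimately show ?thesis using assms by (simp add: cmp_set_ch[OF W])
qed

text \<open>The points \<open>p\<close> and \<open>q\<close> lie on different sides at \<open>y\<close>; a geodesic that is a maximizer from \<open>p\<close> to
  \<open>q\<close> thus cannot have a corner at \<open>y\<close>.\<close>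

lemma comparison_straight:
  assumes W: "cmp_set W" and xyz: "x \<in> W" "y \<in> W" "z \<in> W" "x \<lless> y" "y \<lless> z"
    and "p \<in> W" "q \<in> W" "ratio x y l p" "ratio y z m q" "0 < l" "l < 1" "0 < m" "m < 1"
    and le: "T p q \<le> (1 - l) * T x y + m * T y z"
  shows "T x z = T x y + T y z"
proof -
  let ?a = "T x y" and ?b = "T y z" and ?c = "T x z"
  obtain u v where uv: "0 \<le> v" "v < u" "v < ?c - u" "u\<^sup>2 - v\<^sup>2 = ?a\<^sup>2" "(?c - u)\<^sup>2 - v\<^sup>2 = ?b\<^sup>2" and
    sep: "minkowski_sep (l * u, l * v) (u + m * (?c - u), v - m * v) \<le> T p q"
    by (rule comparison[OF assms(1-6)]) (use assms(7-) in blast)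
  have 1: "\<bar>(1 - l) * v - m * v\<bar> \<le> (1 - l) * u + m * (?c - u)"
  proof -
    have "0 \<le> (1 - l) * v" "0 \<le> m * v" "(1 - l) * v \<le> (1 - l) * u" "m * v \<le> m * (?c - u)"
      using uv assms by (auto intro: mult_left_mono)
    then show ?thesis by linarith
  qed
  have "((1 - l) * u + m * (?c - u))\<^sup>2 - ((1 - l) * v - m * v)\<^sup>2 \<le> (T p q)\<^sup>2"
  proof -
    have "minkowski_sep (l * u, l * v) (u + m * (?c - u), v - m * v) =
       sqrt (((1 - l) * u + m * (?c - u))\<^sup>2 - ((1 - l) * v - m * v)\<^sup>2)"
      using 1 by (simp add: minkowski_sep_def algebra_simps)
    then show ?thesis using sep by (simp add: real_le_lsqrt sqrt_le_D)
  qed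
  also have "\<dots> \<le> ((1 - l) * ?a + m * ?b)\<^sup>2" using le by (intro power_mono) auto
  finally have 2: "((1 - l) * u + m * (?c - u))\<^sup>2 - ((1 - l) * v - m * v)\<^sup>2 \<le> ((1 - l) * ?a + m * ?b)\<^sup>2" .
  \<comment> \<open>The model vector from \<open>p\<close> to \<open>q\<close> is
    \<open>1 - l\<close> times the first side plus \<open>m\<close> times the second, and
    \<open>u * (?c - u) + v\<^sup>2\<close> is the Minkowski product of these sides. The assumption
    bounds it by the product of their lengths, the equality case of the reverse Cauchy-Schwarz
    inequality.\<close>
  have "((1 - l) * u + m * (?c - u))\<^sup>2 - ((1 - l) * v - m * v)\<^sup>2 =
     (1 - l)\<^sup>2 * (u\<^sup>2 - v\<^sup>2) + m\<^sup>2 * ((?c - u)\<^sup>2 - v\<^sup>2) + 2 * ((1 - l) * m) * (u * (?c - u) + v\<^sup>2)"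
    by (simp add: power2_eq_square algebra_simps)
  moreover have "((1 - l) * ?a + m * ?b)\<^sup>2 = (1 - l)\<^sup>2 * ?a\<^sup>2 + m\<^sup>2 * ?b\<^sup>2 + 2 * ((1 - l) * m) * (?a * ?b)"
    by (simp add: power2_eq_square algebra_simps)
  ultimately have "2 * ((1 - l) * m) * (u * (?c - u) + v\<^sup>2) \<le> 2 * ((1 - l) * m) * (?a * ?b)"
    using 2 uv by simp
  moreover have "0 < 2 * ((1 - l) * m)" using assms by simp
  ultimately have "u * (?c - u) + v\<^sup>2 \<le> ?a * ?b" by (meson mult_le_cancel_left_pos)
  moreover have "?c\<^sup>2 = ?a\<^sup>2 + ?b\<^sup>2 + 2 * (u * (?c - u) + v\<^sup>2)"
    using uv(4,5) by (simp add: power2_eq_square algebra_simps)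
  ultimately have "?c\<^sup>2 \<le> (?a + ?b)\<^sup>2" by (simp add: power2_eq_square algebra_simps)
  then have "?c \<le> ?a + ?b" by (rule power2_le_imp_le) simp
  moreover have "?a + ?b \<le> ?c" using xyz chron_imp_causal by (intro cmp_set_rev_tri[OF W]) auto
  ultimately show ?thesis by simp
qed

text \<open>Replaces continuity of maximizers in their endpoints: \<open>\<gamma>\<close> cannot be prolonged beyond its source,
  so the barriers there start at a point slightly before it.\<close>

lemma comparison_past_vertex:
  assumes W: "cmp_set W" and xyz: "x \<in> W" "y \<in> W" "z \<in> W" "x \<lless> y" "y \<lless> z"
    and "q \<in> W" "r \<in> W" "ratio y z m q" "ratio x z n r" "0 < m" "m < n" "n < 1"
    and le: "2 * (T x z - T y z) < (n - m) * T y z"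
  shows "q \<lless> r"
proof -
  obtain u v where uv: "0 \<le> v" "v < u" "v < T x z - u" "u \<le> T x z - T y z" and
    sep: "minkowski_sep (u + m * (T x z - u), v - m * v) (n * T x z, 0) \<le> T q r"
    by (rule comparison[OF assms(1-6)]) (use assms(7-) in fastforce)
  have "0 < T x z - T y z" using uv by linarith
  then have "(n - m) * T y z \<le> (n - m) * T x z" using assms by (intro mult_left_mono) auto
  moreover have "m * u + m * v \<ge> 0" using uv assms by (intro add_nonneg_nonneg mult_nonneg_nonneg) auto
  \<comment> \<open>Both coordinates of the apex are at most the excess of \<open>T x z\<close> over
    \<open>T y z\<close>, which is small against the gap between \<open>m\<close> and
    \<open>n\<close>.\<close>
  moreover have "u + v < 2 * (T x z - T y z)" using uv(2,4) by argo
  ultimately have "u + v - (m * u + m * v) < (n - m) * T x z" using le by linarith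
  moreover have "0 \<le> v - m * v" using uv assms by (simp add: mult_left_le_one_le)
  ultimately have "0 < minkowski_sep (u + m * (T x z - u), v - m * v) (n * T x z, 0)"
    by (intro minkowski_sep_pos) (simp add: algebra_simps)
  then show ?thesis using sep assms by (simp add: cmp_set_ch[OF W])
qed

text \<open>The time reversal of \<open>comparison_past_vertex\<close>, for barriers that end
  slightly after the target. Here \<open>v < T x z - u \<le> T x z - T x y\<close>, so the apex is
  close to the end of the long side compared with the gap between \<open>n\<close> and
  \<open>l\<close>.\<close>

lemma comparison_future_vertex:
  assumes W: "cmp_set W" and xyz: "x \<in> W" "y \<in> W" "z \<in> W" "x \<lless> y" "y \<lless> z"
    and "p \<in> W" "r \<in> W" "ratio x y l p" "ratio x z n r" "0 < n" "n < l" "l < 1"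
    and le: "2 * (T x z - T x y) < (l - n) * T x y"
  shows "r \<lless> p"
proof -
  obtain u v where uv: "0 \<le> v" "v < u" "v < T x z - u" "T x y \<le> u" and
    sep: "minkowski_sep (n * T x z, 0) (l * u, l * v) \<le> T r p"
    by (rule comparison[OF assms(1-6)]) (use assms(7-) in fastforce)
  have "0 < T x z - T x y" using uv by linarith
  then have 1: "(l - n) * T x y \<le> (l - n) * T x z" using assms by (intro mult_left_mono) auto
  have "l * (T x z - u + v) \<le> T x z - u + v" using uv assms by (intro mult_left_le_one_le) auto
  then have "l * v < l * u - n * T x z" using 1 le uv by (simp add: algebra_simps)
  moreover have "0 \<le> l * v" using uv assms by simp
  ultimately have "0 < minkowski_sep (n * T x z, 0) (l * u, l * v)"
    by (intro minkowski_sep_pos) (simp add: algebra_simps)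
  then show ?thesis using sep assms by (simp add: cmp_set_ch[OF W])
qed

text \<open>The division point \<open>d\<close> of the diagonal from \<open>x\<close> to
  \<open>y'\<close> mediates: \<open>comparison_below\<close> moves the later endpoint,
  \<open>comparison_above\<close> the earlier one. One pair of endpoints may coincide, as happens
  next to the common ends of two geodesics.\<close>

lemma comparison_quad:
  assumes W: "cmp_set W" and mem: "x \<in> W" "y \<in> W" "x' \<in> W" "y' \<in> W" "m \<in> W" "m' \<in> W"
    and ch: "x \<lless> y" "x' \<lless> y'" and x: "x = x' \<or> x \<lless> x'" and y: "y = y' \<or> y \<lless> y'"
    and ne: "\<not> (x = x' \<and> y = y')"
    and m: "ratio x y l m" "ratio x' y' l m'" and l: "0 < l" "l < 1"
  shows "m \<lless> m'"
proof -
  have xy': "x \<lless> y'" using ch y chron_trans by blast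
  obtain d where d: "d \<in> W" "ratio x y' l d" using ratio_exists[OF W mem(1,4) xy' l] by blast
  have 1: "m \<lless> d" if "y \<lless> y'"
    using comparison_below[OF W mem(1,2,4) ch(1) that mem(5) d(1) m(1) d(2) l] .
  have 2: "d \<lless> m'" if "x \<lless> x'"
    using comparison_above[OF W mem(1,3,4) that ch(2) mem(6) d(1) m(2) d(2) l] .
  show ?thesis
  proof (cases "x = x'")
    \<comment> \<open>As division points are not known to be unique, \<open>m'\<close> itself takes
      the place of \<open>d\<close>.\<close>
    case True
    then have "y \<lless> y'" using y ne by blast
    then show ?thesis
      using comparison_below[OF W mem(1,2,4) ch(1) _ mem(5,6) m(1) _ l] m(2) True by simp
  next
    case False
    then have x: "x \<lless> x'" using x by simp
    show ?thesis
    proof (cases "y = y'")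
      case True
      then show ?thesis
        using comparison_above[OF W mem(1,3,4) x ch(2) mem(6,5) m(2) _ l] m(1) by simp
    next
      case False
      then show ?thesis using 1 2 x y chron_trans by blast
    qed
  qed
qed

end

section \<open>Local geodesics and their arclength functions\<close>

text \<open>A monotone function onto the whole line has no jumps; extension by the identity makes
  \<phi> such a function.\<close>

lemma reparam_continuous:
  assumes "reparam \<phi>" shows "continuous_on {0..1} \<phi>"
proof -
  define h where "h t = (if t \<in> {0..1} then \<phi> t else t)" for t
  have sm: "strict_mono_on {0..1} \<phi>" and im: "\<phi> ` {0..1} = {0..1}"
    using assms by (auto simp: reparam_def)
  have "t \<in> range h" for t
  proof (cases "t \<in> {0..1}")
    case True
    then obtain s where "s \<in> {0..1}" "t = \<phi> s" using im by (metis imageE)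
    then show ?thesis by (auto simp: h_def image_iff)
  next
    case False
    then show ?thesis by (auto simp: h_def image_iff)
  qed
  then have "range h = UNIV" by auto
  moreover have "h s \<le> h t" if "s \<le> t" for s t
  proof -
    have "\<phi> s \<in> {0..1}" if "s \<in> {0..1}" for s using that im by blast
    then have "h s \<in> {0..1} \<longleftrightarrow> s \<in> {0..1}" "h t \<in> {0..1} \<longleftrightarrow> t \<in> {0..1}"
      by (auto simp: h_def)
    moreover have "\<phi> s \<le> \<phi> t" if "s \<in> {0..1}" "t \<in> {0..1}"
      using sm that \<open>s \<le> t\<close> by (metis strict_mono_on_leD)
    ultimately show ?thesis using that by (auto simp: h_def split: if_splits)
  qed
  ultimately have "continuous_on UNIV h" by (intro continuous_onI_mono) auto
  then have "continuous_on {0..1} h" by (rule continuous_on_subset) simp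
  then show ?thesis by (rule continuous_on_eq) (simp add: h_def)
qed

text \<open>An interval function that is additive at scale \<open>e\<close> has a primitive: a
  primitive up to \<open>a = n * e\<close> is continued by \<open>F a t\<close>, and additivity
  makes the increments across \<open>a\<close> agree.\<close>

lemma local_potential:
  fixes F :: "real \<Rightarrow> real \<Rightarrow> real"
  assumes e: "0 < e"
    and add: "\<And>s t u. \<lbrakk>0 \<le> s; s \<le> t; t \<le> u; u \<le> 1; u - s \<le> e\<rbrakk> \<Longrightarrow> F s t + F t u = F s u"
  obtains f where "f 0 = 0"
    "\<And>s t. \<lbrakk>0 \<le> s; s \<le> t; t \<le> 1; t - s \<le> e\<rbrakk> \<Longrightarrow> F s t = f t - f s"
proof -
  have "\<exists>f. f 0 = 0 \<and> (\<forall>s t. 0 \<le> s \<longrightarrow> s \<le> t \<longrightarrow> t \<le> 1 \<longrightarrow> t \<le> real n * e \<longrightarrow> t - s \<le> e \<longrightarrow> F s t = f t - f s)"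
    for n :: nat
  proof (induction n)
    case 0
    then show ?case using add[of 0 0 0] e by (intro exI[of _ "\<lambda>_. 0"]) (auto dest!: antisym[of _ "0::real"])
  next
    case (Suc n)
    then obtain f where f: "f 0 = 0"
      "\<And>s t. \<lbrakk>0 \<le> s; s \<le> t; t \<le> 1; t \<le> real n * e; t - s \<le> e\<rbrakk> \<Longrightarrow> F s t = f t - f s"
      by blast
    define a where "a = real n * e"
    define g where "g t = (if t \<le> a then f t else f a + F a t)" for t
    have a: "0 \<le> a" using e by (simp add: a_def)
    have "F s t = g t - g s"
      if st: "0 \<le> s" "s \<le> t" "t \<le> 1" "t \<le> real (Suc n) * e" "t - s \<le> e" for s t
    proof -
      have ta: "t - a \<le> e" using st(4) by (simp add: a_def algebra_simps)
      consider "t \<le> a" | "a < s" | "s \<le> a" "a < t" by linarith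
      then show ?thesis
      proof cases
        case 1
        then show ?thesis using f(2)[of s t] st by (simp add: g_def a_def)
      next
        case 2
        then show ?thesis using add[of a s t] st ta a by (simp add: g_def)
      next
        case 3
        then show ?thesis using add[of s a t] f(2)[of s a] st ta a by (simp add: g_def a_def)
      qed
    qed
    moreover have "g 0 = 0" using a f by (simp add: g_def)
    ultimately show ?case by blast
  qed
  moreover obtain n :: nat where "1 / e \<le> real n" using real_arch_simple by blast
  then have "1 \<le> real n * e" using e by (simp add: field_simps)
  ultimately show ?thesis using that by (meson order_trans)
qed

lemma uniform_partition:
  assumes "0 < n" "a < b" shows "(n, \<lambda>i. a + (b - a) * (real i / real n)) \<in> partitions a b"
  using assms by (auto simp: partitions_def divide_strict_right_mono)

lemma uniform_partition_step:
  assumes "0 < n"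
  shows "(a + (b - a) * (real (Suc i) / real n)) - (a + (b - a) * (real i / real n)) = (b - a) / real n"
  using assms by (simp add: field_simps)

text \<open>Half of the Lebesgue number of the cover is spent on the ball around \<open>c t\<close>,
  the other half on the movement of \<open>c\<close> between \<open>s\<close> and
  \<open>t\<close>.\<close>

lemma lebesgue_curve:
  fixes c :: "real \<Rightarrow> 'a::metric_space"
  assumes c: "continuous_on {0..1} c" and G: "\<And>W. W \<in> G \<Longrightarrow> open W" "\<And>t. t \<in> {0..1} \<Longrightarrow> \<exists>W\<in>G. c t \<in> W"
  obtains r h where "0 < r" "0 < h"
    "\<And>s. s \<in> {0..1} \<Longrightarrow> \<exists>W\<in>G. \<forall>t\<in>{0..1}. \<bar>t - s\<bar> \<le> h \<longrightarrow> ball (c t) r \<subseteq> W"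
proof -
  have "c ` {0..1} \<subseteq> \<Union>G" using G(2) by fastforce
  then obtain r where r: "0 < r" "\<And>x. x \<in> c ` {0..1} \<Longrightarrow> \<exists>W\<in>G. ball x r \<subseteq> W"
    using Heine_Borel_lemma[OF compact_continuous_image[OF c compact_Icc] _ G(1)] by blast
  have "uniformly_continuous_on {0..1} c" using c by (rule compact_uniformly_continuous) simp
  then obtain d where d: "0 < d"
    "\<And>s t. \<lbrakk>s \<in> {0..1}; t \<in> {0..1}; dist t s < d\<rbrakk> \<Longrightarrow> dist (c t) (c s) < r / 2"
    using r(1) by (metis half_gt_zero uniformly_continuous_on_def)
  show ?thesis
  proof (rule that[of "r / 2" "d / 2"])
    fix s :: real assume s: "s \<in> {0..1}"
    then obtain W where W: "W \<in> G" "ball (c s) r \<subseteq> W" using r(2) by blast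
    have "ball (c t) (r / 2) \<subseteq> ball (c s) r" if "t \<in> {0..1}" "\<bar>t - s\<bar> \<le> d / 2" for t
    proof
      fix x assume "x \<in> ball (c t) (r / 2)"
      moreover have "dist (c t) (c s) < r / 2" using d s that by (auto simp: dist_real_def)
      ultimately show "x \<in> ball (c s) r" using dist_triangle[of "c s" x "c t"]
        by (simp add: dist_commute)
    qed
    then show "\<exists>W\<in>G. \<forall>t\<in>{0..1}. \<bar>t - s\<bar> \<le> d / 2 \<longrightarrow> ball (c t) (r / 2) \<subseteq> W"
      using W by blast
  qed (use r d in auto)
qed

context curved_space begin

text \<open>Geodesics up to reparametrisation: \<open>c\<close> need not be Lipschitz, \<open>e\<close> is a scale below which it is
  maximizing, and \<open>f\<close> is its \<open>\<tau>\<close>-arclength.\<close>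

definition geod :: "(real \<Rightarrow> 'a) \<Rightarrow> real \<Rightarrow> (real \<Rightarrow> real) \<Rightarrow> bool" where
  "geod c e f \<longleftrightarrow> continuous_on {0..1} c \<and> 0 < e \<and> continuous_on {0..1} f \<and>
     strict_mono_on {0..1} f \<and> f 0 = 0 \<and>
     (\<forall>s t. 0 \<le> s \<longrightarrow> s \<le> t \<longrightarrow> t \<le> 1 \<longrightarrow> t - s \<le> e \<longrightarrow> \<tau> (c s) (c t) = ennreal (f t - f s))"

lemma geod_less: "\<lbrakk>geod c e f; 0 \<le> s; s < t; t \<le> 1\<rbrakk> \<Longrightarrow> f s < f t"
  unfolding geod_def by (auto intro: strict_mono_onD)

lemma geod_le: "\<lbrakk>geod c e f; 0 \<le> s; s \<le> t; t \<le> 1\<rbrakk> \<Longrightarrow> f s \<le> f t"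
  using geod_less[of c e f s t] by (cases "s = t") (simp_all add: less_le)

lemma geod_total: "geod c e f \<Longrightarrow> 0 < f 1"
  using geod_less[of c e f 0 1] by (auto simp: geod_def)

text \<open>Beyond the scale \<open>e\<close> equality may fail. Gluing steps of length
  \<open>e\<close> by the reverse triangle inequality keeps the chronological order and one of the
  two bounds.\<close>

lemma geod_lower:
  assumes c: "geod c e f" and st: "0 \<le> s" "s < t" "t \<le> 1"
  shows "c s \<lless> c t" "ennreal (f t - f s) \<le> \<tau> (c s) (c t)"
proof -
  have e: "0 < e" using c by (simp add: geod_def)
  have loc: "c s \<lless> c t \<and> \<tau> (c s) (c t) = ennreal (f t - f s)"
    if "0 \<le> s" "s < t" "t \<le> 1" "t - s \<le> e" for s t
    using c that geod_less[OF c that(1-3)] unfolding chron_iff geod_def by auto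
  have *: "c s \<lless> c t \<and> ennreal (f t - f s) \<le> \<tau> (c s) (c t)"
    if "0 \<le> s" "s < t" "t \<le> 1" "t - s \<le> real n * e" for n s t
    using that
  proof (induction n arbitrary: t)
    case (Suc n)
    show ?case
    proof (cases "t - s \<le> e")
      case True
      then show ?thesis using loc[of s t] Suc.prems by simp
    next
      case False
      define u where "u = t - e"
      have u: "s < u" "u < t" using False e by (auto simp: u_def)
      have 1: "c s \<lless> c u" "ennreal (f u - f s) \<le> \<tau> (c s) (c u)"
        using Suc.IH[of u] Suc.prems u by (auto simp: u_def algebra_simps)
      have 2: "c u \<lless> c t" "\<tau> (c u) (c t) = ennreal (f t - f u)"
        using loc[of u t] Suc.prems u by (auto simp: u_def)
      have "ennreal (f t - f s) = ennreal (f u - f s) + ennreal (f t - f u)"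
        using geod_less[OF c, of s u] geod_less[OF c, of u t] Suc.prems u
        by (subst ennreal_plus[symmetric]) auto
      also have "\<dots> \<le> \<tau> (c s) (c u) + \<tau> (c u) (c t)" using 1 2 by (simp add: add_mono)
      also have "\<dots> \<le> \<tau> (c s) (c t)" using 1 2 chron_imp_causal by (intro rev_tri) auto
      finally show ?thesis using 1 2 chron_trans by blast
    qed
  qed simp
  obtain n :: nat where "(t - s) / e \<le> real n" using real_arch_simple by blast
  then have "t - s \<le> real n * e" using e by (simp add: field_simps)
  then show "c s \<lless> c t" "ennreal (f t - f s) \<le> \<tau> (c s) (c t)" using *[OF st, of n] by auto
qed

text \<open>Sums over fine partitions telescope to \<open>f 1\<close>, and by
  \<open>geod_lower\<close> no partition gives less, whether or not the whole curve is a
  maximizer.\<close>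

lemma geod_tau_length:
  assumes c: "geod c e f" shows "tau_length X c 0 1 = ennreal (f 1)"
proof (rule antisym)
  have f0: "f 0 = 0" and e: "0 < e" using c by (auto simp: geod_def)
  have tele: "(\<Sum>i<n. ennreal (f (t (Suc i)) - f (t i))) = ennreal (f 1)"
    if p: "(n, t) \<in> partitions 0 1" for n t
  proof -
    have "(\<Sum>i<n. ennreal (f (t (Suc i)) - f (t i))) = ennreal (\<Sum>i<n. f (t (Suc i)) - f (t i))"
    proof (intro sum_ennreal)
      fix i assume "i \<in> {..<n}"
      then show "0 \<le> f (t (Suc i)) - f (t i)"
        using geod_less[OF c, of "t i" "t (Suc i)"] partition_mono[OF p, of i] by simp
    qed
    also have "(\<Sum>i<n. f (t (Suc i)) - f (t i)) = f (t n) - f (t 0)"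
      by (rule sum_lessThan_telescope)
    finally show ?thesis using p f0 by (simp add: partitions_def)
  qed
  obtain m :: nat where m: "1 / e \<le> real m" using real_arch_simple by blast
  define n where "n = Suc m"
  have n: "0 < n" "1 / real n \<le> e" using m e by (auto simp: n_def field_simps)
  have p: "(n, \<lambda>i. 0 + (1 - 0) * (real i / real n)) \<in> partitions 0 1"
    using n by (intro uniform_partition) auto
  show "tau_length X c 0 1 \<le> ennreal (f 1)"
  proof -
    let ?t = "\<lambda>i. 0 + (1 - 0) * (real i / real n)"
    have "tau_length X c 0 1 \<le> (\<Sum>i<n. \<tau> (c (?t i)) (c (?t (Suc i))))"
      by (rule tau_length_le_partition[OF p])
    also have "\<dots> = (\<Sum>i<n. ennreal (f (?t (Suc i)) - f (?t i)))"
    proof (intro sum.cong refl)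
      fix i assume "i \<in> {..<n}"
      then have "0 \<le> ?t i" "?t i \<le> ?t (Suc i)" "?t (Suc i) \<le> 1" "?t (Suc i) - ?t i \<le> e"
        using partition_mono[OF p, of i] uniform_partition_step[OF n(1), of 0 1 i] n by auto
      then show "\<tau> (c (?t i)) (c (?t (Suc i))) = ennreal (f (?t (Suc i)) - f (?t i))"
        using c unfolding geod_def by blast
    qed
    also have "\<dots> = ennreal (f 1)" by (rule tele[OF p])
    finally show ?thesis .
  qed
  show "ennreal (f 1) \<le> tau_length X c 0 1"
    unfolding tau_length_def
  proof (rule INF_greatest, clarify)
    fix n t assume p: "(n, t) \<in> partitions 0 1"
    have "ennreal (f 1) = (\<Sum>i<n. ennreal (f (t (Suc i)) - f (t i)))" using tele[OF p] by simp
    also have "\<dots> \<le> (\<Sum>i<n. \<tau> (c (t i)) (c (t (Suc i))))"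
    proof (intro sum_mono)
      fix i assume "i \<in> {..<n}"
      then show "ennreal (f (t (Suc i)) - f (t i)) \<le> \<tau> (c (t i)) (c (t (Suc i)))"
        using partition_mono[OF p, of i] by (intro geod_lower[OF c]) auto
    qed
    finally show "ennreal (f 1) \<le> (\<Sum>i<n. \<tau> (c (t i)) (c (t (Suc i))))" .
  qed
qed

text \<open>Induction on the length in units of \<open>e / 2\<close>: up to \<open>y\<close> the
  curve is maximizing by induction hypothesis, after \<open>y\<close> by the local property. As it
  is also maximizing on a short interval around \<open>y\<close>, \<open>comparison_straight\<close>
  excludes a corner there.\<close>

lemma geod_cmp_set:
  assumes W: "cmp_set W" and c: "geod c e f" and ab: "0 \<le> a" "b \<le> 1" and cW: "c ` {a..b} \<subseteq> W"
  shows "potential X c a b f"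
proof -
  have e: "0 < e" using c by (simp add: geod_def)
  have loc: "\<tau> (c s) (c t) = ennreal (f t - f s)"
    if "0 \<le> s" "s \<le> t" "t \<le> 1" "t - s \<le> e" for s t using c that unfolding geod_def by blast
  have *: "T (c s) (c t) = f t - f s" if "a \<le> s" "s \<le> t" "t \<le> b" "t - s \<le> real (Suc n) * (e / 2)" for n s t
    using that
  proof (induction n arbitrary: s t)
    case 0
    then show ?case using loc[of s t] geod_le[OF c, of s t] ab e by (simp add: T_def)
  next
    case (Suc n)
    show ?case
    proof (cases "t - s \<le> e / 2")
      case True
      then show ?thesis using loc[of s t] geod_le[OF c, of s t] ab e Suc.prems by (simp add: T_def)
    next
      case False
      define y where "y = t - e / 2"
      \<comment> \<open>Small enough that \<open>y - d\<close> and \<open>y + d\<close> stay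
        strictly between \<open>s\<close> and \<open>t\<close> and that the interval they bound has
        length at most \<open>e\<close>.\<close>
      define d where "d = min (e / 2) (y - s) / 2"
      have y: "s < y" "y < t" using False e by (auto simp: y_def)
      have "0 < d" using y e by (simp add: d_def)
      moreover have "d \<le> (y - s) / 2" by (simp add: d_def)
      moreover have "d \<le> e / 4" unfolding d_def by (simp add: min_def)
      ultimately have d: "0 < d" "s < y - d" "y + d < t" "2 * d \<le> e" using y e by (auto simp: y_def)
      have mem: "c u \<in> W" if "a \<le> u" "u \<le> b" for u using that cW by auto
      have IH: "T (c s') (c t') = f t' - f s'" if "s \<le> s'" "s' \<le> t'" "t' \<le> y" for s' t'
        using Suc.IH[of s' t'] Suc.prems y that by (simp add: y_def algebra_simps)
      have near: "T (c s') (c t') = f t' - f s'"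
        if "s \<le> s'" "s' \<le> t'" "t' \<le> t" "t' - s' \<le> e" for s' t'
        using loc[of s' t'] geod_le[OF c, of s' t'] Suc.prems ab that by (simp add: T_def)
      have less: "f s' < f t'" if "s \<le> s'" "s' < t'" "t' \<le> t" for s' t'
        using geod_less[OF c, of s' t'] that Suc.prems ab by simp
      define l where "l = (f (y - d) - f s) / (f y - f s)"
      define m where "m = (f (y + d) - f y) / (f t - f y)"
      note f = less[of s "y - d"] less[of "y - d" y] less[of s y] less[of y "y + d"]
        less[of "y + d" t] less[of y t]
      have l: "0 < l" "l < 1" using f y d by (auto simp: l_def field_simps)
      have m: "0 < m" "m < 1" using f y d by (auto simp: m_def field_simps)
      have lf: "l * (f y - f s) = f (y - d) - f s" using f y by (simp add: l_def)
      have mf: "m * (f t - f y) = f (y + d) - f y" using f y by (simp add: m_def)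
      have "T (c s) (c t) = T (c s) (c y) + T (c y) (c t)"
      proof (rule comparison_straight[OF W])
        show "c s \<lless> c y" "c y \<lless> c t"
          using geod_lower(1)[OF c, of s y] geod_lower(1)[OF c, of y t] y Suc.prems ab by auto
        show "ratio (c s) (c y) l (c (y - d))"
          using IH[of s "y - d"] IH[of "y - d" y] IH[of s y] y d lf
          by (simp add: ratio_def left_diff_distrib)
        show "ratio (c y) (c t) m (c (y + d))"
          using near[of y "y + d"] near[of "y + d" t] near[of y t] y d mf
          by (simp add: ratio_def left_diff_distrib y_def)
        show "T (c (y - d)) (c (y + d)) \<le> (1 - l) * T (c s) (c y) + m * T (c y) (c t)"
          using near[of "y - d" "y + d"] near[of y t] IH[of s y] y d lf mf
          by (simp add: left_diff_distrib y_def)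
      qed (use mem y d Suc.prems l m in auto)
      then show ?thesis using IH[of s y] near[of y t] y by (simp add: y_def)
    qed
  qed
  have "T (c s) (c t) = f t - f s" if st: "a \<le> s" "s \<le> t" "t \<le> b" for s t
  proof -
    obtain n :: nat where "(t - s) / (e / 2) \<le> real n" using real_arch_simple by blast
    then have "t - s \<le> real n * (e / 2)" using e by (simp add: field_simps)
    also have "\<dots> \<le> real (Suc n) * (e / 2)" using e by (intro mult_right_mono) auto
    finally show ?thesis using * st by blast
  qed
  moreover have "\<tau> (c s) (c t) = ennreal (T (c s) (c t))" if "a \<le> s" "s \<le> t" "t \<le> b" for s t
    using cW that by (intro cmp_set_tau[OF W]) auto
  ultimately show ?thesis using geod_le[OF c] ab unfolding potential_def by auto
qed

section \<open>Arclength of timelike geodesics and reparametrization\<close>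

lemma small_tau:
  assumes "0 < e" obtains W where "cmp_set W" "p \<in> W" "\<And>x y. x \<in> W \<Longrightarrow> y \<in> W \<Longrightarrow> T x y < e"
proof -
  obtain V where V: "cmp_set V" "p \<in> V" using cmp_set_exists[OF open_UNIV UNIV_I] by blast
  have op: "open (V \<times> V)" using cmp_set_open[OF V(1)] by (simp add: open_Times)
  have "open ((\<lambda>(x, y). T x y) -` {..<e} \<inter> V \<times> V)"
    by (rule continuous_on_open_vimage[OF op, THEN iffD1, OF cmp_set_cont[OF V(1)], rule_format,
        OF open_lessThan])
  moreover have "(p, p) \<in> (\<lambda>(x, y). T x y) -` {..<e} \<inter> V \<times> V" using V assms by auto
  ultimately obtain A B where AB: "open A" "open B" "p \<in> A" "p \<in> B"
    "A \<times> B \<subseteq> (\<lambda>(x, y). T x y) -` {..<e} \<inter> V \<times> V" by (metis mem_Sigma_iff open_prod_elim)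
  obtain W where W: "cmp_set W" "p \<in> W" "W \<subseteq> A \<inter> B" using cmp_set_exists[of "A \<inter> B" p] AB by auto
  have "T x y < e" if "x \<in> W" "y \<in> W" for x y
  proof -
    have "(x, y) \<in> A \<times> B" using that W by auto
    then show ?thesis using AB(5) by auto
  qed
  then show ?thesis using W that by blast
qed

text \<open>Two covers enter: comparison sets make \<tau> finite at scale \<open>h1\<close>, and the
  Lebesgue number \<open>h2\<close> of the maximizing intervals makes separations additive at a
  uniform scale \<open>e\<close>, which \<open>local_potential\<close> integrates to an arclength.
  It is continuous because nearby points lie in a set on which \<open>T\<close> is small.\<close>

lemma timelike_geodesic_geod:
  assumes g: "c \<in> timelike_geodesics X"
  shows "\<exists>e f. geod c e f"
proof -
  have tl: "timelike_curve X c 0 1" and geo: "geodesic X c 0 1"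
    using g by (auto simp: timelike_geodesics_def)
  have cont: "continuous_on {0..1} c" by (rule timelike_curve_cont[OF tl])
  have chr: "c s \<lless> c t" if "0 \<le> s" "s < t" "t \<le> 1" for s t
    using tl that by (simp add: timelike_curve_iff)
  obtain r1 h1 where h1: "0 < h1" and
    W: "\<And>s. s \<in> {0..1} \<Longrightarrow> \<exists>W\<in>{W. cmp_set W}. \<forall>t\<in>{0..1}. \<bar>t - s\<bar> \<le> h1 \<longrightarrow> ball (c t) r1 \<subseteq> W" and r1: "0 < r1"
  proof (rule lebesgue_curve[OF cont, of "{W. cmp_set W}"])
    show "\<exists>W\<in>{W. cmp_set W}. c t \<in> W" for t using cmp_set_exists[of UNIV "c t"] by auto
  qed (use cmp_set_open in auto)
  have fin: "\<tau> (c s) (c t) < \<infinity>" if A: "0 \<le> s" "s \<le> t" "t \<le> 1" "t - s \<le> h1" for s t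
  proof -
    obtain V where V: "cmp_set V" "\<forall>t\<in>{0..1}. \<bar>t - s\<bar> \<le> h1 \<longrightarrow> ball (c t) r1 \<subseteq> V"
      using W[of s] A by auto
    then have "ball (c s) r1 \<subseteq> V" "ball (c t) r1 \<subseteq> V" using A by auto
    then have "c s \<in> V" "c t \<in> V" using r1 by (meson centre_in_ball subsetD)+
    then show ?thesis using cmp_set_tau[OF V(1), of "c s" "c t"] by simp
  qed
  define G where "G = {ball t d | t d. \<exists>a b. ball t d \<inter> {0..1} \<subseteq> {a..b} \<and> {a..b} \<subseteq> {0..1} \<and>
    maximizer X c a b}"
  have "{0..1} \<subseteq> \<Union>G"
  proof
    fix t :: real assume "t \<in> {0..1}"
    then obtain a b d where "{a..b} \<subseteq> {0..1}" "0 < d" "ball t d \<inter> {0..1} \<subseteq> {a..b}" "maximizer X c a b"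
      using geo unfolding geodesic_def by blast
    then have "ball t d \<in> G" "t \<in> ball t d" unfolding G_def by auto
    then show "t \<in> \<Union>G" by blast
  qed
  moreover have "open B" if "B \<in> G" for B using that unfolding G_def by auto
  ultimately obtain h2 where h2: "0 < h2" "\<And>x. x \<in> {0..1} \<Longrightarrow> \<exists>B\<in>G. ball x h2 \<subseteq> B"
    using Heine_Borel_lemma[OF compact_Icc, of 0 1 G] by metis
  define e where "e = min (h1 / 2) (h2 / 2)"
  have e: "0 < e" "e \<le> h1" "e < h2" using h1 h2 by (auto simp: e_def)
  have pot: "\<exists>p. potential X c s (min 1 (s + e)) p" if s: "0 \<le> s" "s \<le> 1" for s
  proof -
    obtain t d a b where ab: "ball s h2 \<subseteq> ball t d" "ball t d \<inter> {0..1} \<subseteq> {a..b}" "{a..b} \<subseteq> {0..1}"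
      "maximizer X c a b"
      using h2(2)[of s] s unfolding G_def by auto
    have lt: "a < b" using ab(4) by (auto simp: maximizer_def causal_curve_def
      lipschitz_nowhere_constant_def)
    have ab01: "0 \<le> a" "b \<le> 1" using ab(3) lt by auto
    have "s \<in> ball s h2 \<inter> {0..1}" "min 1 (s + e) \<in> ball s h2 \<inter> {0..1}"
      using s e h2 by (auto simp: dist_real_def)
    then have "s \<in> {a..b}" "min 1 (s + e) \<in> {a..b}" using ab(1,2) by blast+
    then have sub: "a \<le> s" "min 1 (s + e) \<le> b" by simp_all
    \<comment> \<open>A maximizing interval may be longer than \<open>h1\<close>; a partition into
      steps of at most \<open>h1\<close> bounds its length by a finite sum of finite terms.\<close>
    obtain m :: nat where m: "(b - a) / h1 \<le> real m" using real_arch_simple by blast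
    define n where "n = Suc m"
    have "(b - a) / h1 \<le> real n" using m by (simp add: n_def)
    then have n: "0 < n" "(b - a) / real n \<le> h1" using h1 by (auto simp: n_def field_simps)
    let ?t = "\<lambda>i. a + (b - a) * (real i / real n)"
    have p: "(n, ?t) \<in> partitions a b" using uniform_partition[OF n(1) lt] .
    have "\<tau> (c a) (c b) = tau_length X c a b" using ab by (simp add: maximizer_def)
    also have "\<dots> \<le> (\<Sum>i<n. \<tau> (c (?t i)) (c (?t (Suc i))))" by (rule tau_length_le_partition[OF p])
    also have "\<dots> < \<infinity>"
    proof -
      have "\<tau> (c (?t i)) (c (?t (Suc i))) < \<infinity>" if "i < n" for i
        using partition_mono[OF p that] ab01 uniform_partition_step[OF n(1), of a b i] n
        by (intro fin) linarith+
      then show ?thesis by (simp add: less_top)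
    qed
    finally obtain p where "potential X c a b p" using maximizer_potential[OF ab(4)] by blast
    then show ?thesis using potential_subset sub by blast
  qed
  have add: "T (c s) (c t) + T (c t) (c u) = T (c s) (c u)"
    if A: "0 \<le> s" "s \<le> t" "t \<le> u" "u \<le> 1" "u - s \<le> e" for s t u
  proof -
    obtain p where p: "potential X c s (min 1 (s + e)) p" using pot[of s] A by auto
    show ?thesis using potentialD[OF p, of s t] potentialD[OF p, of t u] potentialD[OF p, of s u] A
      by (simp add: T_def)
  qed
  obtain f where f: "f 0 = 0"
    "\<And>s t. \<lbrakk>0 \<le> s; s \<le> t; t \<le> 1; t - s \<le> e\<rbrakk> \<Longrightarrow> T (c s) (c t) = f t - f s"
    using local_potential[of e "\<lambda>s t. T (c s) (c t)"] e(1) add by metis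
  have tau: "\<tau> (c s) (c t) = ennreal (f t - f s)" if "0 \<le> s" "s \<le> t" "t \<le> 1" "t - s \<le> e" for s t
  proof -
    have "\<tau> (c s) (c t) = ennreal (T (c s) (c t))"
      using fin[of s t] that e by (simp add: T_def)
    then show ?thesis using f(2)[OF that] by simp
  qed
  have loc_less: "f s < f t" if "0 \<le> s" "s < t" "t \<le> 1" "t - s \<le> e" for s t
    using tau[of s t] chr[of s t] that by (simp add: chron_iff)
  have less: "f s < f t" if "0 \<le> s" "s < t" "t \<le> 1" "t - s \<le> real n * e" for n s t
    using that
  proof (induction n arbitrary: t)
    case (Suc n)
    show ?case
    proof (cases "t - s \<le> e")
      case False
      then show ?thesis using Suc.IH[of "t - e"] loc_less[of "t - e" t] Suc.prems e
        by (simp add: algebra_simps)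
    qed (use loc_less Suc in auto)
  qed simp
  have "strict_mono_on {0..1} f"
  proof (rule strict_mono_onI)
    fix s t :: real assume st: "s \<in> {0..1}" "t \<in> {0..1}" "s < t"
    obtain n :: nat where "(t - s) / e \<le> real n" using real_arch_simple by blast
    then show "f s < f t" using less[of s t n] st e by (simp add: field_simps)
  qed
  moreover have "continuous_on {0..1} f"
    unfolding continuous_on_iff
  proof (intro ballI allI impI)
    fix s \<epsilon> :: real assume s: "s \<in> {0..1}" and eps: "0 < \<epsilon>"
    obtain V where V: "cmp_set V" "c s \<in> V" "\<And>x y. x \<in> V \<Longrightarrow> y \<in> V \<Longrightarrow> T x y < \<epsilon>"
      using small_tau[OF eps] by metis
    obtain \<rho> where rho: "0 < \<rho>" "ball (c s) \<rho> \<subseteq> V" using cmp_set_open[OF V(1)] V(2) openE by metis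
    obtain d where d: "0 < d" "\<And>t. t \<in> {0..1} \<Longrightarrow> dist t s < d \<Longrightarrow> dist (c t) (c s) < \<rho>"
      using cont s rho(1) unfolding continuous_on_iff by blast
    have "dist (f t) (f s) < \<epsilon>" if t: "t \<in> {0..1}" "dist t s < min d e" for t
    proof -
      have "c t \<in> V" using d(2)[of t] t rho by (auto simp: dist_commute)
      then have "T (c s) (c t) < \<epsilon>" "T (c t) (c s) < \<epsilon>" using V by auto
      moreover have "T (c s) (c t) = f t - f s" if "s \<le> t"
        using f(2)[of s t] s t that by (simp add: dist_real_def)
      moreover have "T (c t) (c s) = f s - f t" if "t \<le> s"
        using f(2)[of t s] s t that by (simp add: dist_real_def)
      ultimately show ?thesis using T_nonneg[of "c s" "c t"] T_nonneg[of "c t" "c s"]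
        by (cases "s \<le> t") (simp_all add: dist_real_def del: T_nonneg)
    qed
    then show "\<exists>d>0. \<forall>t\<in>{0..1}. dist t s < d \<longrightarrow> dist (f t) (f s) < \<epsilon>"
      using d(1) e(1) by (intro exI[of _ "min d e"]) auto
  qed
  ultimately have "geod c e f" using cont e(1) f(1) tau unfolding geod_def by blast
  then show ?thesis by blast
qed

text \<open>Uniform continuity of \<phi> yields a parameter scale at which \<phi> moves by less than
  the old scale \<open>e\<close>.\<close>

lemma geod_reparam:
  assumes c: "geod c e f" and \<phi>: "reparam \<phi>"
  shows "\<exists>e'. geod (c \<circ> \<phi>) e' (f \<circ> \<phi>)"
proof -
  have im: "\<phi> ` {0..1} = {0..1}" and sm: "strict_mono_on {0..1} \<phi>" using \<phi> by (auto simp: reparam_def)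
  have cont: "continuous_on {0..1} \<phi>" by (rule reparam_continuous[OF \<phi>])
  have "uniformly_continuous_on {0..1} \<phi>" using cont by (rule compact_uniformly_continuous) simp
  moreover have e: "0 < e" using c by (simp add: geod_def)
  ultimately obtain d where d: "0 < d"
    "\<And>s t. \<lbrakk>s \<in> {0..1}; t \<in> {0..1}; dist t s < d\<rbrakk> \<Longrightarrow> dist (\<phi> t) (\<phi> s) < e"
    unfolding uniformly_continuous_on_def by metis
  have "geod (c \<circ> \<phi>) (d / 2) (f \<circ> \<phi>)"
    unfolding geod_def
  proof (intro conjI allI impI)
    show "continuous_on {0..1} (c \<circ> \<phi>)"
      by (rule continuous_on_compose[OF cont]) (use c in \<open>simp add: im geod_def\<close>)
    show "continuous_on {0..1} (f \<circ> \<phi>)"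
      by (rule continuous_on_compose[OF cont]) (use c in \<open>simp add: im geod_def\<close>)
    show "0 < d / 2" using d by simp
    show "strict_mono_on {0..1} (f \<circ> \<phi>)"
    proof (rule strict_mono_onI)
      fix s t :: real assume "s \<in> {0..1}" "t \<in> {0..1}" "s < t"
      then show "(f \<circ> \<phi>) s < (f \<circ> \<phi>) t"
        using geod_less[OF c, of "\<phi> s" "\<phi> t"] strict_mono_onD[OF sm, of s t]
          reparam_mem[OF \<phi>, of s] reparam_mem[OF \<phi>, of t] by auto
    qed
    show "(f \<circ> \<phi>) 0 = 0" using c reparam_endpoints[OF \<phi>] by (simp add: geod_def)
    fix s t :: real assume st: "0 \<le> s" "s \<le> t" "t \<le> 1" "t - s \<le> d / 2"
    then have "dist (\<phi> t) (\<phi> s) < e" using d by (auto simp: dist_real_def)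
    moreover have "\<phi> s \<le> \<phi> t" using st strict_mono_on_leD[OF sm, of s t] by auto
    ultimately show "\<tau> ((c \<circ> \<phi>) s) ((c \<circ> \<phi>) t) = ennreal ((f \<circ> \<phi>) t - (f \<circ> \<phi>) s)"
      using c reparam_mem[OF \<phi>, of s] reparam_mem[OF \<phi>, of t] st
      unfolding geod_def by (auto simp: dist_real_def)
  qed
  then show ?thesis by blast
qed

text \<open>The arclength divided by its total is itself a reparametrization; its inverse makes the
  parameter proportional to arclength.\<close>

lemma geod_normalize:
  assumes c: "geod c e f"
  obtains \<phi> where "reparam \<phi>" "\<And>t. t \<in> {0..1} \<Longrightarrow> f (\<phi> t) = f 1 * t"
    "\<And>t. t \<in> {0..1} \<Longrightarrow> \<phi> (f t / f 1) = t"
proof -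
  have f1: "0 < f 1" by (rule geod_total[OF c])
  have f0: "f 0 = 0" and cf: "continuous_on {0..1} f" using c by (auto simp: geod_def)
  let ?h = "\<lambda>t. f t / f 1"
  have "?h ` {0..1} = {0..1}"
  proof
    show "?h ` {0..1} \<subseteq> {0..1}"
      using geod_le[OF c, of 0] geod_le[OF c, of _ 1] f0 f1 by auto
    show "{0..1} \<subseteq> ?h ` {0..1}"
    proof
      fix y :: real assume "y \<in> {0..1}"
      moreover have "continuous_on {0..1} ?h" using cf by (intro continuous_intros) (use f1 in auto)
      ultimately obtain t where "0 \<le> t" "t \<le> 1" "?h t = y"
        using IVT'[of ?h 0 y 1] f0 f1 by auto
      then show "y \<in> ?h ` {0..1}" by force
    qed
  qed
  moreover have "strict_mono_on {0..1} ?h"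
    using geod_less[OF c] f1 by (auto intro!: strict_mono_onI divide_strict_right_mono)
  ultimately have h: "reparam ?h" by (simp add: reparam_def)
  obtain \<phi> where \<phi>: "reparam \<phi>" "\<And>t. t \<in> {0..1} \<Longrightarrow> ?h (\<phi> t) = t" "\<And>t. t \<in> {0..1} \<Longrightarrow> \<phi> (?h t) = t"
    using reparam_inverse[OF h] by metis
  have "f (\<phi> t) = f 1 * t" if "t \<in> {0..1}" for t using \<phi>(2)[OF that] f1 by (simp add: field_simps)
  then show ?thesis by (rule that[OF \<phi>(1) _ \<phi>(3)])
qed

end

section \<open>Uniqueness of geodesics near a given one\<close>

text \<open>Uniform continuity near \<open>K\<close> rather than on \<open>K\<close>: the point
  \<open>x\<close> may leave \<open>K\<close>, as a curve close to \<gamma> does. The radius is a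
  Lebesgue number for the open sets on which \<open>F\<close> oscillates by less than
  \<open>e\<close>.\<close>

lemma compact_uniform_nbhd:
  fixes F :: "'b::metric_space \<Rightarrow> real"
  assumes K: "compact K" and V: "open V" "K \<subseteq> V" and F: "continuous_on V F" and e: "0 < e"
  obtains d where "0 < d" "\<And>k x. k \<in> K \<Longrightarrow> dist x k < d \<Longrightarrow> x \<in> V \<and> \<bar>F x - F k\<bar> < e"
proof -
  define G where "G = {B. open B \<and> B \<subseteq> V \<and> (\<forall>x\<in>B. \<forall>y\<in>B. \<bar>F x - F y\<bar> < e)}"
  have "K \<subseteq> \<Union>G"
  proof
    fix k assume "k \<in> K"
    then have k: "k \<in> V" using V by auto
    let ?B = "F -` {F k - e / 2 <..< F k + e / 2} \<inter> V"
    have "open ?B"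
      by (rule continuous_on_open_vimage[OF V(1), THEN iffD1, OF F, rule_format]) simp
    moreover have "\<bar>F x - F y\<bar> < e" if "x \<in> ?B" "y \<in> ?B" for x y
    proof -
      have "F k - e / 2 < F x" "F x < F k + e / 2" "F k - e / 2 < F y" "F y < F k + e / 2"
        using that by auto
      then show ?thesis by linarith
    qed
    ultimately have "?B \<in> G" unfolding G_def by blast
    moreover have "k \<in> ?B" using k e by auto
    ultimately show "k \<in> \<Union>G" by blast
  qed
  moreover have "open B" if "B \<in> G" for B using that by (simp add: G_def)
  ultimately obtain d where d: "0 < d" "\<And>k. k \<in> K \<Longrightarrow> \<exists>B\<in>G. ball k d \<subseteq> B"
    using Heine_Borel_lemma[OF K] by metis
  show ?thesis
  proof (rule that[OF d(1)])
    fix k x assume "k \<in> K" "dist x k < d"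
    then obtain B where "B \<in> G" "ball k d \<subseteq> B" "x \<in> ball k d" "k \<in> ball k d"
      using d by (auto simp: dist_commute)
    then have "B \<in> G" "x \<in> B" "k \<in> B" by auto
    then show "x \<in> V \<and> \<bar>F x - F k\<bar> < e" unfolding G_def by auto
  qed
qed

section \<open>The concave weight\<close>

definition bump :: "nat \<Rightarrow> nat \<Rightarrow> real" where
  "bump N i = real i * (real N - real i) / real N ^ 3"

lemma bump_ends [simp]: "bump N 0 = 0" "bump N N = 0" by (simp_all add: bump_def)

lemma bump_nonneg: "i \<le> N \<Longrightarrow> 0 \<le> bump N i" by (simp add: bump_def)

lemma bump_pos: "0 < i \<Longrightarrow> i < N \<Longrightarrow> 0 < bump N i" by (simp add: bump_def)

text \<open>The weight is a quadratic polynomial in the index, so its midpoint defect is the same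
  for every \<open>j\<close>, also next to the ends.\<close>

lemma bump_concave:
  "(bump N j + bump N (Suc (Suc j))) / 2 = bump N (Suc j) - 1 / real N ^ 3"
proof -
  have "real j * (real N - real j) + real (Suc (Suc j)) * (real N - real (Suc (Suc j))) =
      2 * (real (Suc j) * (real N - real (Suc j)) - 1)" by (simp add: algebra_simps)
  then
    have "bump N j + bump N (Suc (Suc j)) = 2 * (real (Suc j) * (real N - real (Suc j)) - 1) / real N ^ 3"
    unfolding bump_def by (metis add_divide_distrib)
  then show ?thesis by (simp add: bump_def diff_divide_distrib)
qed

lemma bump_le:
  assumes "0 < N" shows "4 * bump N i \<le> 1 / real N"
proof -
  have "4 * (real i * (real N - real i)) \<le> real N ^ 2"
    using zero_le_power2[of "real N - 2 * real i"] by (simp add: power2_eq_square algebra_simps)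
  then have "4 * bump N i \<le> real N ^ 2 / real N ^ 3"
    unfolding bump_def by (simp add: divide_right_mono)
  then show ?thesis using assms by (simp add: power2_eq_square power3_eq_cube)
qed

text \<open>By \<open>bump_le\<close> the defect \<open>1 / N ^ 3\<close> is at least the fraction
  \<open>4 / N ^ 2\<close> of every weight.\<close>

lemma bump_contract:
  assumes "0 < N" shows "bump N i - 1 / real N ^ 3 \<le> (1 - 4 / real N ^ 2) * bump N i"
proof -
  have "4 / real N ^ 2 * bump N i = (4 * bump N i) / real N ^ 2" by simp
  also have "\<dots> \<le> (1 / real N) / real N ^ 2" by (intro divide_right_mono bump_le assms) simp
  also have "\<dots> = 1 / real N ^ 3" by (simp add: power2_eq_square power3_eq_cube)
  finally show ?thesis by (simp add: left_diff_distrib)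
qed

context curved_space begin

section \<open>Causal relations in the limit and degenerate triangles\<close>

lemma path_limit:
  fixes c :: "real \<Rightarrow> 'a"
  assumes c: "continuous_on {0..1} c" and s: "s \<longlonglongrightarrow> t" "\<And>n. s n \<in> {0..1}" "t \<in> {0..1}"
    and le: "\<And>n. a \<preceq> c (s n)" "\<And>n. c (s n) \<preceq> y"
  shows "c t \<preceq> y"
proof -
  have lim: "(\<lambda>n. c (s n)) \<longlonglongrightarrow> c t"
    using continuous_on_tendsto_compose[OF c s(1,3)] s(2) by simp
  \<comment> \<open>The common lower bound \<open>a\<close> places all points in one causal diamond,
    which is compact and therefore closed.\<close>
  have ev: "\<forall>\<^sub>F n in sequentially. c (s n) \<in> causal_diamond X a y"
    by (simp add: causal_diamond_def le)
  have "c t \<in> causal_diamond X a y"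
    by (rule Lim_in_closed_set[OF closed_causal_diamond ev sequentially_bot lim])
  then show ?thesis by (simp add: causal_diamond_def)
qed

lemma path_limit_left:
  fixes c :: "real \<Rightarrow> 'a"
  assumes c: "continuous_on {0..1} c" and t: "0 \<le> a" "a < t" "t \<le> 1"
    and le: "\<And>s. a < s \<Longrightarrow> s < t \<Longrightarrow> x \<preceq> c s \<and> c s \<preceq> y"
  shows "c t \<preceq> y"
proof (rule path_limit[OF c, of "\<lambda>n. t - (t - a) / 2 * (1 / real (Suc n))"])
  have "(\<lambda>n. t - (t - a) / 2 * (1 / real (Suc n))) \<longlonglongrightarrow> t - (t - a) / 2 * 0"
    by (intro tendsto_intros LIMSEQ_Suc lim_1_over_n)
  then show "(\<lambda>n. t - (t - a) / 2 * (1 / real (Suc n))) \<longlonglongrightarrow> t" by simp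
  have in_int: "a < t - (t - a) / 2 * (1 / real (Suc n)) \<and> t - (t - a) / 2 * (1 / real (Suc n)) < t" for n
  proof -
    have "(t - a) / 2 * (1 / real (Suc n)) \<le> (t - a) / 2 * 1"
      using t by (intro mult_left_mono) auto
    moreover have "0 < (t - a) / 2 * (1 / real (Suc n))" using t by (intro mult_pos_pos) auto
    moreover have "a < t - d \<and> t - d < t" if "0 < d" "d \<le> (t - a) / 2 * 1" for d
      using t that by auto
    ultimately show ?thesis by blast
  qed
  fix n
  show "t - (t - a) / 2 * (1 / real (Suc n)) \<in> {0..1}" unfolding atLeastAtMost_iff
    using in_int[of n] t by (meson le_less_trans less_imp_le less_le_trans)
  show "x \<preceq> c (t - (t - a) / 2 * (1 / real (Suc n)))" "c (t - (t - a) / 2 * (1 / real (Suc n))) \<preceq> y"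
    using le in_int[of n] by blast+
qed (use t in auto)

text \<open>With equality the apex has \<open>u = T x y\<close> and \<open>v = 0\<close>, so the
  comparison triangle collapses to the time axis, where positions alone decide the order. The two
  points may still lie on different curves.\<close>

lemma comparison_degenerate:
  assumes W: "cmp_set W" and xyz: "x \<in> W" "y \<in> W" "z \<in> W" "x \<lless> y" "y \<lless> z"
    and "p \<in> W" "r \<in> W" "ratio x y l p" "ratio x z n r" "0 < l" "l < 1" "0 < n" "n < 1"
    and deg: "T x z = T x y + T y z" and less: "n * T x z < l * T x y"
  shows "r \<lless> p"
proof -
  obtain u v where uv: "0 \<le> v" "u\<^sup>2 - v\<^sup>2 = (T x y)\<^sup>2" "u \<le> T x z - T y z" "T x y \<le> u" and
    sep: "minkowski_sep (n * T x z, 0) (l * u, l * v) \<le> T r p"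
    by (rule comparison[OF assms(1-6)]) (use assms(7-) in blast)
  have "u = T x y" using uv deg by simp
  then have "v = 0" using uv by simp
  have "0 < minkowski_sep (n * T x z, 0) (l * u, l * v)"
    using \<open>u = T x y\<close> \<open>v = 0\<close> less by (intro minkowski_sep_pos) simp
  then show ?thesis using sep assms by (simp add: cmp_set_ch[OF W])
qed

lemma linear_ratio:
  assumes c: "potential X c a b (\<lambda>t. L * t)" and st: "a \<le> s" "s \<le> t" "t \<le> b"
    and l: "0 \<le> l" "l \<le> 1" and u: "u = s + l * (t - s)" and L: "0 < L"
  shows "ratio (c s) (c t) l (c u)"
proof -
  have "0 \<le> l * (t - s)" "l * (t - s) \<le> t - s" using st l by (auto intro: mult_left_le_one_le)
  then have "s \<le> u" "u \<le> t" using u by auto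
  then have e: "T (c s) (c u) = L * u - L * s" "T (c u) (c t) = L * t - L * u"
    "T (c s) (c t) = L * t - L * s"
    using potentialD[OF c, of s u] potentialD[OF c, of u t] potentialD[OF c, of s t] st
    by (auto simp: T_def)
  show ?thesis unfolding ratio_def e unfolding u by (simp add: algebra_simps)
qed

lemma linear_mid:
  assumes c: "potential X c a b (\<lambda>t. L * t)" and st: "a \<le> s" "s \<le> t" "t \<le> b"
    and u: "u = (s + t) / 2" and L: "0 < L"
  shows "ratio (c s) (c t) (1 / 2) (c u)"
  by (rule linear_ratio[OF c st _ _ _ L]) (simp_all add: u field_simps)

section \<open>Stability of arclength under small perturbations\<close>

lemma cmp_set_cover:
  assumes "continuous_on {0..1} (c :: real \<Rightarrow> 'a)" "0 < \<epsilon>"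
  obtains r h where "0 < r" "0 < h"
    "\<And>s. s \<in> {0..1} \<Longrightarrow> \<exists>W. cmp_set W \<and> W \<subseteq> ball (c s) \<epsilon> \<and> (\<forall>t\<in>{0..1}. \<bar>t - s\<bar> \<le> h \<longrightarrow> ball (c t) r \<subseteq> W)"
proof -
  \<comment> \<open>The radius is halved because \<open>c s\<close> need not be the centre of the
    ball that contains a member of the cover.\<close>
  define G where "G = {W. cmp_set W \<and> (\<exists>x. W \<subseteq> ball x (\<epsilon> / 2))}"
  have "\<exists>W\<in>G. c t \<in> W" for t
  proof -
    have "open (ball (c t) (\<epsilon> / 2))" "c t \<in> ball (c t) (\<epsilon> / 2)" using assms(2) by auto
    then obtain W where "cmp_set W" "c t \<in> W" "W \<subseteq> ball (c t) (\<epsilon> / 2)" by (rule cmp_set_exists)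
    then show ?thesis unfolding G_def by blast
  qed
  moreover have "open W" if "W \<in> G" for W using that cmp_set_open by (auto simp: G_def)
  ultimately obtain r h where rh: "0 < r" "0 < h"
    "\<And>s. s \<in> {0..1} \<Longrightarrow> \<exists>W\<in>G. \<forall>t\<in>{0..1}. \<bar>t - s\<bar> \<le> h \<longrightarrow> ball (c t) r \<subseteq> W"
    using lebesgue_curve[OF assms(1), of G] by metis
  show ?thesis
  proof (rule that[OF rh(1,2)])
    fix s :: real assume s: "s \<in> {0..1}"
    then obtain W where W: "W \<in> G" "\<forall>t\<in>{0..1}. \<bar>t - s\<bar> \<le> h \<longrightarrow> ball (c t) r \<subseteq> W"
      using rh(3) by blast
    then obtain x where x: "cmp_set W" "W \<subseteq> ball x (\<epsilon> / 2)" unfolding G_def by auto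
    have "c s \<in> W" using W(2) s rh by (auto simp: subset_iff)
    have "W \<subseteq> ball (c s) \<epsilon>"
    proof
      fix y assume "y \<in> W"
      then have "dist x y < \<epsilon> / 2" "dist x (c s) < \<epsilon> / 2" using x \<open>c s \<in> W\<close> by auto
      then show "y \<in> ball (c s) \<epsilon>" using dist_triangle_half_r[of x y \<epsilon> "c s"]
        by (simp add: dist_commute)
    qed
    then show "\<exists>W. cmp_set W \<and> W \<subseteq> ball (c s) \<epsilon> \<and> (\<forall>t\<in>{0..1}. \<bar>t - s\<bar> \<le> h \<longrightarrow> ball (c t) r \<subseteq> W)"
      using W x by blast
  qed
qed

text \<open>Inside a comparison set both curves are maximizers, so increments of arclength are
  values of \<open>T\<close>, which is uniformly continuous near the compact piece of \<gamma>. The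
  errors \<open>\<epsilon> / N\<close> of the \<open>N\<close> pieces add up to \<epsilon>.\<close>

lemma arclength_close:
  assumes g: "geod \<gamma> e0 (\<lambda>t. L * t)" and eps: "0 < \<epsilon>"
  obtains d where "0 < d"
    "\<And>c e f t. \<lbrakk>geod c e f; (\<And>t. t \<in> {0..1} \<Longrightarrow> dist (c t) (\<gamma> t) < d); t \<in> {0..1}\<rbrakk> \<Longrightarrow> \<bar>f t - L * t\<bar> \<le> \<epsilon>"
proof -
  have cont: "continuous_on {0..1} \<gamma>" using g by (simp add: geod_def)
  obtain r h where rh: "0 < r" "0 < h"
    "\<And>s. s \<in> {0..1} \<Longrightarrow> \<exists>W. cmp_set W \<and> W \<subseteq> ball (\<gamma> s) 1 \<and> (\<forall>t\<in>{0..1}. \<bar>t - s\<bar> \<le> h \<longrightarrow> ball (\<gamma> t) r \<subseteq> W)"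
    using cmp_set_cover[OF cont, of 1] by auto
  obtain m :: nat where m: "1 / h \<le> real m" using real_arch_simple by blast
  define N where "N = Suc m"
  have N: "0 < N" "1 / real N \<le> h" using m rh by (auto simp: N_def field_simps)
  define t where "t i = real i / real N" for i
  have t: "t 0 = 0" "t N = 1" "\<And>i. t (Suc i) = t i + 1 / real N" "\<And>i. 0 \<le> t i" "\<And>i. i \<le> N \<Longrightarrow> t i \<le> 1"
    using N by (auto simp: t_def add_divide_distrib)
  have "\<exists>W. cmp_set W \<and> (\<forall>u\<in>{0..1}. \<bar>u - t i\<bar> \<le> h \<longrightarrow> ball (\<gamma> u) r \<subseteq> W)" if "i < N" for i
    using rh(3)[of "t i"] t that by (auto simp: less_imp_le)
  then obtain W where W: "\<And>i. i < N \<Longrightarrow> cmp_set (W i)"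
    "\<And>i u. \<lbrakk>i < N; u \<in> {0..1}; \<bar>u - t i\<bar> \<le> h\<rbrakk> \<Longrightarrow> ball (\<gamma> u) r \<subseteq> W i" by metis
  have piece: "ball (\<gamma> u) r \<subseteq> W i \<and> \<gamma> u \<in> W i" if "i < N" "t i \<le> u" "u \<le> t (Suc i)" for i u
  proof -
    have "u \<in> {0..1}" "\<bar>u - t i\<bar> \<le> h" using that t(3)[of i] t(4)[of i] t(5)[of "Suc i"] N by auto
    then show ?thesis using W(2)[OF that(1)] rh(1) centre_in_ball by blast
  qed
  have "\<exists>d>0. \<forall>u v x y. t i \<le> u \<longrightarrow> u \<le> t (Suc i) \<longrightarrow> t i \<le> v \<longrightarrow> v \<le> t (Suc i) \<longrightarrow>
      dist x (\<gamma> u) < d \<longrightarrow> dist y (\<gamma> v) < d \<longrightarrow> \<bar>T x y - T (\<gamma> u) (\<gamma> v)\<bar> < \<epsilon> / real N" if i: "i < N" for i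
  proof -
    let ?K = "\<gamma> ` {t i..t (Suc i)}"
    have "{t i..t (Suc i)} \<subseteq> {0..1}" using t(4)[of i] t(5)[of "Suc i"] i by auto
    then have "compact ?K"
      using continuous_on_subset[OF cont] by (intro compact_continuous_image) auto
    then have "compact (?K \<times> ?K)" by (intro compact_Times)
    moreover have "open (W i \<times> W i)" using cmp_set_open[OF W(1)[OF i]] by (simp add: open_Times)
    moreover have "?K \<times> ?K \<subseteq> W i \<times> W i" using piece[OF i] by auto
    moreover have "0 < \<epsilon> / real N" using eps N by simp
    ultimately obtain d where d: "0 < d" "\<And>k x. k \<in> ?K \<times> ?K \<Longrightarrow> dist x k < d \<Longrightarrow>
        x \<in> W i \<times> W i \<and> \<bar>(\<lambda>(x, y). T x y) x - (\<lambda>(x, y). T x y) k\<bar> < \<epsilon> / real N"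
      using compact_uniform_nbhd[OF _ _ _ cmp_set_cont[OF W(1)[OF i]]] by metis
    show ?thesis
    proof (intro exI[of _ "d / 2"] conjI allI impI)
      fix u v x y
      assume a: "t i \<le> u" "u \<le> t (Suc i)" "t i \<le> v" "v \<le> t (Suc i)" "dist x (\<gamma> u) < d / 2"
        "dist y (\<gamma> v) < d / 2"
      have "dist (x, y) (\<gamma> u, \<gamma> v) \<le> dist x (\<gamma> u) + dist y (\<gamma> v)"
        unfolding dist_Pair_Pair by (rule sqrt_sum_squares_le_sum) auto
      then have "dist (x, y) (\<gamma> u, \<gamma> v) < d" using a by linarith
      then show "\<bar>T x y - T (\<gamma> u) (\<gamma> v)\<bar> < \<epsilon> / real N" using d(2)[of "(\<gamma> u, \<gamma> v)" "(x, y)"] a by auto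
    qed (use d in auto)
  qed
  then obtain D where D: "\<And>i. i < N \<Longrightarrow> 0 < D i"
    "\<And>i u v x y.
      \<lbrakk>i < N; t i \<le> u; u \<le> t (Suc i); t i \<le> v; v \<le> t (Suc i); dist x (\<gamma> u) < D i; dist y (\<gamma> v) < D i\<rbrakk> \<Longrightarrow>
        \<bar>T x y - T (\<gamma> u) (\<gamma> v)\<bar> < \<epsilon> / real N" by metis
  define d where "d = min r (Min (D ` {..<N}))"
  have Dne: "finite (D ` {..<N})" "D ` {..<N} \<noteq> {}" using N by auto
  have "0 < d" unfolding d_def using D(1) Dne rh(1) by (auto simp: Min_gr_iff)
  have dD: "d \<le> D i" if "i < N" for i
  proof -
    have "Min (D ` {..<N}) \<le> D i" using Dne that by (intro Min_le) auto
    then show ?thesis by (simp add: d_def)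
  qed
  show ?thesis
  proof (rule that[OF \<open>0 < d\<close>])
    fix c e f x
    assume c: "geod c e f" and close: "\<And>t. t \<in> {0..1} \<Longrightarrow> dist (c t) (\<gamma> t) < d" and x: "x \<in> {0..1::real}"
    have *: "\<bar>f x - L * x\<bar> \<le> real k * (\<epsilon> / real N)" if "k \<le> N" "0 \<le> x" "x \<le> t k" for k x
      using that
    proof (induction k arbitrary: x)
      case 0
      then show ?case using c t by (simp add: geod_def)
    next
      case (Suc k)
      show ?case
      proof (cases "x \<le> t k")
        case True
        then have "\<bar>f x - L * x\<bar> \<le> real k * (\<epsilon> / real N)" using Suc by simp
        also have "\<dots> \<le> real (Suc k) * (\<epsilon> / real N)" using eps by (intro mult_right_mono) auto
        finally show ?thesis .
      next
        case False
        have k: "k < N" using Suc.prems by simp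
        have sub: "0 \<le> t k" "t (Suc k) \<le> 1" by (rule t(4), rule t(5)[OF Suc.prems(1)])
        have cW: "c ` {t k..t (Suc k)} \<subseteq> W k"
        proof
          fix y assume "y \<in> c ` {t k..t (Suc k)}"
          then obtain u where u: "t k \<le> u" "u \<le> t (Suc k)" "y = c u" by auto
          then have "dist (c u) (\<gamma> u) < r" using close[of u] sub by (auto simp: d_def)
          then show "y \<in> W k" using piece[OF k u(1,2)] u(3) by (auto simp: dist_commute)
        qed
        have \<gamma>W: "\<gamma> ` {t k..t (Suc k)} \<subseteq> W k" using piece[OF k] by auto
        note p = geod_cmp_set[OF W(1)[OF k] c sub cW]
        note q = geod_cmp_set[OF W(1)[OF k] g sub \<gamma>W]
        have x: "t k \<le> x" "x \<le> t (Suc k)" "t k \<le> t (Suc k)" using False Suc.prems t(3)[of k] N by auto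
        have e1: "T (c (t k)) (c x) = f x - f (t k)"
          using potentialD[OF p, of "t k" x] x by (simp add: T_def)
        have e2: "T (\<gamma> (t k)) (\<gamma> x) = L * x - L * t k"
          using potentialD[OF q, of "t k" x] x by (simp add: T_def)
        have "\<bar>T (c (t k)) (c x) - T (\<gamma> (t k)) (\<gamma> x)\<bar> < \<epsilon> / real N"
        proof (rule D(2)[OF k])
          show "dist (c (t k)) (\<gamma> (t k)) < D k" "dist (c x) (\<gamma> x) < D k"
            using close[of "t k"] close[of x] sub x dD[OF k] by auto
        qed (use x in auto)
        then have "\<bar>(f x - L * x) - (f (t k) - L * t k)\<bar> < \<epsilon> / real N" unfolding e1 e2
          by (simp add: algebra_simps)
        moreover have "\<bar>f (t k) - L * t k\<bar> \<le> real k * (\<epsilon> / real N)" using Suc.IH[of "t k"] k sub by simp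
        moreover have "real (Suc k) * (\<epsilon> / real N) = real k * (\<epsilon> / real N) + \<epsilon> / real N"
          by (simp add: distrib_right add_divide_distrib)
        ultimately show ?thesis by linarith
      qed
    qed
    show "\<bar>f x - L * x\<bar> \<le> \<epsilon>" using *[of N x] x t N by simp
  qed
qed

text \<open>\<open>L * \<phi> u\<close> is close to \<open>f (\<phi> u) = f 1 * u\<close>, which is
  close to \<open>L * u\<close>. So \<phi> moves parameters only slightly, and uniform continuity of
  \<gamma> does the rest.\<close>

lemma normalized_close:
  assumes g: "geod \<gamma> e0 (\<lambda>t. L * t)" and eps: "0 < \<epsilon>"
  obtains d where "0 < d"
    "\<And>c e f \<phi> t. \<lbrakk>geod c e f; (\<And>t. t \<in> {0..1} \<Longrightarrow> dist (c t) (\<gamma> t) < d); reparam \<phi>; (\<And>t. t \<in> {0..1} \<Longrightarrow>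
      f (\<phi> t) = f 1 * t); t \<in> {0..1}\<rbrakk> \<Longrightarrow> dist (c (\<phi> t)) (\<gamma> t) < \<epsilon>"
proof -
  have L: "0 < L" using geod_total[OF g] by simp
  have "uniformly_continuous_on {0..1} \<gamma>"
    using g by (intro compact_uniformly_continuous) (auto simp: geod_def)
  then obtain \<delta> where \<delta>: "0 < \<delta>"
    "\<And>s t. \<lbrakk>s \<in> {0..1}; t \<in> {0..1}; dist t s < \<delta>\<rbrakk> \<Longrightarrow> dist (\<gamma> t) (\<gamma> s) < \<epsilon> / 2"
    using eps by (metis half_gt_zero uniformly_continuous_on_def)
  \<comment> \<open>This error occurs twice, at \<open>\<phi> u\<close> and at \<open>1\<close>, so
    \<open>\<phi> u\<close> differs from \<open>u\<close> by at most half of \<delta>.\<close>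
  have "0 < L * \<delta> / 4" using L \<delta> by simp
  then obtain d where d: "0 < d"
    "\<And>c e f t. \<lbrakk>geod c e f; (\<And>t. t \<in> {0..1} \<Longrightarrow> dist (c t) (\<gamma> t) < d); t \<in> {0..1}\<rbrakk> \<Longrightarrow>
      \<bar>f t - L * t\<bar> \<le> L * \<delta> / 4"
    using arclength_close[OF g] by metis
  show ?thesis
  proof (rule that[of "min d (\<epsilon> / 2)"])
    fix c e f \<phi> and u :: real
    assume c: "geod c e f" and close: "\<And>t. t \<in> {0..1} \<Longrightarrow> dist (c t) (\<gamma> t) < min d (\<epsilon> / 2)"
      and \<phi>: "reparam \<phi>" "\<And>t. t \<in> {0..1} \<Longrightarrow> f (\<phi> t) = f 1 * t" and u: "u \<in> {0..1}"
    have m: "\<phi> u \<in> {0..1}" by (rule reparam_mem[OF \<phi>(1) u])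
    have f: "\<bar>f t - L * t\<bar> \<le> L * \<delta> / 4" if "t \<in> {0..1}" for t
      using d(2)[OF c _ that] close by simp
    have "\<bar>f 1 * u - L * u\<bar> = \<bar>f 1 - L\<bar> * u" using u by (simp add: abs_mult flip: left_diff_distrib)
    also have "\<dots> \<le> L * \<delta> / 4" using f[of 1] u mult_left_le[of u "\<bar>f 1 - L\<bar>"] by simp
    finally have "\<bar>L * \<phi> u - L * u\<bar> \<le> L * \<delta> / 2" using f[OF m] \<phi>(2)[OF u] by linarith
    then have "L * \<bar>\<phi> u - u\<bar> \<le> L * (\<delta> / 2)" using L by (simp add: abs_mult flip: right_diff_distrib)
    then have "\<bar>\<phi> u - u\<bar> < \<delta>" using L \<delta>(1) by simp
    then have "dist (\<gamma> (\<phi> u)) (\<gamma> u) < \<epsilon> / 2" using \<delta>(2) m u by (simp add: dist_real_def)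
    moreover have "dist (c (\<phi> u)) (\<gamma> (\<phi> u)) < \<epsilon> / 2" using close[OF m] by simp
    ultimately show "dist (c (\<phi> u)) (\<gamma> u) < \<epsilon>" using dist_triangle_half_r[of "\<gamma> (\<phi> u)" "c (\<phi> u)" \<epsilon> "\<gamma> u"]
      by (simp add: dist_commute)
  qed (use d eps in auto)
qed

section \<open>Contraction of shifts and uniqueness\<close>

lemma geod_causal: "\<lbrakk>geod c e f; 0 \<le> s; s \<le> t; t \<le> 1\<rbrakk> \<Longrightarrow> c s \<preceq> c t"
  using geod_lower(1)[of c e f s t] chron_imp_causal by (cases "s = t") auto

text \<open>One step multiplies the shift by \<open>\<theta> = 1 - 4 / N\<^sup>2\<close>, see \<open>bump_contract\<close>.\<close>

lemma shift_contraction: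
  assumes N: "3 \<le> N"
    and W: "\<And>i. 0 < i \<Longrightarrow> i < N \<Longrightarrow> cmp_set (W i)"
    and \<sigma>: "geod \<sigma> e1 (\<lambda>t. A * t)" and \<rho>: "geod \<rho> e2 (\<lambda>t. B * t)"
    and \<sigma>W: "\<And>i t. \<lbrakk>0 < i; i < N; t \<in> {0..1}; \<bar>t - real i / real N\<bar> \<le> 2 / real N\<rbrakk> \<Longrightarrow> \<sigma> t \<in> W i"
    and \<rho>W: "\<And>i t. \<lbrakk>0 < i; i < N; t \<in> {0..1}; \<bar>t - real i / real N\<bar> \<le> 2 / real N\<rbrakk> \<Longrightarrow> \<rho> t \<in> W i"
    and ends: "\<sigma> 0 = \<rho> 0" "\<sigma> 1 = \<rho> 1"
    and start: "\<And>i. 0 < i \<Longrightarrow> i < N \<Longrightarrow> \<sigma> (real i / real N - bump N i) \<lless> \<rho> (real i / real N)"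
    and i: "0 < i" "i < N"
  shows "\<sigma> (real i / real N) \<preceq> \<rho> (real i / real N)"
proof -
  have AB: "0 < A" "0 < B" using geod_total[OF \<sigma>] geod_total[OF \<rho>] by auto
  have N0: "0 < N" using N by simp
  define t where "t i = real i / real N" for i
  have t: "t 0 = 0" "t N = 1" "\<And>i. t (Suc i) = t i + 1 / real N" "\<And>i. 0 \<le> t i" "\<And>i. i \<le> N \<Longrightarrow> t i \<le> 1"
    using N0 by (auto simp: t_def add_divide_distrib)
  define \<theta> where "\<theta> = 1 - 4 / real N ^ 2"
  have "(3::real) ^ 2 \<le> real N ^ 2" using N by (intro power_mono) auto
  then have \<theta>: "0 < \<theta>" "\<theta> < 1" using N0 by (auto simp: \<theta>_def)
  have step: "\<sigma> (t i - s * \<theta> * bump N i) \<lless> \<rho> (t i)"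
    if s: "0 < s" "s \<le> 1" and IH: "\<And>i. 0 < i \<Longrightarrow> i < N \<Longrightarrow> \<sigma> (t i - s * bump N i) \<lless> \<rho> (t i)"
      and i: "0 < i" "i < N" for s i
  proof -
    obtain j where j: "i = Suc j" using i gr0_conv_Suc by auto
    \<comment> \<open>Parameters of \<sigma> at the shifted neighbours of \<open>t i\<close>. By
      concavity their mean is shifted by \<open>s / N ^ 3\<close> less than
      \<open>s * bump N i\<close>.\<close>
    define a where "a = t j - s * bump N j"
    define b where "b = t (Suc i) - s * bump N (Suc i)"
    have w: "0 \<le> s * bump N k" "s * bump N k \<le> bump N k" if "k \<le> N" for k
      using s bump_nonneg[OF that] by (auto intro: mult_left_le_one_le)
    have w4: "4 * bump N k \<le> 1 / real N" for k by (rule bump_le[OF N0])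
    have tj: "t i = t j + 1 / real N" "t (Suc i) = t j + 2 / real N" using t(3) by (auto simp: j)
    have N1: "0 < 1 / real N" using N0 by simp
    have N2: "2 / real N = 1 / real N + 1 / real N" by simp
    have jN: "j \<le> N" "Suc i \<le> N" using i j by auto
    have "s * bump N j \<le> t j"
    proof (cases "j = 0")
      case False
      then have "1 / real N \<le> t j" using N0 by (simp add: t_def divide_right_mono)
      then show ?thesis using w[OF jN(1)] w4[of j] by linarith
    qed (use t in simp)
    then have a: "0 \<le> a" "a \<le> t j" "t j - 1 / real N \<le> a"
      using w[OF jN(1)] w4[of j] by (auto simp: a_def)
    have b: "t i < b" "b \<le> t (Suc i)" "b \<le> 1"
      using w[OF jN(2)] w4[of "Suc i"] t(5)[OF jN(2)] tj N1 N2 unfolding b_def by linarith+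
    have ab: "a < b" using a b tj N1 by linarith
    have avg: "(a + b) / 2 = t i - s * (bump N i - 1 / real N ^ 3)"
    proof -
      have "(a + b) / 2 = t i - s * ((bump N j + bump N (Suc (Suc j))) / 2)"
        using tj by (simp add: a_def b_def j field_simps)
      then show ?thesis unfolding bump_concave by (simp add: j)
    qed
    have tin: "\<bar>x - real i / real N\<bar> \<le> 2 / real N" if "a \<le> x" "x \<le> t (Suc i)" for x
      using that a tj N1 N2 unfolding t_def[symmetric] by linarith
    have t1: "t (Suc i) \<le> 1" by (rule t(5)[OF jN(2)])
    have \<sigma>in: "\<sigma> ` {a..t (Suc i)} \<subseteq> W i" and \<rho>in: "\<rho> ` {a..t (Suc i)} \<subseteq> W i"
      using \<sigma>W[OF i] \<rho>W[OF i] tin a t1 by auto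
    note p\<sigma> = geod_cmp_set[OF W[OF i] \<sigma> a(1) t1 \<sigma>in]
    note p\<rho> = geod_cmp_set[OF W[OF i] \<rho> a(1) t1 \<rho>in]
    have jlt: "t j < t i" "t i < t (Suc i)" using tj N1 N2 by linarith+
    have "\<sigma> ((a + b) / 2) \<lless> \<rho> (t i)"
    proof (rule comparison_quad[OF W[OF i], of "\<sigma> a" "\<sigma> b" "\<rho> (t j)" "\<rho> (t (Suc i))" _ _ "1 / 2"])
      show "\<sigma> a \<in> W i" "\<sigma> b \<in> W i" "\<rho> (t j) \<in> W i" "\<rho> (t (Suc i)) \<in> W i" "\<sigma> ((a + b) / 2) \<in> W i"
        "\<rho> (t i) \<in> W i"
        using \<sigma>in \<rho>in a b ab jlt by (auto intro!: imageI[THEN subsetD[OF \<sigma>in, THEN _]] simp: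
          image_subset_iff)
      show "\<sigma> a \<lless> \<sigma> b" using geod_lower(1)[OF \<sigma> a(1) ab b(3)] .
      show "\<rho> (t j) \<lless> \<rho> (t (Suc i))" using jlt t(4)[of j] t1 by (intro geod_lower(1)[OF \<rho>]) auto
      show x: "\<sigma> a = \<rho> (t j) \<or> \<sigma> a \<lless> \<rho> (t j)"
        using IH[of j] i ends t(1) by (cases "j = 0") (auto simp: a_def j)
      show y: "\<sigma> b = \<rho> (t (Suc i)) \<or> \<sigma> b \<lless> \<rho> (t (Suc i))"
        using IH[of "Suc i"] i ends t(2) by (cases "Suc i = N") (auto simp: b_def)
      \<comment> \<open>Here \<open>3 \<le> N\<close> enters: at least one neighbour is an inner
        grid point, so the two pairs of endpoints do not both coincide.\<close>
      have "0 < j \<or> Suc i < N" using N i j by linarith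
      then show "\<not> (\<sigma> a = \<rho> (t j) \<and> \<sigma> b = \<rho> (t (Suc i)))"
        using IH[of j] IH[of "Suc i"] i j chron_imp_neq by (auto simp: a_def b_def)
      show "ratio (\<sigma> a) (\<sigma> b) (1 / 2) (\<sigma> ((a + b) / 2))"
        using b ab by (intro linear_mid[OF p\<sigma>]) (auto simp: AB)
      show "ratio (\<rho> (t j)) (\<rho> (t (Suc i))) (1 / 2) (\<rho> (t i))"
        using a jlt tj by (intro linear_mid[OF p\<rho>]) (auto simp: AB)
    qed auto
    moreover have "\<sigma> (t i - s * \<theta> * bump N i) \<preceq> \<sigma> ((a + b) / 2)"
    proof -
      have "s * (bump N i - 1 / real N ^ 3) \<le> s * (\<theta> * bump N i)"
        unfolding \<theta>_def using s by (intro mult_left_mono bump_contract N0) auto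
      then have le: "t i - s * \<theta> * bump N i \<le> (a + b) / 2" by (simp add: avg mult.assoc)
      have "s * \<theta> * bump N i \<le> 1 * bump N i"
        using s \<theta> bump_nonneg[of i N] i by (intro mult_right_mono mult_le_one) auto
      then have "0 \<le> t i - s * \<theta> * bump N i" using w4[of i] tj t(4)[of j] bump_nonneg[of i N] i by linarith
      then show ?thesis using le ab b(3) by (intro geod_causal[OF \<sigma>]) auto
    qed
    ultimately show ?thesis by (rule causal_chron_trans[rotated])
  qed
  have all: "\<sigma> (t i - \<theta> ^ n * bump N i) \<lless> \<rho> (t i)" if "0 < i" "i < N" for n i
    using that
  proof (induction n arbitrary: i)
    case 0
    then show ?case using start by (simp add: t_def)
  next
    case (Suc n)
    have "0 < \<theta> ^ n" "\<theta> ^ n \<le> 1" using \<theta> by (auto intro: power_le_one)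
    from step[OF this Suc.IH Suc.prems] show ?case by (simp add: mult.assoc mult.commute)
  qed
  \<comment> \<open>The shifts \<open>\<theta> ^ n * bump N i\<close> tend to 0, and
    \<open>\<sigma> 0\<close> is the common lower bound that \<open>path_limit\<close> asks
    for.\<close>
  have "\<sigma> (t i) \<preceq> \<rho> (t i)"
  proof (rule path_limit[of \<sigma> "\<lambda>n. t i - \<theta> ^ n * bump N i" "t i" "\<sigma> 0"])
    show "continuous_on {0..1} \<sigma>" using \<sigma> by (simp add: geod_def)
    have "(\<lambda>n. t i - \<theta> ^ n * bump N i) \<longlonglongrightarrow> t i - 0 * bump N i"
      using \<theta> by (intro tendsto_intros LIMSEQ_power_zero) auto
    then show "(\<lambda>n. t i - \<theta> ^ n * bump N i) \<longlonglongrightarrow> t i" by simp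
    show "t i \<in> {0..1}" using t i by simp
    have "1 / real N \<le> t i" using i N0 by (simp add: t_def divide_right_mono)
    moreover have "0 \<le> \<theta> ^ n * bump N i" "\<theta> ^ n * bump N i \<le> bump N i" for n
      using \<theta> bump_nonneg[of i N] i by (auto intro!: mult_left_le_one_le power_le_one)
    ultimately have in01: "0 \<le> t i - \<theta> ^ n * bump N i" "t i - \<theta> ^ n * bump N i \<le> 1" for n
      using bump_le[OF N0, of i] t(5)[OF less_imp_le[OF i(2)]] by (smt (verit))+
    then show "t i - \<theta> ^ n * bump N i \<in> {0..1}" for n by simp
    show "\<sigma> 0 \<preceq> \<sigma> (t i - \<theta> ^ n * bump N i)" for n
      by (rule geod_causal[OF \<sigma> order_refl in01])
    show "\<sigma> (t i - \<theta> ^ n * bump N i) \<preceq> \<rho> (t i)" for n using all i chron_imp_causal by blast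
  qed
  then show ?thesis by (simp add: t_def)
qed

lemma chron_nbhd:
  assumes "x \<lless> y"
  obtains d where "0 < d" "\<And>x' y'. dist x' x < d \<Longrightarrow> dist y' y < d \<Longrightarrow> x' \<lless> y'"
proof -
  have "(x, y) \<in> {(x, y). x \<lless> y}" using assms by simp
  then obtain B C where BC: "open B" "open C" "(x, y) \<in> B \<times> C" "B \<times> C \<subseteq> {(x, y). x \<lless> y}"
    by (rule open_prod_elim[OF open_chron])
  obtain d1 where d1: "0 < d1" "ball x d1 \<subseteq> B" using BC openE[of B x] by auto
  obtain d2 where d2: "0 < d2" "ball y d2 \<subseteq> C" using BC openE[of C y] by auto
  show ?thesis
  proof (rule that[of "min d1 d2"])
    fix x' y' assume "dist x' x < min d1 d2" "dist y' y < min d1 d2"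
    then have "(x', y') \<in> B \<times> C" using d1 d2 by (auto simp: subset_iff dist_commute)
    then show "x' \<lless> y'" using BC(4) by auto
  qed (use d1 d2 in auto)
qed

text \<open>The triangle from the common start over \<open>\<rho> t1\<close> to the common end is
  degenerate because \<rho> is a maximizer between these points. The vertex is taken at
  \<open>t1\<close>, strictly between \<open>t\<close> and \<open>b\<close>, so that
  \<open>\<rho> t\<close> is an inner point of its side.\<close>

lemma linear_interleave:
  assumes W: "cmp_set W" and \<sigma>: "geod \<sigma> e1 (\<lambda>t. A * t)" and \<rho>: "geod \<rho> e2 (\<lambda>t. A * t)"
    and ab: "0 \<le> a" "b \<le> 1" and mem: "\<sigma> ` {a..b} \<subseteq> W" "\<rho> ` {a..b} \<subseteq> W"
    and ends: "\<sigma> a = \<rho> a" "\<sigma> b = \<rho> b" and st: "a < s" "s < t" "t < b"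
  shows "\<sigma> s \<lless> \<rho> t"
proof -
  have A: "0 < A" using geod_total[OF \<sigma>] by simp
  note p = geod_cmp_set[OF W \<sigma> ab mem(1)] and q = geod_cmp_set[OF W \<rho> ab mem(2)]
  define t1 where "t1 = (t + b) / 2"
  have t1: "t < t1" "t1 < b" using st by (auto simp: t1_def)
  have Tz: "T (\<sigma> a) (\<sigma> b) = A * b - A * a" using potentialD[OF p, of a b] st by (simp add: T_def)
  have Ty: "T (\<sigma> a) (\<rho> t1) = A * t1 - A * a" "T (\<rho> t1) (\<sigma> b) = A * b - A * t1"
    using potentialD[OF q, of a t1] potentialD[OF q, of t1 b] st t1 ends by (auto simp: T_def)
  show ?thesis
  proof (rule comparison_degenerate[OF W, of "\<sigma> a" "\<rho> t1" "\<sigma> b" _ _ "(t - a) / (t1 - a)"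
    "(s - a) / (b - a)"])
    show "\<sigma> a \<lless> \<rho> t1" unfolding ends using st t1 ab by (intro geod_lower(1)[OF \<rho>]) auto
    show "\<rho> t1 \<lless> \<sigma> b" unfolding ends using st t1 ab by (intro geod_lower(1)[OF \<rho>]) auto
    show "ratio (\<sigma> a) (\<rho> t1) ((t - a) / (t1 - a)) (\<rho> t)"
      unfolding ends using st t1 by (intro linear_ratio[OF q]) (auto simp: A)
    show "ratio (\<sigma> a) (\<sigma> b) ((s - a) / (b - a)) (\<sigma> s)"
      using st t1 by (intro linear_ratio[OF p]) (auto simp: A)
    have "(s - a) / (b - a) * T (\<sigma> a) (\<sigma> b) = A * (s - a)"
      using st by (simp add: Tz field_simps)
    also have "\<dots> < A * (t - a)" using A st by simp
    also have "\<dots> = (t - a) / (t1 - a) * T (\<sigma> a) (\<rho> t1)"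
      using st t1 by (simp add: Ty field_simps)
    finally show "(s - a) / (b - a) * T (\<sigma> a) (\<sigma> b) < (t - a) / (t1 - a) * T (\<sigma> a) (\<rho> t1)" .
  qed (use st t1 mem Tz Ty in auto)
qed

text \<open>Equal ends force equal speeds, since the total separations agree. By
  \<open>linear_interleave\<close>, \<open>\<sigma> s \<lless> \<rho> t\<close> for
  \<open>s < t\<close>; letting \<open>s\<close> tend to \<open>t\<close>, for both orders of the
  curves, antisymmetry gives equality.\<close>

lemma linear_unique:
  assumes W: "cmp_set W" and \<sigma>: "geod \<sigma> e1 (\<lambda>t. A * t)" and \<rho>: "geod \<rho> e2 (\<lambda>t. B * t)"
    and ab: "0 \<le> a" "b \<le> 1" "a < b" and mem: "\<sigma> ` {a..b} \<subseteq> W" "\<rho> ` {a..b} \<subseteq> W"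
    and ends: "\<sigma> a = \<rho> a" "\<sigma> b = \<rho> b" and t: "a \<le> t" "t \<le> b"
  shows "\<sigma> t = \<rho> t"
proof -
  have "T (\<sigma> a) (\<sigma> b) = A * b - A * a" "T (\<rho> a) (\<rho> b) = B * b - B * a"
    using potentialD[OF geod_cmp_set[OF W \<sigma> ab(1,2) mem(1)], of a b]
      potentialD[OF geod_cmp_set[OF W \<rho> ab(1,2) mem(2)], of a b] ab by (auto simp: T_def)
  then have "A * (b - a) = B * (b - a)" using ends by (simp add: algebra_simps)
  then have AB: "B = A" using ab by simp
  note \<rho>' = \<rho>[unfolded AB]
  have lim: "\<sigma>' t \<preceq> \<rho>' t"
    if c: "continuous_on {0..1} \<sigma>'" "\<And>s. a < s \<Longrightarrow> s < t \<Longrightarrow> \<sigma>' a \<preceq> \<sigma>' s"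
      and l: "\<And>s. a < s \<Longrightarrow> s < t \<Longrightarrow> \<sigma>' s \<lless> \<rho>' t" and t: "a < t" "t < b" for \<sigma>' \<rho>'
    by (rule path_limit_left[OF c(1) ab(1) t(1), of "\<sigma>' a"]) (use c l chron_imp_causal t ab in auto)
  show ?thesis
  proof (cases "t = a \<or> t = b")
    case False
    then have t: "a < t" "t < b" using t by auto
    have "\<sigma> t \<preceq> \<rho> t"
    proof (rule lim)
      show "continuous_on {0..1} \<sigma>" using \<sigma> by (simp add: geod_def)
      show "\<sigma> a \<preceq> \<sigma> s" if "a < s" "s < t" for s using that t ab by (intro geod_causal[OF \<sigma>]) auto
      show "\<sigma> s \<lless> \<rho> t" if "a < s" "s < t" for s
        using linear_interleave[OF W \<sigma> \<rho>' ab(1,2) mem ends that t(2)] .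
    qed (use t in auto)
    moreover have "\<rho> t \<preceq> \<sigma> t"
    proof (rule lim)
      show "continuous_on {0..1} \<rho>" using \<rho> by (simp add: geod_def)
      show "\<rho> a \<preceq> \<rho> s" if "a < s" "s < t" for s using that t ab by (intro geod_causal[OF \<rho>]) auto
      show "\<rho> s \<lless> \<sigma> t" if "a < s" "s < t" for s
        using linear_interleave[OF W \<rho>' \<sigma> ab(1,2) mem(2,1) ends[symmetric] that t(2)] .
    qed (use t in auto)
    ultimately show ?thesis by (rule causal_antisym)
  qed (use ends in auto)
qed

text \<open>The relation of \<open>\<gamma> (t i - bump N i)\<close> to
  \<open>\<gamma> (t i)\<close> is open, so it persists for curves near \<gamma> and starts
  \<open>shift_contraction\<close>, once for each order of the two curves. This settles the grid
  points; \<open>linear_unique\<close> fills the gaps.\<close>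

lemma nearby_unique:
  assumes g: "geod \<gamma> e0 (\<lambda>t. L * t)"
  obtains d where "0 < d"
    "\<And>\<sigma> \<rho> e1 e2 A B t. \<lbrakk>geod \<sigma> e1 (\<lambda>t. A * t); geod \<rho> e2 (\<lambda>t. B * t); (\<And>t. t \<in> {0..1} \<Longrightarrow>
      dist (\<sigma> t) (\<gamma> t) < d); (\<And>t. t \<in> {0..1} \<Longrightarrow> dist (\<rho> t) (\<gamma> t) < d); \<sigma> 0 = \<rho> 0; \<sigma> 1 = \<rho> 1; t \<in> {0..1}\<rbrakk>
        \<Longrightarrow> \<sigma> t = \<rho> t"
proof -
  have cont: "continuous_on {0..1} \<gamma>" using g by (simp add: geod_def)
  obtain r h where rh: "0 < r" "0 < h"
    "\<And>s. s \<in> {0..1} \<Longrightarrow> \<exists>W. cmp_set W \<and> W \<subseteq> ball (\<gamma> s) 1 \<and> (\<forall>t\<in>{0..1}. \<bar>t - s\<bar> \<le> h \<longrightarrow> ball (\<gamma> t) r \<subseteq> W)"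
    using cmp_set_cover[OF cont, of 1] by auto
  obtain m :: nat where m: "2 / h \<le> real m" using real_arch_simple by blast
  define N where "N = m + 3"
  have "2 / h \<le> real N" using m by (simp add: N_def)
  then have N: "3 \<le> N" "0 < N" "2 / real N \<le> h" using rh by (auto simp: N_def field_simps)
  define t where "t i = real i / real N" for i
  have t: "t 0 = 0" "t N = 1" "\<And>i. t (Suc i) = t i + 1 / real N" "\<And>i. 0 \<le> t i" "\<And>i. i \<le> N \<Longrightarrow> t i \<le> 1"
    using N by (auto simp: t_def add_divide_distrib)
  have "\<exists>W. cmp_set W \<and> (\<forall>u\<in>{0..1}. \<bar>u - t i\<bar> \<le> h \<longrightarrow> ball (\<gamma> u) r \<subseteq> W)" if "i < N" for i
    using rh(3)[of "t i"] t that by (auto simp: less_imp_le)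
  then obtain W where W: "\<And>i. i < N \<Longrightarrow> cmp_set (W i)"
    "\<And>i u. \<lbrakk>i < N; u \<in> {0..1}; \<bar>u - t i\<bar> \<le> h\<rbrakk> \<Longrightarrow> ball (\<gamma> u) r \<subseteq> W i" by metis
  have "\<exists>d>0. \<forall>x y. dist x (\<gamma> (t i - bump N i)) < d \<longrightarrow> dist y (\<gamma> (t i)) < d \<longrightarrow> x \<lless> y"
    if i: "0 < i" "i < N" for i
  proof -
    have "1 / real N \<le> t i" using i N by (simp add: t_def divide_right_mono)
    then have "0 \<le> t i - bump N i" "t i - bump N i < t i" "t i \<le> 1"
      using bump_pos[of i N] i bump_le[of N i] N t(5)[of i] by linarith+
    then have "\<gamma> (t i - bump N i) \<lless> \<gamma> (t i)" by (intro geod_lower(1)[OF g]) auto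
    then show ?thesis using chron_nbhd by metis
  qed
  then obtain D where D: "\<And>i. 0 < i \<Longrightarrow> i < N \<Longrightarrow> 0 < D i"
    "\<And>i x y. \<lbrakk>0 < i; i < N; dist x (\<gamma> (t i - bump N i)) < D i; dist y (\<gamma> (t i)) < D i\<rbrakk> \<Longrightarrow> x \<lless> y"
    by metis
  define d where "d = min r (Min (D ` {0<..<N}))"
  have "1 \<in> {0<..<N}" using N by simp
  then have Dne: "finite (D ` {0<..<N})" "D ` {0<..<N} \<noteq> {}" by blast+
  have d: "0 < d" unfolding d_def using D(1) Dne rh(1) by (auto simp: Min_gr_iff)
  have dD: "d \<le> D i" if "0 < i" "i < N" for i
  proof -
    have "Min (D ` {0<..<N}) \<le> D i" using Dne that by (intro Min_le) auto
    then show ?thesis by (simp add: d_def)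
  qed
  have memW: "\<sigma> u \<in> W i"
    if close: "\<And>t. t \<in> {0..1} \<Longrightarrow> dist (\<sigma> t) (\<gamma> t) < d" and "i < N" "u \<in> {0..1}" "\<bar>u - t i\<bar> \<le> 2 / real N"
    for \<sigma> i u
  proof -
    have "\<sigma> u \<in> ball (\<gamma> u) r" using close[OF that(3)] by (simp add: d_def dist_commute)
    then show ?thesis using W(2)[OF that(2,3)] that(4) N by auto
  qed
  have one_sided: "\<sigma> (t i) \<preceq> \<rho> (t i)"
    if \<sigma>: "geod \<sigma> e1 (\<lambda>t. A * t)" and \<rho>: "geod \<rho> e2 (\<lambda>t. B * t)"
      and cs: "\<And>t. t \<in> {0..1} \<Longrightarrow> dist (\<sigma> t) (\<gamma> t) < d" and cr: "\<And>t. t \<in> {0..1} \<Longrightarrow> dist (\<rho> t) (\<gamma> t) < d"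
      and ends: "\<sigma> 0 = \<rho> 0" "\<sigma> 1 = \<rho> 1" and i: "0 < i" "i < N" for \<sigma> \<rho> e1 e2 A B i
    unfolding t_def
  proof (rule shift_contraction[OF N(1) W(1) \<sigma> \<rho> _ _ ends _ i, of "\<lambda>i. i"])
    fix j u assume j: "0 < j" "j < N" and u: "u \<in> {0..1}" "\<bar>u - real j / real N\<bar> \<le> 2 / real N"
    show "\<sigma> u \<in> W j" "\<rho> u \<in> W j"
      using memW[OF cs j(2) u(1)] memW[OF cr j(2) u(1)] u(2) by (auto simp: t_def)
  next
    fix j assume j: "0 < j" "j < N"
    have "1 / real N \<le> t j" using j N by (simp add: t_def divide_right_mono)
    then have "t j - bump N j \<in> {0..1}" "t j \<in> {0..1}"
      using bump_pos[of j N] j bump_le[of N j] N t(4)[of j] t(5)[of j] unfolding atLeastAtMost_iff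
        by linarith+
    then have "\<sigma> (t j - bump N j) \<lless> \<rho> (t j)" using cs cr dD[OF j] by (intro D(2)[OF j]) (meson
      less_le_trans)+
    then show "\<sigma> (real j / real N - bump N j) \<lless> \<rho> (real j / real N)" by (simp add: t_def)
  qed auto
  show ?thesis
  proof (rule that[OF d])
    fix \<sigma> \<rho> e1 e2 A B and u :: real
    assume \<sigma>: "geod \<sigma> e1 (\<lambda>t. A * t)" and \<rho>: "geod \<rho> e2 (\<lambda>t. B * t)"
      and cs: "\<And>t. t \<in> {0..1} \<Longrightarrow> dist (\<sigma> t) (\<gamma> t) < d" and cr: "\<And>t. t \<in> {0..1} \<Longrightarrow> dist (\<rho> t) (\<gamma> t) < d"
      and ends: "\<sigma> 0 = \<rho> 0" "\<sigma> 1 = \<rho> 1" and u: "u \<in> {0..1}"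
    have grid: "\<sigma> (t i) = \<rho> (t i)" if "i \<le> N" for i
    proof -
      consider "i = 0" | "i = N" | "0 < i" "i < N" using \<open>i \<le> N\<close> by linarith
      then show ?thesis
      proof cases
        case 3
        then show ?thesis
          using one_sided[OF \<sigma> \<rho> cs cr ends] one_sided[OF \<rho> \<sigma> cr cs ends[symmetric]]
            by (intro causal_antisym) auto
      qed (use ends t in auto)
    qed
    have "\<exists>i<N. t i \<le> u \<and> u \<le> t (Suc i)"
    proof (cases "u = 1")
      case True
      then show ?thesis using t(2) t(5)[of "N - 1"] N by (intro exI[of _ "N - 1"]) auto
    next
      case False
      define i where "i = nat \<lfloor>u * real N\<rfloor>"
      have "0 \<le> u * real N" using u by simp
      then have i: "real i \<le> u * real N" "u * real N < real (Suc i)" unfolding i_def by linarith+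
      moreover have "u * real N < 1 * real N" using u False N by (intro mult_strict_right_mono) auto
      then have "i < N" using i(1) by linarith
      ultimately have "i < N" "t i \<le> u" "u \<le> t (Suc i)" using N by (auto simp: t_def field_simps)
      then show ?thesis by blast
    qed
    then obtain i where i: "i < N" "t i \<le> u" "u \<le> t (Suc i)" by blast
    have "Suc i \<le> N" using i by simp
    note t1 = t(5)[OF this]
    have "\<bar>v - t i\<bar> \<le> 2 / real N \<and> v \<in> {0..1}" if "t i \<le> v" "v \<le> t (Suc i)" for v
    proof -
      have "1 / real N \<le> 2 / real N" by (intro divide_right_mono) auto
      then show ?thesis using that t(3)[of i] t(4)[of i] t1 unfolding atLeastAtMost_iff by linarith
    qed
    note v = this
    have "\<sigma> v \<in> W i" "\<rho> v \<in> W i" if "t i \<le> v" "v \<le> t (Suc i)" for v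
      using memW[OF cs i(1)] memW[OF cr i(1)] v[OF that] by blast+
    then have im: "\<sigma> ` {t i..t (Suc i)} \<subseteq> W i" "\<rho> ` {t i..t (Suc i)} \<subseteq> W i"
      unfolding image_subset_iff Ball_def atLeastAtMost_iff by blast+
    have "t i < t (Suc i)" using t(3)[of i] N by simp
    moreover have "\<sigma> (t i) = \<rho> (t i)" "\<sigma> (t (Suc i)) = \<rho> (t (Suc i))"
      using grid[of i] grid[of "Suc i"] i(1) by simp_all
    ultimately show "\<sigma> u = \<rho> u"
      by (rule linear_unique[OF W(1)[OF i(1)] \<sigma> \<rho> t(4) t1 _ im _ _ i(2,3)])
  qed
qed

section \<open>Existence of geodesics near a given one\<close>

text \<open>Chains are indexed by all natural numbers, so that compactness of a product of compact
  sets applies to the function type; only indices up to \<open>N\<close> affect the sum.\<close>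

lemma chain_max:
  fixes K :: "nat \<Rightarrow> 'a set"
  assumes K: "\<And>i. compact (K i)" "\<And>i. K i \<noteq> {}"
    and cont: "\<And>i. i < N \<Longrightarrow> continuous_on (K i \<times> K (Suc i)) (\<lambda>(x, y). T x y)"
  obtains x where "\<And>i. x i \<in> K i"
    "\<And>y. (\<And>i. y i \<in> K i) \<Longrightarrow> (\<Sum>i<N. T (y i) (y (Suc i))) \<le> (\<Sum>i<N. T (x i) (x (Suc i)))"
proof -
  let ?P = "PiE UNIV K"
  have "compactin (product_topology (\<lambda>_. euclidean) UNIV) ?P" unfolding compactin_PiE using K by simp
  then have cp: "compact ?P" by (simp add: euclidean_product_topology)
  have ne: "?P \<noteq> {}" using K by (simp add: PiE_eq_empty_iff)
  have cs: "continuous_on ?P (\<lambda>x. \<Sum>i<N. T (x i) (x (Suc i)))"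
  proof (intro continuous_on_sum)
    fix i assume i: "i \<in> {..<N}"
    have c: "continuous_on ?P (\<lambda>x. x j)" for j
      by (rule continuous_on_subset[OF continuous_on_product_coordinates]) simp
    have "continuous_on ?P (\<lambda>x. (\<lambda>(x, y). T x y) (x i, x (Suc i)))"
      using i c by (intro continuous_on_compose2[OF cont[of i]] continuous_on_Pair) auto
    then show "continuous_on ?P (\<lambda>x. T (x i) (x (Suc i)))" by simp
  qed
  obtain x where x: "x \<in> ?P"
    "\<forall>y\<in>?P. (\<Sum>i<N. T (y i) (y (Suc i))) \<le> (\<Sum>i<N. T (x i) (x (Suc i)))"
    using continuous_attains_sup[OF cp ne cs] by blast
  show ?thesis
  proof (rule that[of x])
    show "x i \<in> K i" for i using x(1) by (simp add: PiE_iff)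
    fix y assume "\<And>i. y i \<in> K i"
    then have "y \<in> ?P" by (simp add: PiE_iff)
    then show "(\<Sum>i<N. T (y i) (y (Suc i))) \<le> (\<Sum>i<N. T (x i) (x (Suc i)))" using x(2) by blast
  qed
qed

text \<open>Replacing one inner point changes just the two summands that contain it.\<close>

lemma chain_max_local:
  assumes K: "\<And>i. x i \<in> K i" "\<And>y. (\<And>i. y i \<in> K i) \<Longrightarrow> (\<Sum>i<N. T (y i) (y (Suc i))) \<le> (\<Sum>i<N.
    T (x i) (x (Suc i)))"
    and j: "Suc j < N" and m: "m \<in> K (Suc j)"
  shows "T (x j) m + T m (x (Suc (Suc j))) \<le> T (x j) (x (Suc j)) + T (x (Suc j)) (x (Suc (Suc j)))"
proof -
  let ?y = "x(Suc j := m)"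
  have "(\<Sum>i<N. T (?y i) (?y (Suc i))) \<le> (\<Sum>i<N. T (x i) (x (Suc i)))"
    using K(1) m by (intro K(2)) auto
  moreover have split: "(\<Sum>i<N. f i) = f j + f (Suc j) + (\<Sum>i\<in>{..<N} - {j, Suc j}. f i)" for f :: "nat \<Rightarrow> real"
  proof -
    have "(\<Sum>i<N. f i) = (\<Sum>i\<in>{j, Suc j}. f i) + (\<Sum>i\<in>{..<N} - {j, Suc j}. f i)"
      using j by (subst sum.union_disjoint[symmetric]) (auto intro!: sum.cong)
    then show ?thesis by simp
  qed
  moreover have "(\<Sum>i\<in>{..<N} - {j, Suc j}. T (?y i) (?y (Suc i))) = (\<Sum>i\<in>{..<N} - {j, Suc j}.
    T (x i) (x (Suc i)))"
    by (intro sum.cong) auto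
  ultimately show ?thesis
    unfolding split[of "\<lambda>i. T (?y i) (?y (Suc i))"] split[of "\<lambda>i. T (x i) (x (Suc i))"] by simp
qed

text \<open>Additivity makes each window of two consecutive pieces maximizing. Neighbouring windows
  overlap in a whole piece, so every parameter is interior to some window relative to the unit
  interval, as a geodesic requires. Convexity keeps each window in its comparison set.\<close>

lemma chain_geodesic:
  fixes x :: "nat \<Rightarrow> 'a"
  assumes N: "2 \<le> N" and W: "\<And>j. Suc j < N \<Longrightarrow> cmp_set (W (Suc j))"
    and mem: "\<And>j. Suc j < N \<Longrightarrow> x j \<in> W (Suc j) \<and> x (Suc j) \<in> W (Suc j) \<and> x (Suc (Suc j)) \<in> W (Suc j)"
    and ch: "\<And>i. i < N \<Longrightarrow> x i \<lless> x (Suc i)"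
    and add: "\<And>j. Suc j < N \<Longrightarrow>
      T (x j) (x (Suc (Suc j))) = T (x j) (x (Suc j)) + T (x (Suc j)) (x (Suc (Suc j)))"
  shows "\<exists>\<sigma>\<in>timelike_geodesics X. \<sigma> 0 = x 0 \<and> \<sigma> 1 = x N \<and>
    (\<forall>j t. Suc j < N \<longrightarrow> real j / real N \<le> t \<longrightarrow> t \<le> real (Suc (Suc j)) / real N \<longrightarrow> \<sigma> t \<in> W (Suc j))"
proof -
  have N0: "0 < N" using N by simp
  define t where "t i = real i / real N" for i
  have t: "t 0 = 0" "t N = 1" "\<And>i. t i < t (Suc i)" "\<And>i. 0 \<le> t i" "\<And>i. i \<le> N \<Longrightarrow> t i \<le> 1"
    using N0 by (auto simp: t_def divide_strict_right_mono)
  have "\<exists>c f. timelike_curve X c (t i) (t (Suc i)) \<and> potential X c (t i) (t (Suc i)) f \<and>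
      c (t i) = x i \<and> c (t (Suc i)) = x (Suc i)" if i: "i < N" for i
  proof (cases i)
    case 0
    then have "cmp_set (W 1)" "x i \<in> W 1" "x (Suc i) \<in> W 1" using W[of 0] mem[of 0] N by auto
    then show ?thesis using cmp_set_connect[of "W 1"] ch[OF i] t(3)[of i] by blast
  next
    case (Suc j)
    then have "cmp_set (W i)" "x i \<in> W i" "x (Suc i) \<in> W i" using W[of j] mem[of j] i by auto
    then show ?thesis using cmp_set_connect[of "W i"] ch[OF i] t(3)[of i] by blast
  qed
  then obtain c f where c: "\<And>i. i < N \<Longrightarrow> timelike_curve X (c i) (t i) (t (Suc i))"
    "\<And>i. i < N \<Longrightarrow> potential X (c i) (t i) (t (Suc i)) (f i)"
    "\<And>i. i < N \<Longrightarrow> c i (t i) = x i" "\<And>i. i < N \<Longrightarrow> c i (t (Suc i)) = x (Suc i)" by metis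
  \<comment> \<open>At \<open>s = 1\<close> the floor would give the index \<open>N\<close>, for
    which there is no piece; hence the separate value.\<close>
  define \<sigma> where "\<sigma> s = (if s < 1 then c (nat \<lfloor>s * real N\<rfloor>) s else x N)" for s
  have \<sigma>c: "\<sigma> s = c i s" if i: "i < N" and s: "t i \<le> s" "s \<le> t (Suc i)" for i s
  proof (cases "s < t (Suc i)")
    case True
    then have "real i \<le> s * real N" "s * real N < real (Suc i)" using s N0 by (auto simp: t_def field_simps)
    then have "\<lfloor>s * real N\<rfloor> = int i" by (intro floor_unique) auto
    moreover have "s < 1" using True t(5)[of "Suc i"] i by simp
    ultimately show ?thesis by (simp add: \<sigma>_def)
  next
    case False
    then have s: "s = t (Suc i)" using s by simp
    show ?thesis
    proof (cases "Suc i = N")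
      case True
      then have "s = 1" using s t by simp
      then show ?thesis using c(4)[OF i] s True by (simp add: \<sigma>_def)
    next
      case False
      then have i': "Suc i < N" using i by simp
      then have "s < 1" using t(3)[of "Suc i"] t(5)[of "Suc (Suc i)"] s by simp
      moreover have "s * real N = real (Suc i)" using s N0 by (simp add: t_def)
      then have "nat \<lfloor>s * real N\<rfloor> = Suc i" by simp
      ultimately show ?thesis using c(3)[OF i'] c(4)[OF i] s by (simp add: \<sigma>_def)
    qed
  qed
  have tl1: "timelike_curve X \<sigma> (t i) (t (Suc i))" if "i < N" for i
    by (rule timelike_curve_cong[OF c(1)[OF that]]) (rule \<sigma>c[OF that])
  have pot1: "potential X \<sigma> (t i) (t (Suc i)) (f i)" if "i < N" for i
    by (rule potential_cong[OF c(2)[OF that]]) (rule \<sigma>c[OF that])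
  have \<sigma>t: "\<sigma> (t i) = x i" if "i \<le> N" for i
  proof (cases "i < N")
    case True
    then show ?thesis using \<sigma>c[OF True, of "t i"] c(3)[OF True] t(3)[of i] by simp
  next
    case False
    then have "i = N" using that by simp
    then show ?thesis using t by (simp add: \<sigma>_def)
  qed
  have "timelike_curve X \<sigma> 0 (t (Suc k))" if "Suc k \<le> N" for k
    using that
  proof (induction k)
    case 0
    then show ?case using tl1[of 0] t(1) by simp
  next
    case (Suc k)
    then show ?case using timelike_curve_join[OF _ tl1[of "Suc k"]] by simp
  qed
  from this[of "N - 1"] have tl: "timelike_curve X \<sigma> 0 1" using N0 t(2) by simp
  have sub: "0 \<le> t j" "t (Suc (Suc j)) \<le> 1" "t j < t (Suc j)" "t (Suc j) < t (Suc (Suc j))"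
    if "Suc j < N" for j
    using t(4) t(5)[of "Suc (Suc j)"] t(3) that by auto
  have inW: "\<sigma> s \<in> W (Suc j)" if j: "Suc j < N" and s: "t j \<le> s" "s \<le> t (Suc (Suc j))" for j s
  proof -
    have "\<sigma> a \<preceq> \<sigma> b" if "0 \<le> a" "a \<le> b" "b \<le> 1" for a b
      using tl that chron_imp_causal by (cases "a = b") (auto simp: timelike_curve_iff)
    then have "\<sigma> (t j) \<preceq> \<sigma> s" "\<sigma> s \<preceq> \<sigma> (t (Suc (Suc j)))" using s sub[OF j] by auto
    then show ?thesis using cmp_set_convex[OF W[OF j], of "x j" "x (Suc (Suc j))"] mem[OF j] \<sigma>t j by simp
  qed
  have max: "maximizer X \<sigma> (t j) (t (Suc (Suc j)))" if j: "Suc j < N" for j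
  proof -
    have tl2: "timelike_curve X \<sigma> (t j) (t (Suc (Suc j)))"
      using timelike_curve_join[OF tl1 tl1] j by simp
    note m = mem[OF j] and e = cmp_set_tau[OF W[OF j]]
    have "\<exists>h. potential X \<sigma> (t j) (t (Suc (Suc j))) h"
    proof (rule potential_join[OF pot1 pot1])
      show "\<sigma> s \<preceq> \<sigma> u" if "t j \<le> s" "s \<le> u" "u \<le> t (Suc (Suc j))" for s u
        using tl2 that chron_imp_causal by (cases "s = u") (auto simp: timelike_curve_iff)
      show "\<tau> (\<sigma> (t j)) (\<sigma> (t (Suc (Suc j)))) \<le> \<tau> (\<sigma> (t j)) (\<sigma> (t (Suc j))) + \<tau> (\<sigma> (t (Suc j))) (\<sigma> (t
        (Suc (Suc j))))"
        using m j add[OF j] by (simp add: \<sigma>t e)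
    qed (use sub[OF j] j in auto)
    then show ?thesis using potential_maximizer[OF tl2] by blast
  qed
  have "geodesic X \<sigma> 0 1"
    unfolding geodesic_def
  proof (intro conjI ballI timelike_curve_causal[OF tl])
    fix s :: real assume s: "s \<in> {0..1}"
    have "\<exists>j. Suc j < N \<and> (j = 0 \<or> t j < s) \<and> (Suc (Suc j) = N \<or> s < t (Suc (Suc j)))"
    proof (cases "s < t 2")
      case True
      then show ?thesis using N by (intro exI[of _ 0]) (auto simp: numeral_2_eq_2)
    next
      case False
      define k where "k = nat \<lfloor>s * real N\<rfloor>"
      have "0 \<le> s * real N" using s by simp
      then have k: "real k \<le> s * real N" "s * real N < real (Suc k)" unfolding k_def by linarith+
      have "2 \<le> s * real N" using False N0 by (simp add: t_def field_simps)
      then have k2: "2 \<le> k" using k by linarith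
      have "s * real N \<le> 1 * real N" using s by (intro mult_right_mono) auto
      then have kN: "k \<le> N" using k(1) by linarith
      \<comment> \<open>The grid interval containing \<open>s\<close> starts at index
        \<open>k\<close>, so the window from \<open>k - 1\<close> to \<open>k + 1\<close> has
        \<open>s\<close> strictly inside. For \<open>k = N\<close>, that is \<open>s = 1\<close>,
        the last window is used.\<close>
      define j where "j = (if k = N then N - 2 else k - 1)"
      have "t j < s"
      proof -
        have "real j < s * real N" using k(1) k2 by (auto simp: j_def)
        then show ?thesis using N0 by (simp add: t_def field_simps)
      qed
      moreover have "Suc j < N" using k2 kN N by (auto simp: j_def)
      moreover have "Suc (Suc j) = N \<or> s < t (Suc (Suc j))"
      proof (cases "k = N")
        case False
        then have "real (Suc (Suc j)) = real (Suc k)" using k2 by (simp add: j_def)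
        then show ?thesis using k(2) N0 by (simp add: t_def field_simps)
      qed (use N in \<open>auto simp: j_def\<close>)
      ultimately show ?thesis by blast
    qed
    then obtain j where j: "Suc j < N" "j = 0 \<or> t j < s" "Suc (Suc j) = N \<or> s < t (Suc (Suc j))" by blast
    define e
      where "e = min (if j = 0 then 1 else s - t j) (if Suc (Suc j) = N then 1 else t (Suc (Suc j)) - s)"
    have "0 < e" using j by (auto simp: e_def)
    moreover have "ball s e \<inter> {0..1} \<subseteq> {t j..t (Suc (Suc j))}"
    proof
      fix u assume u: "u \<in> ball s e \<inter> {0..1}"
      have "t j \<le> u" using u t(1) by (cases "j = 0") (auto simp: e_def dist_real_def)
      moreover have "u \<le> t (Suc (Suc j))" using u t(2) by (cases "Suc (Suc j) = N") (auto simp: e_def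
        dist_real_def)
      ultimately show "u \<in> {t j..t (Suc (Suc j))}" by simp
    qed
    moreover have "{t j..t (Suc (Suc j))} \<subseteq> {0..1}" using sub[OF j(1)] by auto
    ultimately show "\<exists>a b. {a..b} \<subseteq> {0..1} \<and> (\<exists>e>0. ball s e \<inter> {0..1} \<subseteq> {a..b}) \<and> maximizer X \<sigma> a b"
      using max[OF j(1)] by blast
  qed
  then have "\<sigma> \<in> timelike_geodesics X" using tl by (simp add: timelike_geodesics_def)
  moreover have "\<sigma> 0 = x 0" "\<sigma> 1 = x N" using \<sigma>t[of 0] \<sigma>t[of N] t by auto
  moreover have "\<sigma> s \<in> W (Suc j)"
    if "Suc j < N" "real j / real N \<le> s" "s \<le> real (Suc (Suc j)) / real N" for j s
    using inW[OF that(1)] that(2,3) by (simp add: t_def)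
  ultimately show ?thesis by blast
qed

section \<open>Barriers for the competing chains\<close>

lemma tau_near_past:
  assumes W: "cmp_set W" and yz: "y \<in> W" "z \<in> W" and \<eta>: "0 < \<eta>"
  obtains p where "p \<in> W" "p \<lless> y" "T p z < T y z + \<eta>"
proof -
  have "continuous_on W (\<lambda>x. (\<lambda>(x, y). T x y) (x, z))"
    using yz by (intro continuous_on_compose2[OF cmp_set_cont[OF W]] continuous_intros) auto
  then have c: "continuous_on W (\<lambda>x. T x z)" by simp
  have "open ((\<lambda>x. T x z) -` {..<T y z + \<eta>} \<inter> W)"
    by (rule continuous_on_open_vimage[OF cmp_set_open[OF W], THEN iffD1, OF c, rule_format]) simp
  moreover have "y \<in> (\<lambda>x. T x z) -` {..<T y z + \<eta>} \<inter> W" using yz \<eta> by auto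
  ultimately obtain p where "p \<in> (\<lambda>x. T x z) -` {..<T y z + \<eta>} \<inter> W" "p \<lless> y"
    by (rule past_exists)
  then show ?thesis using that by auto
qed

lemma tau_near_future:
  assumes W: "cmp_set W" and xy: "x \<in> W" "y \<in> W" and \<eta>: "0 < \<eta>"
  obtains p where "p \<in> W" "y \<lless> p" "T x p < T x y + \<eta>"
proof -
  have "continuous_on W (\<lambda>y. (\<lambda>(x, y). T x y) (x, y))"
    using xy by (intro continuous_on_compose2[OF cmp_set_cont[OF W]] continuous_intros) auto
  then have c: "continuous_on W (\<lambda>y. T x y)" by simp
  have "open ((\<lambda>y. T x y) -` {..<T x y + \<eta>} \<inter> W)"
    by (rule continuous_on_open_vimage[OF cmp_set_open[OF W], THEN iffD1, OF c, rule_format]) simp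
  moreover have "y \<in> (\<lambda>y. T x y) -` {..<T x y + \<eta>} \<inter> W" using xy \<eta> by auto
  ultimately obtain p where "p \<in> (\<lambda>y. T x y) -` {..<T x y + \<eta>} \<inter> W" "y \<lless> p"
    by (rule future_exists)
  then show ?thesis using that by auto
qed

text \<open>\<open>comparison_quad\<close> squeezes the midpoint between \<open>m1\<close> and
  \<open>m2\<close>, the midpoints of the lower and of the upper barrier points. The condition
  \<open>b \<lless> a'\<close> ensures \<open>x \<lless> y\<close>.\<close>

lemma ratio_half_between:
  assumes W: "cmp_set W" and mem: "a \<in> W" "a' \<in> W" "b \<in> W" "b' \<in> W" "x \<in> W" "y \<in> W"
    and x: "a \<lless> x" "x \<lless> b" and y: "a' \<lless> y" "y \<lless> b'" and ba: "b \<lless> a'"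
    and m: "m1 \<in> W" "ratio a a' (1/2) m1" "m2 \<in> W" "ratio b b' (1/2) m2" and lu: "l \<lless> m1" "m2 \<lless> u"
  obtains m where "m \<in> W" "ratio x y (1/2) m" "l \<lless> m" "m \<lless> u"
proof -
  have aa: "a \<lless> a'" and bb: "b \<lless> b'" and xy: "x \<lless> y" using x y ba chron_trans by blast+
  obtain m where mm: "m \<in> W" "ratio x y (1/2) m" using ratio_exists[OF W mem(5,6) xy, of "1/2"] by auto
  have "m1 \<lless> m"
    using comparison_quad[OF W mem(1,2,5,6) m(1) mm(1) aa xy _ _ _ m(2) mm(2)] x y
      chron_imp_neq[OF x(1)] by simp
  moreover have "m \<lless> m2"
    using comparison_quad[OF W mem(5,6,3,4) mm(1) m(3) xy bb _ _ _ mm(2) m(4)] x y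
      chron_imp_neq[OF x(2)] by simp
  ultimately show ?thesis using that[OF mm] lu chron_trans by blast
qed

text \<open>The sets \<open>K i\<close> of admissible points lie strictly between barrier points
  \<open>A i\<close> and \<open>B i\<close>. Conversely, the midpoint of \<open>A j\<close> and
  \<open>A (j + 2)\<close> lies after the lower vertex of \<open>K (j + 1)\<close>, and that of
  \<open>B j\<close> and \<open>B (j + 2)\<close> before its upper vertex. This makes midpoints of
  admissible points admissible again.\<close>

lemma nearby_geodesic:
  assumes g: "geod \<gamma> e0 (\<lambda>t. L * t)" and eps: "0 < \<epsilon>"
  obtains \<delta> where "0 < \<delta>"
    "\<And>p' q'. dist p' (\<gamma> 0) < \<delta> \<Longrightarrow> dist q' (\<gamma> 1) < \<delta> \<Longrightarrow>
       \<exists>\<sigma>\<in>timelike_geodesics X. \<sigma> 0 = p' \<and> \<sigma> 1 = q' \<and> (\<forall>t\<in>{0..1}. dist (\<sigma> t) (\<gamma> t) < \<epsilon>)"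
proof -
  have L: "0 < L" using geod_total[OF g] by simp
  have cont: "continuous_on {0..1} \<gamma>" using g by (simp add: geod_def)
  have "0 < \<epsilon> / 2" using eps by simp
  then obtain r h where rh: "0 < r" "0 < h"
    "\<And>s. s \<in> {0..1} \<Longrightarrow> \<exists>W. cmp_set W \<and> W \<subseteq> ball (\<gamma> s) (\<epsilon> / 2) \<and> (\<forall>t\<in>{0..1}. \<bar>t - s\<bar> \<le> h \<longrightarrow> ball (\<gamma> t) r \<subseteq> W)"
    using cmp_set_cover[OF cont] by metis
  obtain m :: nat where m: "3 / h \<le> real m" using real_arch_simple by blast
  define M where "M = m + 1"
  \<comment> \<open>With this form of \<open>N\<close> the window at the target has the middle index
    \<open>Suc M\<close>.\<close>
  define N where "N = Suc (Suc M)"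
  have "3 / h \<le> real N" using m by (simp add: N_def M_def)
  then have N: "3 \<le> N" "0 < N" "3 / real N \<le> h" using rh by (auto simp: N_def M_def field_simps)
  define t where "t i = real i / real N" for i
  define w where "w = bump N"
  have t0: "t 0 = 0" and tN: "t N = 1" and tS: "\<And>i. t (Suc i) = t i + 1 / real N"
    and tpos: "\<And>i. 0 \<le> t i" and tle: "\<And>i. i \<le> N \<Longrightarrow> t i \<le> 1"
    using N by (auto simp: t_def add_divide_distrib)
  have N1: "0 < 1 / real N" using N by simp
  have N3: "3 / real N = 1 / real N + 1 / real N + 1 / real N" by simp
  \<comment> \<open>Half the midpoint defect of the weight. The barriers are moved outwards by
    \<kappa>; averaging them gains \<open>2 * \<kappa>\<close>, which leaves \<kappa> as a margin
    inside the diamond.\<close>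
  define \<kappa> where "\<kappa> = 1 / (2 * real N ^ 3)"
  have \<kappa>2: "1 / real N ^ 3 = 2 * \<kappa>" by (simp add: \<kappa>_def)
  have "(2::real) ^ 2 \<le> real N ^ 2" using N by (intro power_mono) auto
  then have \<kappa>: "0 < \<kappa>" "8 * \<kappa> \<le> 1 / real N" using N(2) by (auto simp: \<kappa>_def field_simps power2_eq_square
    power3_eq_cube)
  have w4: "4 * w i \<le> 1 / real N" for i unfolding w_def by (rule bump_le[OF N(2)])
  have w0: "0 \<le> w i" if "i \<le> N" for i unfolding w_def by (rule bump_nonneg[OF that])
  have wc: "w j + w (Suc (Suc j)) = 2 * w (Suc j) - 4 * \<kappa>" for j
    using bump_concave[of N j] \<kappa>2 by (simp add: w_def)
  have wends: "w 0 = 0" "w N = 0" by (simp_all add: w_def)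
  define aL where "aL i = t i - w i - \<kappa>" for i
  define bU where "bU i = t i + w i + \<kappa>" for i
  have step: "t i + 1 / real N \<le> t k" if "i < k" for i k
  proof -
    have "t (Suc i) \<le> t k" unfolding t_def using that by (intro divide_right_mono) auto
    then show ?thesis using tS by simp
  qed
  have ba: "bU i < aL k" if "i < k" "k \<le> N" for i k
    using step[OF that(1)] w4[of i] w4[of k] \<kappa> N1 unfolding aL_def bU_def by linarith
  have aLpos: "0 < aL i" if "0 < i" "i \<le> N" for i
    using step[OF that(1)] t0 w4[of i] \<kappa> N1 unfolding aL_def by linarith
  have aLlt: "aL i < t i - w i" "t i - w i \<le> t i" "aL i < 1" if "i \<le> N" for i
    using w0[OF that] \<kappa> tle[OF that] unfolding aL_def by linarith+
  have bUlt: "bU i < 1" if "i < N" for i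
    using step[OF that] tN w4[of i] \<kappa> N1 unfolding bU_def by linarith
  have bUgt: "t i + w i < bU i" "t i \<le> t i + w i" "0 < bU i" if "i \<le> N" for i
    using w0[OF that] \<kappa> tpos[of i] unfolding bU_def by linarith+
  have "\<exists>W. cmp_set W \<and> W \<subseteq> ball (\<gamma> (t i)) (\<epsilon> / 2) \<and> (\<forall>u\<in>{0..1}. \<bar>u - t i\<bar> \<le> h \<longrightarrow> ball (\<gamma> u) r \<subseteq> W)"
    if "i \<le> N" for i
    using rh(3)[of "t i"] tpos[of i] tle[OF that] by auto
  then obtain W where W: "\<And>i. i \<le> N \<Longrightarrow> cmp_set (W i)" "\<And>i. i \<le> N \<Longrightarrow> W i \<subseteq> ball (\<gamma> (t i)) (\<epsilon> / 2)"
    "\<And>i u. \<lbrakk>i \<le> N; u \<in> {0..1}; \<bar>u - t i\<bar> \<le> h\<rbrakk> \<Longrightarrow> ball (\<gamma> u) r \<subseteq> W i" by metis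
  have \<gamma>W: "\<gamma> u \<in> W (Suc j)"
    if "Suc j < N" "0 \<le> u" "u \<le> 1" "t j - 1 / real N \<le> u" "u \<le> t (Suc (Suc j)) + 1 / real N" for j u
  proof -
    have "\<bar>u - t (Suc j)\<bar> \<le> h" using that tS[of j] tS[of "Suc j"] N(3) N1 N3 by linarith
    then have "ball (\<gamma> u) r \<subseteq> W (Suc j)" using W(3)[of "Suc j" u] that by auto
    then show ?thesis using rh(1) by (meson centre_in_ball subsetD)
  qed
  have \<gamma>pot: "potential X \<gamma> a b (\<lambda>t. L * t)"
    if "Suc j < N" "0 \<le> a" "b \<le> 1" "t j - 1 / real N \<le> a" "b \<le> t (Suc (Suc j)) + 1 / real N" for j a b
  proof (rule geod_cmp_set[OF W(1)[of "Suc j"] g])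
    show "\<gamma> ` {a..b} \<subseteq> W (Suc j)"
    proof
      fix x assume "x \<in> \<gamma> ` {a..b}"
      then obtain u where "a \<le> u" "u \<le> b" "x = \<gamma> u" by auto
      then show "x \<in> W (Suc j)" using \<gamma>W[OF that(1), of u] that by auto
    qed
  qed (use that in auto)
  have \<gamma>ch: "\<gamma> s \<lless> \<gamma> u" if "0 \<le> s" "s < u" "u \<le> 1" for s u using geod_lower(1)[OF g that] .
  have aLW: "\<gamma> (aL k) \<in> W (Suc j)" if "Suc j < N" "j \<le> k" "k \<le> Suc (Suc j)" "0 < k" for j k
  proof (rule \<gamma>W[OF that(1)])
    have "t j \<le> t k" "t k \<le> t (Suc (Suc j))" using that by (auto simp: t_def divide_right_mono)
    then show "t j - 1 / real N \<le> aL k" "aL k \<le> t (Suc (Suc j)) + 1 / real N"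
      using w4[of k] w0[of k] \<kappa> that N1 unfolding aL_def by linarith+
    show "0 \<le> aL k" "aL k \<le> 1" using aLpos[of k] aLlt[of k] that by auto
  qed
  have bUW: "\<gamma> (bU k) \<in> W (Suc j)" if "Suc j < N" "j \<le> k" "k \<le> Suc (Suc j)" "k < N" for j k
  proof (rule \<gamma>W[OF that(1)])
    have "t j \<le> t k" "t k \<le> t (Suc (Suc j))" using that by (auto simp: t_def divide_right_mono)
    then show "t j - 1 / real N \<le> bU k" "bU k \<le> t (Suc (Suc j)) + 1 / real N"
      using w4[of k] w0[of k] \<kappa> that N1 unfolding bU_def by linarith+
    show "0 \<le> bU k" "bU k \<le> 1" using bUgt[of k] bUlt[of k] that by auto
  qed
  have sN: "Suc 0 < N" "Suc M < N" "Suc (Suc M) = N" "0 < M" using N by (auto simp: N_def M_def)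
  have past: "\<exists>p\<in>W (Suc 0). p \<lless> \<gamma> 0 \<and> (\<exists>m1\<in>W (Suc 0). ratio p (\<gamma> (aL (Suc (Suc 0)))) (1/2) m1 \<and>
    \<gamma> (t (Suc 0) - w (Suc 0)) \<lless> m1)"
  proof -
    have t2: "t (Suc (Suc 0)) = 2 / real N" by (simp add: t_def)
    have mem: "\<gamma> 0 \<in> W (Suc 0)" "\<gamma> (aL (Suc (Suc 0))) \<in> W (Suc 0)" "\<gamma> (t (Suc 0) - w (Suc 0)) \<in> W (Suc 0)"
    proof -
      show "\<gamma> 0 \<in> W (Suc 0)" using t0 t2 N1 by (intro \<gamma>W[OF sN(1)]) simp_all
      show "\<gamma> (aL (Suc (Suc 0))) \<in> W (Suc 0)" by (rule aLW[OF sN(1)]) simp_all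
      show "\<gamma> (t (Suc 0) - w (Suc 0)) \<in> W (Suc 0)"
        using aLlt[of "Suc 0"] aLpos[of "Suc 0"] t0 tle[of "Suc 0"] tS[of "Suc 0"] N N1
        by (intro \<gamma>W[OF sN(1)]) linarith+
    qed
    have a2: "0 < aL (Suc (Suc 0))" "aL (Suc (Suc 0)) < 1" using aLpos[of "Suc (Suc 0)"]
      aLlt[of "Suc (Suc 0)"] N by auto
    \<comment> \<open>As the weight vanishes at index 0, the lower vertex at index 1 falls short of
      the midpoint of \<open>0\<close> and the barrier at index 2 by
      \<open>3 * \<kappa> / 2\<close>. So it divides that segment of \<gamma> in a ratio
      \<open>\<mu> < 1 / 2\<close>.\<close>
    have e2: "aL (Suc (Suc 0)) = 2 * (t (Suc 0) - w (Suc 0)) + 3 * \<kappa>"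
      using wc[of 0] wends tS[of 0] tS[of "Suc 0"] t0 by (simp add: aL_def)
    have t1: "0 < t (Suc 0) - w (Suc 0)" "t (Suc 0) - w (Suc 0) < aL (Suc (Suc 0))"
      using aLpos[of "Suc 0"] aLlt[of "Suc 0"] e2 \<kappa> N by auto
    define \<mu> where "\<mu> = (t (Suc 0) - w (Suc 0)) / aL (Suc (Suc 0))"
    have \<mu>: "0 < \<mu>" "\<mu> < 1 / 2" using t1 a2 e2 \<kappa> by (auto simp: \<mu>_def field_simps)
    have pot: "potential X \<gamma> 0 (aL (Suc (Suc 0))) (\<lambda>t. L * t)"
      using a2 t0 tS[of 0] tS[of "Suc 0"] w0[of "Suc (Suc 0)"] \<kappa> N N1 aLlt[of "Suc (Suc 0)"]
        by (intro \<gamma>pot[OF sN(1)]) auto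
    have yz: "\<gamma> 0 \<lless> \<gamma> (aL (Suc (Suc 0)))" using a2 by (intro \<gamma>ch) auto
    have W1: "cmp_set (W (Suc 0))" using W(1)[of "Suc 0"] N by simp
    have "0 < T (\<gamma> 0) (\<gamma> (aL (Suc (Suc 0))))" using cmp_set_ch[OF W1 mem(1,2)] yz by simp
    \<comment> \<open>The slack \<open>1 / 2 - \<mu>\<close> is the room in
      \<open>comparison_past_vertex\<close>: a point \<open>p\<close> before
      \<open>\<gamma> 0\<close> is admissible if it lengthens the side by less than this
      amount.\<close>
    then have "0 < (1 / 2 - \<mu>) * T (\<gamma> 0) (\<gamma> (aL (Suc (Suc 0)))) / 2" using \<mu> by simp
    then obtain p where p: "p \<in> W (Suc 0)" "p \<lless> \<gamma> 0"
      "T p (\<gamma> (aL (Suc (Suc 0)))) < T (\<gamma> 0) (\<gamma> (aL (Suc (Suc 0)))) + (1 / 2 - \<mu>) * T (\<gamma> 0) (\<gamma> (aL (Suc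
        (Suc 0)))) / 2"
      using tau_near_past[OF W1 mem(1,2)] by metis
    obtain m1 where m1: "m1 \<in> W (Suc 0)" "ratio p (\<gamma> (aL (Suc (Suc 0)))) (1/2) m1"
      using ratio_exists[OF W1 p(1) mem(2) chron_trans[OF p(2) yz], of "1/2"] by auto
    have "\<gamma> (t (Suc 0) - w (Suc 0)) \<lless> m1"
    proof (rule comparison_past_vertex[OF W1 p(1) mem(1,2) p(2) yz mem(3) m1(1) _ m1(2) \<mu>])
      show "ratio (\<gamma> 0) (\<gamma> (aL (Suc (Suc 0)))) \<mu> (\<gamma> (t (Suc 0) - w (Suc 0)))"
        using a2 \<mu> by (intro linear_ratio[OF pot]) (auto simp: \<mu>_def L)
    qed (use p(3) in auto)
    then show ?thesis using p m1 by blast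
  qed
  then obtain pm where pm: "pm \<in> W (Suc 0)" "pm \<lless> \<gamma> 0" "\<exists>m1\<in>W (Suc 0).
    ratio pm (\<gamma> (aL (Suc (Suc 0)))) (1/2) m1 \<and> \<gamma> (t (Suc 0) - w (Suc 0)) \<lless> m1"
    by blast
  have future: "\<exists>p\<in>W (Suc M). \<gamma> 1 \<lless> p \<and>
      (\<exists>m2\<in>W (Suc M). ratio (\<gamma> (bU M)) p (1/2) m2 \<and> m2 \<lless> \<gamma> (t (Suc M) + w (Suc M)))"
  proof -
    have tM: "t (Suc M) = t M + 1 / real N" "t M + 2 / real N = 1"
      using tS[of M] tS[of "Suc M"] tN sN(3) by auto
    have MN: "M \<le> N" by (simp add: N_def)
    have tSS: "t (Suc (Suc M)) = 1" using tN by (simp add: sN(3))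
    have tM1: "t M \<le> 1" by (rule tle[OF MN])
    have wM: "w M = 2 * w (Suc M) - 4 * \<kappa>" using wc[of M] wends sN(3) by simp
    have b: "0 < bU M" "bU M < 1" using bUgt[of M] bUlt[of M] sN by auto
    have u: "bU M < t (Suc M) + w (Suc M)" "t (Suc M) + w (Suc M) < 1"
      using ba[of M "Suc M"] aLlt[of "Suc M"] bUlt[of "Suc M"] bUgt[of "Suc M"] w0[of "Suc M"] sN by auto
    \<comment> \<open>The mirror image of the computation at the source: the upper vertex at index
      \<open>Suc M\<close> lies \<open>3 * \<kappa> / 2\<close> beyond the midpoint of
      \<open>bU M\<close> and \<open>1\<close>, whence \<open>1 / 2 < l\<close>.\<close>
    have e2: "1 - bU M = 2 * (1 - (t (Suc M) + w (Suc M))) + 3 * \<kappa>"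
    proof -
      have "t M = 1 - 2 / real N" using tM(2) by simp
      then show ?thesis by (simp add: bU_def wM tM(1))
    qed
    have bM: "t M \<le> bU M" using bUgt(1,2)[OF MN] by linarith
    have mem: "\<gamma> (bU M) \<in> W (Suc M)" "\<gamma> 1 \<in> W (Suc M)" "\<gamma> (t (Suc M) + w (Suc M)) \<in> W (Suc M)"
    proof -
      show "\<gamma> (bU M) \<in> W (Suc M)" using sN by (intro bUW) auto
      show "\<gamma> 1 \<in> W (Suc M)" by (rule \<gamma>W[OF sN(2)]) (use tSS tM1 N1 in linarith)+
      show "\<gamma> (t (Suc M) + w (Suc M)) \<in> W (Suc M)"
        by (rule \<gamma>W[OF sN(2)]) (use b u bM tSS N1 in linarith)+
    qed
    define l where "l = (t (Suc M) + w (Suc M) - bU M) / (1 - bU M)"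
    have l: "1 / 2 < l" "l < 1" using u e2 \<kappa> b by (auto simp: l_def field_simps)
    have pot: "potential X \<gamma> (bU M) 1 (\<lambda>t. L * t)"
      by (rule \<gamma>pot[OF sN(2)]) (use b bM tSS N1 in linarith)+
    have xy: "\<gamma> (bU M) \<lless> \<gamma> 1" using b by (intro \<gamma>ch) auto
    have W1: "cmp_set (W (Suc M))" using W(1)[of "Suc M"] sN by simp
    have "0 < T (\<gamma> (bU M)) (\<gamma> 1)" using cmp_set_ch[OF W1 mem(1,2)] xy by simp
    then have "0 < (l - 1 / 2) * T (\<gamma> (bU M)) (\<gamma> 1) / 2" using l by simp
    then obtain p where p: "p \<in> W (Suc M)" "\<gamma> 1 \<lless> p"
      "T (\<gamma> (bU M)) p < T (\<gamma> (bU M)) (\<gamma> 1) + (l - 1 / 2) * T (\<gamma> (bU M)) (\<gamma> 1) / 2"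
      using tau_near_future[OF W1 mem(1,2)] by metis
    obtain m2 where m2: "m2 \<in> W (Suc M)" "ratio (\<gamma> (bU M)) p (1/2) m2"
      using ratio_exists[OF W1 mem(1) p(1) chron_trans[OF xy p(2)], of "1/2"] by auto
    have "m2 \<lless> \<gamma> (t (Suc M) + w (Suc M))"
    proof (rule comparison_future_vertex[OF W1 mem(1,2) p(1) xy p(2) mem(3) m2(1) _ m2(2) _ l])
      show "ratio (\<gamma> (bU M)) (\<gamma> 1) l (\<gamma> (t (Suc M) + w (Suc M)))"
        using b l by (intro linear_ratio[OF pot]) (auto simp: l_def L)
    qed (use p(3) in auto)
    then show ?thesis using p m2 by blast
  qed
  then obtain qp where qp: "qp \<in> W (Suc M)" "\<gamma> 1 \<lless> qp"
    "\<exists>m2\<in>W (Suc M). ratio (\<gamma> (bU M)) qp (1/2) m2 \<and> m2 \<lless> \<gamma> (t (Suc M) + w (Suc M))" by blast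
  \<comment> \<open>Only the outermost barriers \<open>A 0\<close> and \<open>B N\<close> are not
    taken on \<gamma>.\<close>
  define A where "A i = (if i = 0 then pm else \<gamma> (aL i))" for i
  define B where "B i = (if i = N then qp else \<gamma> (bU i))" for i
  have AW: "A k \<in> W (Suc j)" and BW: "B k \<in> W (Suc j)" if "Suc j < N" "j \<le> k" "k \<le> Suc (Suc j)" for j k
  proof -
    show "A k \<in> W (Suc j)" using aLW[OF that] pm(1) that by (cases "k = 0") (auto simp: A_def)
    show "B k \<in> W (Suc j)"
    proof (cases "k = N")
      case True
      then have "j = M" using that sN(3) by simp
      then show ?thesis using True qp(1) by (simp add: B_def)
    next
      case False
      then have "k < N" using that by simp
      then show ?thesis using bUW[OF that] False by (simp add: B_def)
    qed
  qed
  have BA: "B i \<lless> A k" if "i < k" "k \<le> N" for i k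
    using ba[OF that] that bUgt[of i] aLlt[of k] \<gamma>ch[of "bU i" "aL k"] by (auto simp: A_def B_def)
  have Amid: "\<exists>m1\<in>W (Suc j). ratio (A j) (A (Suc (Suc j))) (1/2) m1 \<and> \<gamma> (t (Suc j) - w (Suc j)) \<lless> m1"
    if j: "Suc j < N" for j
  proof (cases "j = 0")
    case True
    then show ?thesis using pm(3) by (simp add: A_def)
  next
    case False
    define u where "u = (aL j + aL (Suc (Suc j))) / 2"
    have u: "u = t (Suc j) - w (Suc j) + \<kappa>" using wc[of j] tS[of j] tS[of "Suc j"]
      by (simp add: u_def aL_def)
    have o: "0 < aL j" "aL j < aL (Suc (Suc j))" "aL (Suc (Suc j)) < 1"
      using aLpos[of j] aLlt[of "Suc (Suc j)"] ba[of j "Suc (Suc j)"] aLlt[of j] bUgt[of j] j False by auto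
    have tj: "t j \<le> t (Suc (Suc j))" using tS N1 by simp
    have u01: "0 \<le> u" "u \<le> 1" using o by (auto simp: u_def)
    have pot: "potential X \<gamma> (aL j) (aL (Suc (Suc j))) (\<lambda>t. L * t)"
      using o w4[of j] w0[of "Suc (Suc j)"] \<kappa> N1 j
      by (intro \<gamma>pot[OF j]) (auto simp: aL_def)
    have "ratio (\<gamma> (aL j)) (\<gamma> (aL (Suc (Suc j)))) (1/2) (\<gamma> u)"
      using o by (intro linear_mid[OF pot]) (auto simp: u_def L)
    moreover have "\<gamma> (t (Suc j) - w (Suc j)) \<lless> \<gamma> u"
      using aLpos[of "Suc j"] aLlt[of "Suc j"] u01 \<kappa> j by (intro \<gamma>ch) (auto simp: u)
    moreover have "\<gamma> u \<in> W (Suc j)"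
      using u01 tS[of j] tS[of "Suc j"] w4[of "Suc j"] w0[of "Suc j"] \<kappa> N1 j by (intro \<gamma>W[OF j]) (auto
        simp: u)
    ultimately show ?thesis using False by (auto simp: A_def)
  qed
  have Bmid: "\<exists>m2\<in>W (Suc j). ratio (B j) (B (Suc (Suc j))) (1/2) m2 \<and> m2 \<lless> \<gamma> (t (Suc j) + w (Suc j))"
    if j: "Suc j < N" for j
  proof (cases "Suc (Suc j) = N")
    case True
    then have "j = M" "j \<noteq> N" using sN by auto
    then show ?thesis using qp(3) sN(3) by (simp add: B_def)
  next
    case False
    then have j2: "Suc (Suc j) < N" using j by simp
    define u where "u = (bU j + bU (Suc (Suc j))) / 2"
    have u: "u = t (Suc j) + w (Suc j) - \<kappa>" using wc[of j] tS[of j] tS[of "Suc j"]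
      by (simp add: u_def bU_def)
    have o: "0 < bU j" "bU j < bU (Suc (Suc j))" "bU (Suc (Suc j)) < 1"
      using bUgt[of j] bUlt[of "Suc (Suc j)"] ba[of j "Suc (Suc j)"] aLlt[of "Suc (Suc j)"]
        bUgt[of "Suc (Suc j)"] j2 by auto
    have u01: "0 \<le> u" "u \<le> 1" using o by (auto simp: u_def)
    have pot: "potential X \<gamma> (bU j) (bU (Suc (Suc j))) (\<lambda>t. L * t)"
      using o w4[of "Suc (Suc j)"] w0[of j] \<kappa> N1 j
      by (intro \<gamma>pot[OF j]) (auto simp: bU_def)
    have "ratio (\<gamma> (bU j)) (\<gamma> (bU (Suc (Suc j)))) (1/2) (\<gamma> u)"
      using o by (intro linear_mid[OF pot]) (auto simp: u_def L)
    moreover have "\<gamma> u \<lless> \<gamma> (t (Suc j) + w (Suc j))"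
      using bUgt[of "Suc j"] bUlt[of "Suc j"] u01 \<kappa> j by (intro \<gamma>ch) (auto simp: u)
    moreover have "\<gamma> u \<in> W (Suc j)"
      using u01 tS[of j] tS[of "Suc j"] w4[of "Suc j"] w0[of "Suc j"] \<kappa> N1 j by (intro \<gamma>W[OF j]) (auto
        simp: u)
    ultimately show ?thesis using False j by (auto simp: B_def)
  qed
  have "\<gamma> 0 \<lless> B 0" "A N \<lless> \<gamma> 1" using \<gamma>ch[of 0 "bU 0"] \<gamma>ch[of "aL N" 1] bUgt[of 0] bUlt[of 0] aLpos[of N]
    aLlt[of N] N
    by (auto simp: A_def B_def)
  \<comment> \<open>The prescribed endpoints may move as long as they stay strictly between the
    barriers of index 0 and of index \<open>N\<close>, an open condition.\<close>
  then have "\<gamma> 0 \<in> chron_diamond X pm (B 0)" "\<gamma> 1 \<in> chron_diamond X (A N) qp"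
    using pm qp by (auto simp: chron_diamond_def)
  then obtain d1 d2 where d: "0 < d1" "ball (\<gamma> 0) d1 \<subseteq> chron_diamond X pm (B 0)"
    "0 < d2" "ball (\<gamma> 1) d2 \<subseteq> chron_diamond X (A N) qp"
    using open_chron_diamond by (metis openE)
  show ?thesis
  proof (rule that[of "min d1 d2"])
    show "0 < min d1 d2" using d by simp
    fix p' q' assume "dist p' (\<gamma> 0) < min d1 d2" "dist q' (\<gamma> 1) < min d1 d2"
    then have "p' \<in> ball (\<gamma> 0) d1" "q' \<in> ball (\<gamma> 1) d2" by (auto simp: dist_commute)
    then have "p' \<in> chron_diamond X pm (B 0)" "q' \<in> chron_diamond X (A N) qp" using d by auto
    then have pq: "A 0 \<lless> p'" "p' \<lless> B 0" "A N \<lless> q'" "q' \<lless> B N" by (auto simp: chron_diamond_def A_def B_def)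
    \<comment> \<open>Singletons pin the chain to the prescribed endpoints; the indices beyond
      \<open>N\<close>, over which \<open>chain_max\<close> also ranges, get the singleton of
      \<open>q'\<close>.\<close>
    define K
      where "K i = (if i = 0 then {p'} else if i < N then causal_diamond X (\<gamma> (t i - w i)) (\<gamma> (t i + w
        i)) else {q'})" for i
    have KAB: "A i \<lless> x \<and> x \<lless> B i" if "i \<le> N" "x \<in> K i" for i x
    proof -
      consider "i = 0" | "i = N" | "0 < i" "i < N" using \<open>i \<le> N\<close> by linarith
      then show ?thesis
      proof cases
        case 3
        then have x: "\<gamma> (t i - w i) \<preceq> x" "x \<preceq> \<gamma> (t i + w i)" using that
          by (auto simp: K_def causal_diamond_def)
        have "A i \<lless> \<gamma> (t i - w i)"
          using aLpos[of i] aLlt[of i] tle[of i] 3 \<gamma>ch[of "aL i" "t i - w i"] by (auto simp: A_def)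
        moreover have "\<gamma> (t i + w i) \<lless> B i"
          using bUgt[of i] bUlt[of i] tpos[of i] 3 \<gamma>ch[of "t i + w i" "bU i"] by (auto simp: B_def)
        ultimately show ?thesis using x chron_causal_trans causal_chron_trans by blast
      qed (use that pq N in \<open>auto simp: K_def\<close>)
    qed
    have KW: "x \<in> W (Suc j)" if "Suc j < N" "j \<le> k" "k \<le> Suc (Suc j)" "x \<in> K k" for j k x
    proof -
      have "A k \<lless> x \<and> x \<lless> B k" using that by (intro KAB) auto
      then show ?thesis using cmp_set_convex[OF W(1) AW[OF that(1-3)] BW[OF that(1-3)]] that(1)
        chron_imp_causal by simp
    qed
    have Kch: "x \<lless> y" if "i < k" "k \<le> N" "x \<in> K i" "y \<in> K k" for i k x y
      using KAB[of i x] KAB[of k y] BA[OF that(1,2)] that chron_trans by (meson less_imp_le less_le_trans)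
    have Kmid: "\<exists>m\<in>K (Suc j). ratio x y (1/2) m"
      if j: "Suc j < N" and xy: "x \<in> K j" "y \<in> K (Suc (Suc j))" for j x y
    proof -
      have Wj: "cmp_set (W (Suc j))" using W(1) j by simp
      obtain m1 where m1: "m1 \<in> W (Suc j)" "ratio (A j) (A (Suc (Suc j))) (1/2) m1"
        "\<gamma> (t (Suc j) - w (Suc j)) \<lless> m1"
        using Amid[OF j] by blast
      obtain m2 where m2: "m2 \<in> W (Suc j)" "ratio (B j) (B (Suc (Suc j))) (1/2) m2"
        "m2 \<lless> \<gamma> (t (Suc j) + w (Suc j))"
        using Bmid[OF j] by blast
      have xA: "A j \<lless> x" "x \<lless> B j" and yA: "A (Suc (Suc j)) \<lless> y" "y \<lless> B (Suc (Suc j))"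
        using KAB[of j x] KAB[of "Suc (Suc j)" y] xy j by auto
      have jj: "j \<le> j" "j \<le> Suc (Suc j)" "Suc (Suc j) \<le> Suc (Suc j)" by auto
      obtain m where "m \<in> W (Suc j)" "ratio x y (1/2) m" "\<gamma> (t (Suc j) - w (Suc j)) \<lless> m"
        "m \<lless> \<gamma> (t (Suc j) + w (Suc j))"
      proof (rule ratio_half_between[OF Wj AW[OF j jj(1,2)] AW[OF j jj(2,3)] BW[OF j jj(1,2)]
        BW[OF j jj(2,3)]
            KW[OF j jj(1,2) xy(1)] KW[OF j jj(2,3) xy(2)] xA yA _ m1(1,2) m2(1,2) m1(3) m2(3)])
        show "B j \<lless> A (Suc (Suc j))" using j by (intro BA) auto
      qed
      then show ?thesis using j chron_imp_causal by (auto simp: K_def causal_diamond_def)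
    qed
    have Kcomp: "compact (K i)" for i using gh by (auto simp: K_def globally_hyperbolic_def)
    have Kne: "K i \<noteq> {}" for i
    proof -
      have "\<gamma> (t i - w i) \<preceq> \<gamma> (t i + w i)" if "0 < i" "i < N"
        using aLpos[of i] aLlt[of i] bUlt[of i] bUgt[of i] that by (intro geod_causal[OF g]) auto
      then show ?thesis by (auto simp: K_def causal_diamond_def intro!: exI[of _ "\<gamma> (t i - w i)"])
    qed
    have Kcont: "continuous_on (K i \<times> K (Suc i)) (\<lambda>(x, y). T x y)" if i: "i < N" for i
    proof -
      have "\<exists>j. Suc j < N \<and> j \<le> i \<and> Suc i \<le> Suc (Suc j)"
        using i N by (cases i) (auto intro: exI[of _ 0])
      then obtain j where j: "Suc j < N" "j \<le> i" "Suc i \<le> Suc (Suc j)" by blast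
      have "K i \<times> K (Suc i) \<subseteq> W (Suc j) \<times> W (Suc j)"
        using KW[OF j(1), of i] KW[OF j(1), of "Suc i"] j by auto
      moreover have "cmp_set (W (Suc j))" using W(1) j by simp
      ultimately show ?thesis using continuous_on_subset[OF cmp_set_cont] by blast
    qed
    obtain x where x: "\<And>i. x i \<in> K i"
      "\<And>y. (\<And>i. y i \<in> K i) \<Longrightarrow> (\<Sum>i<N. T (y i) (y (Suc i))) \<le> (\<Sum>i<N. T (x i) (x (Suc i)))"
      using chain_max[of K N, OF Kcomp Kne Kcont] by metis
    have xW: "x j \<in> W (Suc j) \<and> x (Suc j) \<in> W (Suc j) \<and> x (Suc (Suc j)) \<in> W (Suc j)" if "Suc j < N" for j
      using KW[OF that _ _ x(1)] by simp
    have xch: "x i \<lless> x (Suc i)" if "i < N" for i using Kch[of i "Suc i"] x(1) that by auto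
    have xadd: "T (x j) (x (Suc (Suc j))) = T (x j) (x (Suc j)) + T (x (Suc j)) (x (Suc (Suc j)))"
      if j: "Suc j < N" for j
    proof -
      obtain m where m: "m \<in> K (Suc j)" "ratio (x j) (x (Suc (Suc j))) (1/2) m"
        using Kmid[OF j x(1) x(1)] by blast
      have "T (x j) m + T m (x (Suc (Suc j))) \<le> T (x j) (x (Suc j)) + T (x (Suc j)) (x (Suc (Suc j)))"
        by (rule chain_max_local[OF x j m(1)])
      moreover have "T (x j) m + T m (x (Suc (Suc j))) = T (x j) (x (Suc (Suc j)))"
        using m(2) by (simp add: ratio_def)
      moreover have "T (x j) (x (Suc j)) + T (x (Suc j)) (x (Suc (Suc j))) \<le> T (x j) (x (Suc (Suc j)))"
        using xW[OF j] xch[of j] xch[of "Suc j"] j chron_imp_causal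
          by (intro cmp_set_rev_tri[OF W(1)[of "Suc j"]]) auto
      ultimately show ?thesis by linarith
    qed
    have N2: "2 \<le> N" using N by simp
    have W': "cmp_set (W (Suc j))" if "Suc j < N" for j using W(1) that by simp
    obtain \<sigma> where \<sigma>: "\<sigma> \<in> timelike_geodesics X" "\<sigma> 0 = x 0" "\<sigma> 1 = x N"
      "\<forall>j s. Suc j < N \<longrightarrow> real j / real N \<le> s \<longrightarrow> s \<le> real (Suc (Suc j)) / real N \<longrightarrow> \<sigma> s \<in> W (Suc j)"
      using chain_geodesic[of N W x, OF N2 W' xW xch xadd] by blast
    have "dist (\<sigma> s) (\<gamma> s) < \<epsilon>" if s: "s \<in> {0..1}" for s
    proof -
      have "\<exists>j. Suc j < N \<and> t j \<le> s \<and> s \<le> t (Suc (Suc j))"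
      proof (cases "s < 1")
        case False
        then have "s = 1" using s by simp
        then show ?thesis using sN tN tle[of M] by (intro exI[of _ M]) auto
      next
        case True
        define k where "k = nat \<lfloor>s * real N\<rfloor>"
        have "0 \<le> s * real N" using s by simp
        then have k: "real k \<le> s * real N" "s * real N < real (Suc k)" unfolding k_def by linarith+
        have "s * real N < 1 * real N" using True N by (intro mult_strict_right_mono) auto
        then have kN: "k < N" using k(1) by linarith
        have tk: "t k \<le> s" "s \<le> t (Suc k)" using k N by (auto simp: t_def field_simps)
        show ?thesis
        proof (cases k)
          case 0
          then show ?thesis using tk sN tS[of 1] tS[of 0] N1 by (intro exI[of _ 0]) auto
        next
          case (Suc j)
          then have "t j \<le> s" using tk(1) tS[of j] N1 unfolding Suc by linarith
          then show ?thesis using tk kN Suc by blast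
        qed
      qed
      then obtain j where j: "Suc j < N" "t j \<le> s" "s \<le> t (Suc (Suc j))" by blast
      have "\<sigma> s \<in> W (Suc j)" using \<sigma>(4) j by (simp add: t_def)
      moreover have "\<gamma> s \<in> W (Suc j)" using s j N1 unfolding atLeastAtMost_iff
        by (intro \<gamma>W[OF j(1)]) linarith+
      ultimately have "dist (\<gamma> (t (Suc j))) (\<sigma> s) < \<epsilon> / 2" "dist (\<gamma> (t (Suc j))) (\<gamma> s) < \<epsilon> / 2"
        using W(2)[of "Suc j"] j(1) by auto
      then show ?thesis using dist_triangle_half_r by blast
    qed
    moreover have "x 0 = p'" "x N = q'" using x(1)[of 0] x(1)[of N] N by (auto simp: K_def)
    ultimately show "\<exists>\<sigma>\<in>timelike_geodesics X. \<sigma> 0 = p' \<and> \<sigma> 1 = q' \<and> (\<forall>t\<in>{0..1}. dist (\<sigma> t) (\<gamma> t) < \<epsilon>)"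
      using \<sigma> by auto
  qed
qed

section \<open>Timelike families\<close>

lemma TGeo_rep:
  assumes "g \<in> TGeo X" shows "rep g \<in> g" "rep g \<in> timelike_geodesics X"
proof -
  obtain x where "x \<in> timelike_geodesics X" "g = reparam_rel X `` {x}"
    using assms unfolding TGeo_def by (rule quotientE)
  then have "x \<in> g" "g \<subseteq> timelike_geodesics X"
    using equiv_class_self[OF equiv_reparam_rel] by (auto simp: reparam_rel_def)
  then show "rep g \<in> g" unfolding rep_def by (metis someI)
  then show "rep g \<in> timelike_geodesics X" using \<open>g \<subseteq> timelike_geodesics X\<close> by blast
qed

lemma TGeo_class:
  assumes "\<sigma> \<in> timelike_geodesics X"
  shows "reparam_rel X `` {\<sigma>} \<in> TGeo X" "\<sigma> \<in> reparam_rel X `` {\<sigma>}"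
  using assms equiv_class_self[OF equiv_reparam_rel assms] by (auto simp: TGeo_def intro: quotientI)

lemma TGeo_eqI:
  assumes "g \<in> TGeo X" "h \<in> TGeo X" "reparam \<phi>" "\<And>t. t \<in> {0..1} \<Longrightarrow> rep h t = rep g (\<phi> t)"
  shows "g = h"
proof -
  have "(rep g, rep h) \<in> reparam_rel X"
    using assms TGeo_rep unfolding reparam_rel_def by blast
  then show ?thesis
    using quotient_eq_iff[OF equiv_reparam_rel, of g X h "rep g" "rep h"] assms TGeo_rep
    unfolding TGeo_def by blast
qed

lemma geod_cong:
  assumes "geod c e f" "\<And>t. t \<in> {0..1} \<Longrightarrow> f' t = f t" shows "geod c e f'"
proof -
  have "continuous_on {0..1} f' = continuous_on {0..1} f" using assms(2) by (intro continuous_on_cong) auto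
  then show ?thesis using assms by (auto simp: geod_def strict_mono_on_def)
qed

text \<open>The normalized curve is not claimed to be Lipschitz, hence not to be a member of
  \<open>g\<close>; it is tied to the class through a reparametrization of
  \<open>rep g\<close>.\<close>

lemma normalized_rep:
  assumes "g \<in> TGeo X"
  obtains \<gamma> \<phi> e L where "reparam \<phi>" "\<And>t. \<gamma> t = rep g (\<phi> t)" "geod \<gamma> e (\<lambda>t. L * t)" "len X g = ennreal L"
    "source g = \<gamma> 0" "target g = \<gamma> 1"
proof -
  obtain e f where f: "geod (rep g) e f" using timelike_geodesic_geod TGeo_rep[OF assms] by blast
  obtain \<phi> where \<phi>: "reparam \<phi>" "\<And>t. t \<in> {0..1} \<Longrightarrow> f (\<phi> t) = f 1 * t" using geod_normalize[OF f] by metis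
  obtain e' where e': "geod (rep g \<circ> \<phi>) e' (f \<circ> \<phi>)" using geod_reparam[OF f \<phi>(1)] by blast
  show ?thesis
  proof (rule that[of \<phi> "rep g \<circ> \<phi>" e' "f 1"])
    show "geod (rep g \<circ> \<phi>) e' (\<lambda>t. f 1 * t)"
      using geod_cong[OF e'] \<phi>(2) by simp
    show "len X g = ennreal (f 1)" unfolding len_def by (rule geod_tau_length[OF f])
  qed (use \<phi> in \<open>auto simp: source_def target_def reparam_endpoints\<close>)
qed

end

section \<open>The Frechet distance of continuous curves\<close>

lemma frechet_bdd_above:
  fixes c d :: "real \<Rightarrow> 'a::metric_space"
  assumes c: "continuous_on {0..1} c" "continuous_on {0..1} d" and r: "reparam \<phi>" "reparam \<psi>"
  shows "bdd_above ((\<lambda>t. dist (c (\<phi> t)) (d (\<psi> t))) ` {0..1})"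
proof -
  have "continuous_on {0..1} (\<lambda>t. c (\<phi> t))" "continuous_on {0..1} (\<lambda>t. d (\<psi> t))"
    using reparam_continuous[OF r(1)] reparam_continuous[OF r(2)] reparam_mem[OF r(1)] reparam_mem[OF r(2)]
    by (auto intro!: continuous_on_compose2[OF c(1)] continuous_on_compose2[OF c(2)])
  then have "compact ((\<lambda>t. dist (c (\<phi> t)) (d (\<psi> t))) ` {0..1})"
    by (intro compact_continuous_image continuous_on_dist) auto
  then show ?thesis by (intro bounded_imp_bdd_above compact_imp_bounded)
qed

lemma frechet_bdd_below:
  fixes c d :: "real \<Rightarrow> 'a::metric_space"
  assumes c: "continuous_on {0..1} c" "continuous_on {0..1} d"
  shows "bdd_below ((\<lambda>(\<phi>, \<psi>). SUP t\<in>{0..1}.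
    dist (c (\<phi> t)) (d (\<psi> t))) ` (Collect reparam \<times> Collect reparam))"
proof (rule bdd_belowI2[of _ 0], clarify)
  fix \<phi> \<psi> assume r: "reparam \<phi>" "reparam \<psi>"
  show "0 \<le> (SUP t\<in>{0..1}. dist (c (\<phi> t)) (d (\<psi> t)))"
    by (rule cSUP_upper2[OF frechet_bdd_above[OF c r], of 0]) auto
qed

lemma frechet_dist_lessD:
  fixes c d :: "real \<Rightarrow> 'a::metric_space"
  assumes c: "continuous_on {0..1} c" "continuous_on {0..1} d" and less: "frechet_dist c d < e"
  obtains \<phi> \<psi> where "reparam \<phi>" "reparam \<psi>" "\<And>t. t \<in> {0..1} \<Longrightarrow> dist (c (\<phi> t)) (d (\<psi> t)) < e"
proof -
  have ne: "Collect reparam \<times> Collect reparam \<noteq> {}" using reparam_id by auto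
  have "\<exists>x\<in>Collect reparam \<times> Collect reparam. (\<lambda>(\<phi>, \<psi>). SUP t\<in>{0..1}. dist (c (\<phi> t)) (d (\<psi> t))) x < e"
    using less cINF_less_iff[OF ne frechet_bdd_below[OF c]] unfolding frechet_dist_def by blast
  then obtain \<phi> \<psi> where r: "reparam \<phi>" "reparam \<psi>" "(SUP t\<in>{0..1}. dist (c (\<phi> t)) (d (\<psi> t))) < e"
    by auto
  have "dist (c (\<phi> t)) (d (\<psi> t)) < e" if "t \<in> {0..1}" for t
    using cSUP_upper[OF that frechet_bdd_above[OF c r(1,2)]] r(3) by simp
  then show ?thesis using that r by blast
qed

lemma frechet_dist_le:
  fixes c d :: "real \<Rightarrow> 'a::metric_space"
  assumes c: "continuous_on {0..1} c" "continuous_on {0..1} d"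
    and le: "\<And>t. t \<in> {0..1} \<Longrightarrow> dist (c t) (d t) \<le> e"
  shows "frechet_dist c d \<le> e"
proof -
  have "frechet_dist c d \<le> (case (\<lambda>t. t, \<lambda>t. t) of (\<phi>, \<psi>) \<Rightarrow> SUP t\<in>{0..1}. dist (c (\<phi> t)) (d (\<psi> t)))"
    unfolding frechet_dist_def by (rule cINF_lower[OF frechet_bdd_below[OF c]]) (simp add: reparam_id)
  also have "\<dots> = (SUP t\<in>{0..1}. dist (c t) (d t))" by simp
  also have "\<dots> \<le> e" using le by (intro cSUP_least) auto
  finally show ?thesis .
qed

context curved_space begin

lemma TGeo_continuous: "g \<in> TGeo X \<Longrightarrow> continuous_on {0..1} (rep g)"
  using TGeo_rep timelike_curve_cont by (auto simp: timelike_geodesics_def)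

lemma d_Gamma_less_d_F:
  assumes "d_Gamma X h g < ereal e" shows "d_F h g < e"
proof -
  have "ereal (d_F h g) + 0 \<le> d_Gamma X h g" unfolding d_Gamma_def by (intro add_left_mono) simp
  then have "ereal (d_F h g) + 0 < ereal e" using assms by (rule le_less_trans)
  then show ?thesis by simp
qed

text \<open>A small Frechet distance provides one reparametrization for each curve. Undoing that of
  \<open>rep g\<close> and following the one that leads to \<gamma> makes a reparametrized
  \<open>h\<close> pointwise close to \<gamma>; the subsequent normalization is harmless by
  \<open>normalized_close\<close>.\<close>

lemma nearby_normalized:
  assumes g: "g \<in> TGeo X" and \<gamma>: "reparam \<phi>\<^sub>0" "\<And>t. \<gamma> t = rep g (\<phi>\<^sub>0 t)" "geod \<gamma> e0 (\<lambda>t. L * t)"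
    and eps: "0 < \<epsilon>"
  obtains d where "0 < d"
    "\<And>h. h \<in> TGeo X \<Longrightarrow> d_Gamma X h g < ereal d \<Longrightarrow>
       \<exists>\<omega> e A. reparam \<omega> \<and> geod (rep h \<circ> \<omega>) e (\<lambda>t. A * t) \<and> (\<forall>t\<in>{0..1}. dist (rep h (\<omega> t)) (\<gamma> t) < \<epsilon>)"
proof -
  obtain d where d: "0 < d"
    "\<And>c e f \<phi> t. \<lbrakk>geod c e f; (\<And>t. t \<in> {0..1} \<Longrightarrow> dist (c t) (\<gamma> t) < d); reparam \<phi>; (\<And>t. t \<in> {0..1} \<Longrightarrow>
      f (\<phi> t) = f 1 * t); t \<in> {0..1}\<rbrakk> \<Longrightarrow> dist (c (\<phi> t)) (\<gamma> t) < \<epsilon>"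
    using normalized_close[OF \<gamma>(3) eps] by blast
  show ?thesis
  proof (rule that[OF d(1)])
    fix h assume h: "h \<in> TGeo X" "d_Gamma X h g < ereal d"
    have "frechet_dist (rep h) (rep g) < d" using d_Gamma_less_d_F[OF h(2)] by (simp add: d_F_def)
    then obtain \<phi> \<psi> where r: "reparam \<phi>" "reparam \<psi>" "\<And>t. t \<in> {0..1} \<Longrightarrow> dist (rep h (\<phi> t)) (rep g (\<psi> t)) < d"
      using frechet_dist_lessD[OF TGeo_continuous[OF h(1)] TGeo_continuous[OF g]] by metis
    obtain \<psi>' where \<psi>': "reparam \<psi>'" "\<And>t. t \<in> {0..1} \<Longrightarrow> \<psi> (\<psi>' t) = t" using reparam_inverse[OF r(2)] by metis
    define \<alpha> where "\<alpha> t = \<phi> (\<psi>' (\<phi>\<^sub>0 t))" for t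
    have \<alpha>: "reparam \<alpha>" unfolding \<alpha>_def
      by (intro reparam_comp[OF r(1)] reparam_comp[OF \<psi>'(1) \<gamma>(1)])
    have close: "dist ((rep h \<circ> \<alpha>) t) (\<gamma> t) < d" if t: "t \<in> {0..1}" for t
    proof -
      have 1: "\<phi>\<^sub>0 t \<in> {0..1}" by (rule reparam_mem[OF \<gamma>(1) t])
      then have "\<psi>' (\<phi>\<^sub>0 t) \<in> {0..1}" by (rule reparam_mem[OF \<psi>'(1)])
      from r(3)[OF this] show ?thesis by (simp add: \<alpha>_def \<gamma>(2) \<psi>'(2)[OF 1])
    qed
    obtain e f where f: "geod (rep h) e f" using timelike_geodesic_geod TGeo_rep[OF h(1)] by blast
    obtain e' where f': "geod (rep h \<circ> \<alpha>) e' (f \<circ> \<alpha>)" using geod_reparam[OF f \<alpha>] by blast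
    obtain \<beta> where \<beta>: "reparam \<beta>" "\<And>t. t \<in> {0..1} \<Longrightarrow> (f \<circ> \<alpha>) (\<beta> t) = (f \<circ> \<alpha>) 1 * t"
      using geod_normalize[OF f'] by metis
    obtain e'' where f'': "geod (rep h \<circ> \<alpha> \<circ> \<beta>) e'' (f \<circ> \<alpha> \<circ> \<beta>)" using geod_reparam[OF f' \<beta>(1)] by blast
    have "geod (rep h \<circ> (\<lambda>t. \<alpha> (\<beta> t))) e'' (\<lambda>t. (f \<circ> \<alpha>) 1 * t)"
      using geod_cong[OF f''] \<beta>(2) by (simp add: comp_def)
    moreover have "dist (rep h (\<alpha> (\<beta> t))) (\<gamma> t) < \<epsilon>" if "t \<in> {0..1}" for t
      using d(2)[OF f' close \<beta>(1) \<beta>(2) that] by simp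
    ultimately show "\<exists>\<omega> e A. reparam \<omega> \<and> geod (rep h \<circ> \<omega>) e (\<lambda>t. A * t) \<and>
        (\<forall>t\<in>{0..1}. dist (rep h (\<omega> t)) (\<gamma> t) < \<epsilon>)"
      using reparam_comp[OF \<alpha> \<beta>(1)] by blast
  qed
qed

text \<open>Closeness of classes becomes pointwise closeness of normalized curves, which coincide by
  \<open>nearby_unique\<close>. The representatives then differ by \<alpha> composed with the
  inverse of \<beta>.\<close>

lemma TGeo_unique_near:
  assumes g: "g \<in> TGeo X"
  obtains d where "0 < d"
    "\<And>h h'.
      \<lbrakk>h \<in> TGeo X; h' \<in> TGeo X; d_Gamma X h g < ereal d; d_Gamma X h' g < ereal d; source h = source h';
        target h = target h'\<rbrakk> \<Longrightarrow> h = h'"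
proof -
  obtain \<gamma> \<phi> e0 L where \<gamma>: "reparam \<phi>" "\<And>t. \<gamma> t = rep g (\<phi> t)" "geod \<gamma> e0 (\<lambda>t. L * t)"
    using normalized_rep[OF g] by metis
  obtain \<epsilon> where \<epsilon>: "0 < \<epsilon>"
    "\<And>\<sigma> \<rho> e1 e2 A B t. \<lbrakk>geod \<sigma> e1 (\<lambda>t. A * t); geod \<rho> e2 (\<lambda>t. B * t); (\<And>t. t \<in> {0..1} \<Longrightarrow>
      dist (\<sigma> t) (\<gamma> t) < \<epsilon>); (\<And>t. t \<in> {0..1} \<Longrightarrow> dist (\<rho> t) (\<gamma> t) < \<epsilon>); \<sigma> 0 = \<rho> 0; \<sigma> 1 = \<rho> 1; t \<in> {0..1}\<rbrakk>
        \<Longrightarrow> \<sigma> t = \<rho> t"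
    using nearby_unique[OF \<gamma>(3)] by blast
  obtain d where d: "0 < d"
    "\<And>h. h \<in> TGeo X \<Longrightarrow> d_Gamma X h g < ereal d \<Longrightarrow>
       \<exists>\<omega> e A. reparam \<omega> \<and> geod (rep h \<circ> \<omega>) e (\<lambda>t. A * t) \<and> (\<forall>t\<in>{0..1}. dist (rep h (\<omega> t)) (\<gamma> t) < \<epsilon>)"
    using nearby_normalized[OF g \<gamma> \<epsilon>(1)] by blast
  show ?thesis
  proof (rule that[OF d(1)])
    fix h h' assume h: "h \<in> TGeo X" "h' \<in> TGeo X" "d_Gamma X h g < ereal d" "d_Gamma X h' g < ereal d"
      "source h = source h'" "target h = target h'"
    obtain \<alpha> e1 A where \<alpha>: "reparam \<alpha>" "geod (rep h \<circ> \<alpha>) e1 (\<lambda>t. A * t)" "\<And>t. t \<in> {0..1} \<Longrightarrow>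
      dist ((rep h \<circ> \<alpha>) t) (\<gamma> t) < \<epsilon>"
      using d(2)[OF h(1,3)] by auto
    obtain \<beta> e2 B where \<beta>: "reparam \<beta>" "geod (rep h' \<circ> \<beta>) e2 (\<lambda>t. B * t)" "\<And>t. t \<in> {0..1} \<Longrightarrow>
      dist ((rep h' \<circ> \<beta>) t) (\<gamma> t) < \<epsilon>"
      using d(2)[OF h(2,4)] by auto
    have ends: "(rep h \<circ> \<alpha>) 0 = (rep h' \<circ> \<beta>) 0" "(rep h \<circ> \<alpha>) 1 = (rep h' \<circ> \<beta>) 1"
      using h(5,6) by (simp_all add: reparam_endpoints \<alpha>(1) \<beta>(1) source_def target_def)
    have eq: "(rep h \<circ> \<alpha>) t = (rep h' \<circ> \<beta>) t" if "t \<in> {0..1}" for t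
      by (rule \<epsilon>(2)[OF \<alpha>(2) \<beta>(2) _ _ ends that]) (fact \<alpha>(3) \<beta>(3))+
    obtain \<beta>' where \<beta>': "reparam \<beta>'" "\<And>t. t \<in> {0..1} \<Longrightarrow> \<beta> (\<beta>' t) = t" using reparam_inverse[OF \<beta>(1)] by metis
    show "h = h'"
    proof (rule TGeo_eqI[OF h(1,2) reparam_comp[OF \<alpha>(1) \<beta>'(1)]])
      fix t :: real assume t: "t \<in> {0..1}"
      show "rep h' t = rep h (\<alpha> (\<beta>' t))"
        using eq[OF reparam_mem[OF \<beta>'(1) t]] \<beta>'(2)[OF t] by simp
    qed
  qed
qed

text \<open>Besides the pointwise estimate the lengths must be close, which is
  \<open>arclength_close\<close> at parameter \<open>1\<close>. Each of the two terms of
  \<open>d_Gamma\<close> is at most \<open>e / 3\<close>.\<close>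

lemma TGeo_exists_near:
  assumes g: "g \<in> TGeo X" and e: "0 < e"
  obtains \<delta> where "0 < \<delta>"
    "\<And>p' q'. dist p' (source g) < \<delta> \<Longrightarrow> dist q' (target g) < \<delta> \<Longrightarrow>
       \<exists>h\<in>TGeo X. source h = p' \<and> target h = q' \<and> d_Gamma X h g < ereal e"
proof -
  obtain \<gamma> \<phi> e0 L where \<gamma>: "reparam \<phi>" "\<And>t. \<gamma> t = rep g (\<phi> t)" "geod \<gamma> e0 (\<lambda>t. L * t)"
    and len: "len X g = ennreal L" and ends: "source g = \<gamma> 0" "target g = \<gamma> 1"
    using normalized_rep[OF g] by metis
  have e3: "0 < e / 3" using e by simp
  obtain d where d: "0 < d"
    "\<And>c e' f t. \<lbrakk>geod c e' f; (\<And>t. t \<in> {0..1} \<Longrightarrow> dist (c t) (\<gamma> t) < d); t \<in> {0..1}\<rbrakk> \<Longrightarrow> \<bar>f t - L * t\<bar> \<le> e / 3"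
    using arclength_close[OF \<gamma>(3) e3] by blast
  have "0 < min d (e / 3)" using d e by simp
  then obtain \<delta> where \<delta>: "0 < \<delta>"
    "\<And>p' q'. dist p' (\<gamma> 0) < \<delta> \<Longrightarrow> dist q' (\<gamma> 1) < \<delta> \<Longrightarrow>
       \<exists>\<sigma>\<in>timelike_geodesics X. \<sigma> 0 = p' \<and> \<sigma> 1 = q' \<and> (\<forall>t\<in>{0..1}. dist (\<sigma> t) (\<gamma> t) < min d (e / 3))"
    using nearby_geodesic[OF \<gamma>(3)] by metis
  show ?thesis
  proof (rule that[OF \<delta>(1)])
    fix p' q' assume "dist p' (source g) < \<delta>" "dist q' (target g) < \<delta>"
    then obtain \<sigma> where \<sigma>: "\<sigma> \<in> timelike_geodesics X" "\<sigma> 0 = p'" "\<sigma> 1 = q'"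
      "\<And>t. t \<in> {0..1} \<Longrightarrow> dist (\<sigma> t) (\<gamma> t) < min d (e / 3)"
      using \<delta>(2) unfolding ends by blast
    let ?h = "reparam_rel X `` {\<sigma>}"
    note h = TGeo_class[OF \<sigma>(1)]
    obtain e1 f where f: "geod \<sigma> e1 f" using timelike_geodesic_geod[OF \<sigma>(1)] by blast
    have f1: "0 < f 1" "0 < L" using geod_total[OF f] geod_total[OF \<gamma>(3)] by auto
    have "len X ?h = ennreal (f 1)" using len_class[OF h] geod_tau_length[OF f] by simp
    moreover have "\<bar>f 1 - L\<bar> \<le> e / 3" using d(2)[OF f, of 1] \<sigma>(4) by simp
    moreover have "d_F ?h g \<le> e / 3"
    proof -
      have "d_F ?h g = frechet_dist \<sigma> (rep g)" by (rule d_F_class[OF h g TGeo_rep(1)[OF g]])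
      also have "\<dots> = frechet_dist \<sigma> \<gamma>"
        by (rule frechet_dist_reparam[of "\<lambda>t. t" \<sigma> \<sigma> \<phi> \<gamma> "rep g", symmetric])
          (simp_all add: reparam_id \<gamma>(1,2))
      also have "\<dots> \<le> e / 3"
        using f \<gamma>(3) \<sigma>(4) by (intro frechet_dist_le) (auto simp: geod_def less_imp_le)
      finally show ?thesis .
    qed
    ultimately have "d_Gamma X ?h g < ereal e"
      using f1 e len by (simp add: d_Gamma_def enn2ereal_ennreal)
    moreover have "source ?h = p'" "target ?h = q'" using source_class[OF h] target_class[OF h] \<sigma>(2,3)
      by auto
    ultimately show "\<exists>h\<in>TGeo X. source h = p' \<and> target h = q' \<and> d_Gamma X h g < ereal e" using h(1) by blast
  qed
qed

lemma d_Gamma_self: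
  assumes g: "g \<in> TGeo X" and e: "0 < e" shows "d_Gamma X g g < ereal e"
proof -
  obtain L where L: "len X g = ennreal L" using normalized_rep[OF g] by metis
  have "d_F g g \<le> 0" unfolding d_F_def using TGeo_continuous[OF g] by (intro frechet_dist_le) auto
  then have "ereal (d_F g g) < ereal e" using e by simp
  then show ?thesis by (cases "0 \<le> L") (simp_all add: d_Gamma_def L enn2ereal_ennreal ennreal_neg
    zero_ennreal.rep_eq)
qed

section \<open>The family, its continuity and its uniqueness\<close>

lemma source_chron_target:
  assumes "g \<in> TGeo X" shows "source g \<lless> target g"
  using TGeo_rep(2)[OF assms] by (simp add: timelike_geodesics_def timelike_curve_iff source_def target_def)

text \<open>The radius \<open>e0\<close> of uniqueness selects \<open>F\<close>: the only class
  within \<open>e0\<close> of \<open>g\<close> that has the given endpoints. Closer endpoints admit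
  a closer class, which must be the selected one; this is continuity. A second continuous family
  enters the same \<open>e0\<close>-ball near the endpoints and so agrees with
  \<open>F\<close>.\<close>

lemma family_exists:
  assumes g: "g \<in> TGeo X"
  shows "\<exists>U V F. timelike_family X g U V F \<and> family_continuous_at X g U V F \<and>
    unique_continuous_family X g U V F"
proof -
  let ?p = "source g" and ?q = "target g"
  obtain e0 where e0: "0 < e0"
    "\<And>h h'.
      \<lbrakk>h \<in> TGeo X; h' \<in> TGeo X; d_Gamma X h g < ereal e0; d_Gamma X h' g < ereal e0; source h = source
        h'; target h = target h'\<rbrakk> \<Longrightarrow> h = h'"
    using TGeo_unique_near[OF g] by blast
  obtain \<delta>0 where \<delta>0: "0 < \<delta>0"
    "\<And>p' q'. dist p' ?p < \<delta>0 \<Longrightarrow> dist q' ?q < \<delta>0 \<Longrightarrow>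
       \<exists>h\<in>TGeo X. source h = p' \<and> target h = q' \<and> d_Gamma X h g < ereal e0"
    using TGeo_exists_near[OF g e0(1)] by blast
  obtain \<delta>1 where \<delta>1: "0 < \<delta>1" "\<And>x y. dist x ?p < \<delta>1 \<Longrightarrow> dist y ?q < \<delta>1 \<Longrightarrow> x \<lless> y"
    using chron_nbhd[OF source_chron_target[OF g]] by blast
  define r where "r = min \<delta>0 \<delta>1"
  define F where "F x = (SOME h. h \<in> TGeo X \<and> source h = fst x \<and> target h = snd x \<and>
    d_Gamma X h g < ereal e0)" for x
  have r: "0 < r" using \<delta>0 \<delta>1 by (simp add: r_def)
  have F: "F (p', q') \<in> TGeo X" "source (F (p', q')) = p'" "target (F (p', q')) = q'"
    "d_Gamma X (F (p', q')) g < ereal e0"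
    if "p' \<in> ball ?p r" "q' \<in> ball ?q r" for p' q'
  proof -
    have "\<exists>h. h \<in> TGeo X \<and> source h = fst (p', q') \<and> target h = snd (p', q') \<and> d_Gamma X h g < ereal e0"
      using \<delta>0(2)[of p' q'] that by (auto simp: r_def dist_commute)
    then have "F (p', q') \<in> TGeo X \<and> source (F (p', q')) = fst (p', q') \<and>
      target (F (p', q')) = snd (p', q') \<and> d_Gamma X (F (p', q')) g < ereal e0"
      unfolding F_def by (rule someI_ex)
    then show "F (p', q') \<in> TGeo X" "source (F (p', q')) = p'" "target (F (p', q')) = q'"
      "d_Gamma X (F (p', q')) g < ereal e0"
      by simp_all
  qed
  have F_unique: "h = F (p', q')"
    if "p' \<in> ball ?p r" "q' \<in> ball ?q r" "h \<in> TGeo X" "source h = p'" "target h = q'"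
      "d_Gamma X h g < ereal e0" for p' q' h
    using e0(2)[OF that(3) F(1)[OF that(1,2)] that(6) F(4)[OF that(1,2)]] F(2,3)[OF that(1,2)] that(4,5)
      by simp
  have pq: "?p \<in> ball ?p r" "?q \<in> ball ?q r" using r by auto
  have "timelike_family X g (ball ?p r) (ball ?q r) F"
    unfolding timelike_family_def
  proof (intro conjI ballI)
    show "?p \<in> interior (ball ?p r)" "?q \<in> interior (ball ?q r)" using pq by simp_all
    show "F (?p, ?q) = g" using F_unique[OF pq g refl refl d_Gamma_self[OF g e0(1)]] by simp
    fix p' q' assume m: "p' \<in> ball ?p r" "q' \<in> ball ?q r"
    show "p' \<lless> q'" using \<delta>1(2)[of p' q'] m by (simp add: r_def dist_commute)
    show "F (p', q') \<in> TGeo X" "source (F (p', q')) = p'" "target (F (p', q')) = q'" using F[OF m]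
      by simp_all
  qed
  moreover have "family_continuous_at X g (ball ?p r) (ball ?q r) F"
    unfolding family_continuous_at_def
  proof (intro allI impI)
    fix e :: real assume "0 < e"
    then have "0 < min e e0" using e0(1) by simp
    then obtain \<delta> where \<delta>: "0 < \<delta>"
      "\<And>p' q'. dist p' ?p < \<delta> \<Longrightarrow> dist q' ?q < \<delta> \<Longrightarrow>
         \<exists>h\<in>TGeo X. source h = p' \<and> target h = q' \<and> d_Gamma X h g < ereal (min e e0)"
      using TGeo_exists_near[OF g] by metis
    have "d_Gamma X (F (p', q')) g < ereal e"
      if m: "p' \<in> ball ?p r" "q' \<in> ball ?q r" and dd: "dist p' ?p < \<delta>" "dist q' ?q < \<delta>" for p' q'
    proof -
      obtain h where h: "h \<in> TGeo X" "source h = p'" "target h = q'" "d_Gamma X h g < ereal (min e e0)"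
        using \<delta>(2)[OF dd] by blast
      have "ereal (min e e0) \<le> ereal e0" "ereal (min e e0) \<le> ereal e" by simp_all
      then have "d_Gamma X h g < ereal e0" "d_Gamma X h g < ereal e" using h(4) by (metis less_le_trans)+
      then show ?thesis using F_unique[OF m h(1-3)] by simp
    qed
    then show "\<exists>\<delta>>0. \<forall>p'\<in>ball ?p r. \<forall>q'\<in>ball ?q r. dist p' ?p < \<delta> \<longrightarrow> dist q' ?q < \<delta> \<longrightarrow>
        d_Gamma X (F (p', q')) g < ereal e" using \<delta>(1) by blast
  qed
  moreover have "unique_continuous_family X g (ball ?p r) (ball ?q r) F"
    unfolding unique_continuous_family_def
  proof (intro allI impI)
    fix U' V' F' assume F': "timelike_family X g U' V' F'" "family_continuous_at X g U' V' F'"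
    obtain \<delta> where \<delta>: "0 < \<delta>" "\<And>p' q'. \<lbrakk>p' \<in> U'; q' \<in> V'; dist p' ?p < \<delta>; dist q' ?q < \<delta>\<rbrakk> \<Longrightarrow>
      d_Gamma X (F' (p', q')) g < ereal e0"
      using F'(2) e0(1) unfolding family_continuous_at_def by blast
    let ?U = "ball ?p r \<inter> U' \<inter> ball ?p \<delta>" and ?V = "ball ?q r \<inter> V' \<inter> ball ?q \<delta>"
    have "?p \<in> interior ?U" "?q \<in> interior ?V"
      using F'(1) r \<delta>(1) by (simp_all add: timelike_family_def interior_Int)
    moreover have "F (p', q') = F' (p', q')" if m: "p' \<in> ?U" "q' \<in> ?V" for p' q'
    proof -
      have "F' (p', q') \<in> TGeo X" "source (F' (p', q')) = p'" "target (F' (p', q')) = q'"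
        using F'(1) m by (auto simp: timelike_family_def)
      moreover have "d_Gamma X (F' (p', q')) g < ereal e0" using m by (intro \<delta>(2)) (auto simp: dist_commute)
      ultimately show ?thesis using F_unique[of p' q'] m by auto
    qed
    ultimately show "\<exists>U'' V''. U'' \<subseteq> ball ?p r \<inter> U' \<and> V'' \<subseteq> ball ?q r \<inter> V' \<and> ?p \<in> interior U'' \<and>
        ?q \<in> interior V'' \<and> (\<forall>p'\<in>U''. \<forall>q'\<in>V''. F (p', q') = F' (p', q'))"
      by (intro exI[of _ ?U] exI[of _ ?V] conjI) blast+
  qed
  ultimately show ?thesis by blast
qed

text \<open>Both sequences eventually enter the ball of uniqueness around \<open>g\<close>, where
  equal endpoints force equal classes.\<close>

lemma not_symmetrically_conjugate:
  assumes g: "g \<in> TGeo X" shows "\<not> symmetrically_conjugate_along X g"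
proof
  assume "symmetrically_conjugate_along X g"
  then obtain P Q G S where GS: "\<And>i::nat. G i \<in> TGeo X \<and> S i \<in> TGeo X \<and> G i \<noteq> S i \<and>
           source (G i) = P i \<and> target (G i) = Q i \<and> source (S i) = P i \<and> target (S i) = Q i"
    and lim: "(\<lambda>i. d_Gamma X (G i) g) \<longlonglongrightarrow> 0" "(\<lambda>i. d_Gamma X (S i) g) \<longlonglongrightarrow> 0"
    unfolding symmetrically_conjugate_along_def by blast
  obtain e0 where e0: "0 < e0"
    "\<And>h h'.
      \<lbrakk>h \<in> TGeo X; h' \<in> TGeo X; d_Gamma X h g < ereal e0; d_Gamma X h' g < ereal e0; source h = source
        h'; target h = target h'\<rbrakk> \<Longrightarrow> h = h'"
    using TGeo_unique_near[OF g] by blast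
  have "(0::ereal) < ereal e0" using e0(1) by simp
  then have "\<forall>\<^sub>F i in sequentially. d_Gamma X (G i) g < ereal e0 \<and> d_Gamma X (S i) g < ereal e0"
    using order_tendstoD(2)[OF lim(1)] order_tendstoD(2)[OF lim(2)] by (intro eventually_conj) auto
  then obtain i where "d_Gamma X (G i) g < ereal e0" "d_Gamma X (S i) g < ereal e0"
    using eventually_happens'[OF sequentially_bot] by blast
  then show False using e0(2)[of "G i" "S i"] GS[of i] by simp
qed

end

theorem theorem4p2:
  fixes X :: "'a::metric_space causal_space" and g :: "(real \<Rightarrow> 'a) set"
  assumes "lorentzian_pre_length_space X"
    and "globally_hyperbolic X"
    and "strongly_causal X"
    and "locally_causally_closed X"
    and "timelike_path_connected X"
    and "regular X"
    and "timelike_curvature_bounded_above_0 X"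
    and "g \<in> TGeo X"
  shows "(\<exists>U V F. timelike_family X g U V F \<and> family_continuous_at X g U V F \<and>
            unique_continuous_family X g U V F) \<and>
         reachable_along X g \<and> \<not> ultimate_conjugate_along X g"
proof -
  obtain \<gamma> where \<gamma>: "timelike_curve X \<gamma> 0 1"
    using assms(8) by (auto simp: TGeo_def timelike_geodesics_def elim!: quotientE)
  \<comment> \<open>A nowhere constant curve takes two different values, which provides
    \<open>nontrivial\<close>.\<close>
  have "\<exists>x y::'a. x \<noteq> y"
  proof (rule ccontr)
    assume "\<not> ?thesis"
    then have "\<gamma> constant_on {0..1}" unfolding constant_on_def by metis
    then show False using \<gamma> by (auto simp: timelike_curve_def lipschitz_nowhere_constant_def)
  qed
  then interpret curved_space X using assms by unfold_locales
  note family = family_exists[OF assms(8)]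
  then have "reachable_along X g" unfolding reachable_along_def by blast
  then show ?thesis
    using family not_symmetrically_conjugate[OF assms(8)]
    by (auto simp: ultimate_conjugate_along_def unreachable_conjugate_along_def)
qed

end
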